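(* Let $\Gamma$ be a junction and let the data $\lambda>0$, $(H_i)_{1\le i\le N}$, $(\nu_{ij})_{1\le i,j\le N}$, $B\in\mathbb{R}$, $(h_i)_{1\le i\le N}\subset\mathbb{R}$ satisfy the standing assumptions listed in the context. Then there exists a viscosity solution $u\in C(\Gamma)$ of the Kirchhoff--Dirichlet problem $$\lambda u(x)-\mathcal{I}_iu(x)+H_i(x,u_{x_i}(x))=0\ \ (x\in E_i,\ 1\le i\le N),\qquad \sum_{i=1}^N-u_{x_i}(O)=B,\qquad u_i(a_i)=h_i\ \ (1\le i\le N).$$ Moreover, $u\in C^{0,\gamma}(\Gamma)$ for every $\gamma\in(0,1)$, and $u$ is locally Lipschitz continuous in $\Gamma\setminus\{\mathbf{v}_i\}_{1\le i\le N}$.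
   Context: **Junction.** Let $d\ge 2$, $N\ge1$, $O=0\in\mathbb{R}^d$, and let $\mathbf{v}_1,\dots,\mathbf{v}_N\in\mathbb{R}^d\setminus\{O\}$ be pairwise non-collinear. Set $E_i=\{t\mathbf{v}_i: t\in(0,1)\}$ (these are pairwise disjoint), $a_i=|\mathbf{v}_i|$, $J_i=(0,a_i)$, $\Gamma=\bigcup_{i=1}^N\bar E_i$, $\gamma_i:[0,a_i]\to\bar E_i$, $\gamma_i(s)=s\,\mathbf{v}_i/a_i$. For $x\in\bar E_i$ write $x_i=|x|=\gamma_i^{-1}(x)$ ($x$ and $x_i$ are identified when convenient). The geodesic distance is $\rho(x,y)=|x-y|$ if $x,y$ lie in the same $\bar E_i$ and $\rho(x,y)=|x|+|y|$ if $x\in\bar E_i$, $y\in\bar E_j$, $i\ne j$. $B_\delta(x)=\{z\in\Gamma:\rho(x,z)<\delta\}$ and $B_\delta^c(x)=\Gamma\setminus B_\delta(x)$. **Function spaces.** For $u:\Gamma\to\mathbb{R}$ let $u_i=u\circ\gamma_i:[0,a_i]\to\mathbb{R}$. $USC(\Gamma)$ (resp. $LSC(\Gamma)$) is the set of $u:\Gamma\to\mathbb{R}$ with every $u_i$ upper (resp. lower) semicontinuous on $[0,a_i]$; $C(\Gamma)=USC(\Gamma)\cap LSC(\Gamma)$. $C^m(\Gamma)=\{u\in C(\Gamma): u_i\in C^m([0,a_i])\ \forall i\}$. $C^{0,\alpha}(\Gamma)$ is the set of $u\in C(\Gamma)$ with every $u_i$ $\alpha$-Hölder on $[0,a_i]$.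 For $u\in C^1(\Gamma)$ and $x\in\bar E_i$, $u_{x_i}(x)=u_i'(x_i)$ (one-sided at the endpoints). **Standing assumptions.** $\lambda>0$; $B,h_i\in\mathbb{R}$. $H_i\in C(\bar E_i\times\mathbb{R})$ and there is $C_H>1$ such that for all $i$, $x,y\in\bar E_i$, $p,q\in\mathbb{R}$: $|H_i(x,p)-H_i(y,p)|\le C_H(1+|p|)|x-y|$; $|H_i(x,p)-H_i(x,q)|\le C_H|p-q|$; $C_H^{-1}|p|-C_H\le H_i(x,p)\le C_H(1+|p|)$. The functions $\nu_{ij}:\bar E_i\times(0,\infty)\to[0,\infty)$ are measurable and there are $\Lambda>0$, $\sigma\in(0,1)$ with $0\le\nu_{ij}(x,r)\le\Lambda r^{-1-\sigma}$ and $|\nu_{ij}(x,r)-\nu_{ij}(y,r)|\le\Lambda r^{-1-\sigma}|x-y|$ for all $i,j$, $x,y\in\bar E_i$, $r>0$. **Nonlocal operators.** For measurable $A\subseteq\Gamma$ and $x\in\bar E_i$, $\mathcal{I}_i[A]\varphi(x)=\sum_{j=1}^N\int_{\{z\in J_j:\gamma_j(z)\in A\}}[\varphi_j(z)-\varphi(x)]\,\nu_{ij}(x,\rho(x,\gamma_j(z)))\,dz$ and $\mathcal{I}_i=\mathcal{I}_i[\Gamma]$. **Viscosity solutions.** For $\delta>0$, $x\in\bar E_i$, put $G_i^\delta(u,\varphi,p,x)=\lambda u(x)-\mathcal{I}_i[B_\delta^c(x)]u(x)-\mathcal{I}_i[B_\delta(x)]\varphi(x)+H_i(x,p)$. A function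 $u\in USC(\Gamma)$ is a viscosity subsolution of the problem if for every $x\in\Gamma$, $\delta>0$, $\varphi\in C^1(\Gamma)$ such that $x$ is a maximum point of $u-\varphi$ in $B_\delta(x)$: - $G_i^\delta(u,\varphi,\varphi_{x_i}(x),x)\le0$ if $x\in E_i$; - $\min\{\min_{1\le i\le N}G_i^\delta(u,\varphi,\varphi_{x_i}(O),O),\ \sum_{i}-\varphi_{x_i}(O)-B\}\le0$ if $x=O$; - $\min\{G_i^\delta(u,\varphi,\varphi_{x_i}(x),x),\ u(x)-h_i\}\le0$ if $x=\mathbf{v}_i$. $u\in LSC(\Gamma)$ is a viscosity supersolution if the analogous conditions hold with "minimum point" in place of "maximum point", every $\min$ replaced by $\max$, and $\le0$ replaced by $\ge0$. A viscosity solution is a function in $C(\Gamma)$ that is both. *)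

theory Defs
  imports "HOL-Analysis.Analysis"
begin

text \<open>
  A junction in \<open>real ^ 'd\<close> is given by the number \<open>N\<close> of its edges and the edge vectors
  \<open>v 1, \<dots>, v N\<close> (values of \<open>v\<close> outside \<open>{1..N}\<close> are irrelevant).
\<close>

definition junction :: "nat \<Rightarrow> (nat \<Rightarrow> real ^ 'd) \<Rightarrow> bool" where
  "junction N v \<longleftrightarrow> 2 \<le> CARD('d) \<and> 1 \<le> N \<and> (\<forall>i\<in>{1..N}. v i \<noteq> 0) \<and>
     (\<forall>i\<in>{1..N}. \<forall>j\<in>{1..N}. i \<noteq> j \<longrightarrow> \<not> collinear {0, v i, v j})"

definition edge :: "(nat \<Rightarrow> real ^ 'd) \<Rightarrow> nat \<Rightarrow> (real ^ 'd) set" where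
  "edge v i = {t *\<^sub>R v i | t. t \<in> {0<..<1}}"

abbreviation cedge :: "(nat \<Rightarrow> real ^ 'd) \<Rightarrow> nat \<Rightarrow> (real ^ 'd) set" where
  "cedge v i \<equiv> closure (edge v i)"

abbreviation edge_len :: "(nat \<Rightarrow> real ^ 'd) \<Rightarrow> nat \<Rightarrow> real" where
  "edge_len v i \<equiv> norm (v i)"

definition Gam :: "nat \<Rightarrow> (nat \<Rightarrow> real ^ 'd) \<Rightarrow> (real ^ 'd) set" where
  "Gam N v = (\<Union>i\<in>{1..N}. cedge v i)"

definition gam :: "(nat \<Rightarrow> real ^ 'd) \<Rightarrow> nat \<Rightarrow> real \<Rightarrow> real ^ 'd" where
  "gam v i s = (s / edge_len v i) *\<^sub>R v i"

definition geo :: "nat \<Rightarrow> (nat \<Rightarrow> real ^ 'd) \<Rightarrow> real ^ 'd \<Rightarrow> real ^ 'd \<Rightarrow> real" where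
  "geo N v x y = (if \<exists>i\<in>{1..N}. x \<in> cedge v i \<and> y \<in> cedge v i then norm (x - y)
                  else norm x + norm y)"

definition gball :: "nat \<Rightarrow> (nat \<Rightarrow> real ^ 'd) \<Rightarrow> real \<Rightarrow> real ^ 'd \<Rightarrow> (real ^ 'd) set" where
  "gball N v d x = {z \<in> Gam N v. geo N v x z < d}"


text \<open>
  Functions on the junction are total functions on \<open>real ^ 'd\<close>; every notion below only looks at
  their values on \<open>Gam N v\<close>.
\<close>

definition usc_on :: "real set \<Rightarrow> (real \<Rightarrow> real) \<Rightarrow> bool" where
  "usc_on S f \<longleftrightarrow> (\<forall>x\<in>S. \<forall>c>f x. \<forall>\<^sub>F y in at x within S. f y < c)"

definition lsc_on :: "real set \<Rightarrow> (real \<Rightarrow> real) \<Rightarrow> bool" where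
  "lsc_on S f \<longleftrightarrow> (\<forall>x\<in>S. \<forall>c<f x. \<forall>\<^sub>F y in at x within S. c < f y)"

definition USC :: "nat \<Rightarrow> (nat \<Rightarrow> real ^ 'd) \<Rightarrow> (real ^ 'd \<Rightarrow> real) set" where
  "USC N v = {u. \<forall>i\<in>{1..N}. usc_on {0..edge_len v i} (u \<circ> gam v i)}"

definition LSC :: "nat \<Rightarrow> (nat \<Rightarrow> real ^ 'd) \<Rightarrow> (real ^ 'd \<Rightarrow> real) set" where
  "LSC N v = {u. \<forall>i\<in>{1..N}. lsc_on {0..edge_len v i} (u \<circ> gam v i)}"

definition C0 :: "nat \<Rightarrow> (nat \<Rightarrow> real ^ 'd) \<Rightarrow> (real ^ 'd \<Rightarrow> real) set" where
  "C0 N v = USC N v \<inter> LSC N v"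

definition C1_on :: "real set \<Rightarrow> (real \<Rightarrow> real) \<Rightarrow> bool" where
  "C1_on S f \<longleftrightarrow> (\<exists>f'. (\<forall>s\<in>S. (f has_real_derivative f' s) (at s within S)) \<and> continuous_on S f')"

definition C1 :: "nat \<Rightarrow> (nat \<Rightarrow> real ^ 'd) \<Rightarrow> (real ^ 'd \<Rightarrow> real) set" where
  "C1 N v = {u \<in> C0 N v. \<forall>i\<in>{1..N}. C1_on {0..edge_len v i} (u \<circ> gam v i)}"

definition Hoelder :: "nat \<Rightarrow> (nat \<Rightarrow> real ^ 'd) \<Rightarrow> real \<Rightarrow> (real ^ 'd \<Rightarrow> real) set" where
  "Hoelder N v a = {u \<in> C0 N v. \<forall>i\<in>{1..N}. \<exists>C. \<forall>s\<in>{0..edge_len v i}. \<forall>t\<in>{0..edge_len v i}.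
     \<bar>(u \<circ> gam v i) s - (u \<circ> gam v i) t\<bar> \<le> C * \<bar>s - t\<bar> powr a}"

definition locally_Lipschitz ::
    "nat \<Rightarrow> (nat \<Rightarrow> real ^ 'd) \<Rightarrow> (real ^ 'd) set \<Rightarrow> (real ^ 'd \<Rightarrow> real) \<Rightarrow> bool" where
  "locally_Lipschitz N v S u \<longleftrightarrow> (\<forall>x\<in>S. \<exists>r>0. \<exists>L. \<forall>y\<in>S \<inter> gball N v r x. \<forall>z\<in>S \<inter> gball N v r x.
     \<bar>u y - u z\<bar> \<le> L * geo N v y z)"

text \<open>The derivative along edge \<open>i\<close> at a point of \<open>cedge v i\<close>; one-sided at both end points.\<close>

definition edge_deriv ::
    "(nat \<Rightarrow> real ^ 'd) \<Rightarrow> nat \<Rightarrow> (real ^ 'd \<Rightarrow> real) \<Rightarrow> real ^ 'd \<Rightarrow> real" where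
  "edge_deriv v i u x = vector_derivative (u \<circ> gam v i) (at (norm x) within {0..edge_len v i})"


text \<open>
  The integral is the Lebesgue integral, which is \<open>0\<close> by convention for a non-integrable integrand.
  In the definitions below it is applied to a \<open>C\<^sup>1\<close> function near \<open>x\<close> and to the candidate
  \<open>u\<close> away from \<open>x\<close>; under the growth bound \<open>\<nu>\<^sub>i\<^sub>j(x, r) \<le> \<Lambda> r\<^sup>-\<^sup>1\<^sup>-\<^sup>\<sigma>\<close>
  with \<open>\<sigma> < 1\<close> both integrals converge absolutely whenever \<open>u\<close> is continuous on the junction.
  The convention can therefore only be seen for an unbounded semicontinuous \<open>u\<close>,
  never for a viscosity solution.
\<close>

definition nonloc :: "nat \<Rightarrow> (nat \<Rightarrow> real ^ 'd) \<Rightarrow> (nat \<Rightarrow> nat \<Rightarrow> real ^ 'd \<Rightarrow> real \<Rightarrow> real) \<Rightarrow>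
    nat \<Rightarrow> (real ^ 'd) set \<Rightarrow> (real ^ 'd \<Rightarrow> real) \<Rightarrow> real ^ 'd \<Rightarrow> real" where
  "nonloc N v nu i A f x = (\<Sum>j=1..N.
     set_lebesgue_integral lebesgue {z \<in> {0<..<edge_len v j}. gam v j z \<in> A}
       (\<lambda>z. (f (gam v j z) - f x) * nu i j x (geo N v x (gam v j z))))"

definition Gop :: "nat \<Rightarrow> (nat \<Rightarrow> real ^ 'd) \<Rightarrow> real \<Rightarrow> (nat \<Rightarrow> real ^ 'd \<Rightarrow> real \<Rightarrow> real) \<Rightarrow>
    (nat \<Rightarrow> nat \<Rightarrow> real ^ 'd \<Rightarrow> real \<Rightarrow> real) \<Rightarrow>
    nat \<Rightarrow> real \<Rightarrow> (real ^ 'd \<Rightarrow> real) \<Rightarrow> (real ^ 'd \<Rightarrow> real) \<Rightarrow> real \<Rightarrow> real ^ 'd \<Rightarrow> real" where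
  "Gop N v lam H nu i d u f p x =
     lam * u x - nonloc N v nu i (Gam N v - gball N v d x) u x
       - nonloc N v nu i (gball N v d x) f x + H i x p"

definition visc_subsolution :: "nat \<Rightarrow> (nat \<Rightarrow> real ^ 'd) \<Rightarrow> real \<Rightarrow>
    (nat \<Rightarrow> real ^ 'd \<Rightarrow> real \<Rightarrow> real) \<Rightarrow> (nat \<Rightarrow> nat \<Rightarrow> real ^ 'd \<Rightarrow> real \<Rightarrow> real) \<Rightarrow>
    real \<Rightarrow> (nat \<Rightarrow> real) \<Rightarrow> (real ^ 'd \<Rightarrow> real) \<Rightarrow> bool" where
  "visc_subsolution N v lam H nu B h u \<longleftrightarrow> u \<in> USC N v \<and>
     (\<forall>x\<in>Gam N v. \<forall>d>0. \<forall>f\<in>C1 N v. (\<forall>y\<in>gball N v d x. u y - f y \<le> u x - f x) \<longrightarrow>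
        (\<forall>i\<in>{1..N}. x \<in> edge v i \<longrightarrow> Gop N v lam H nu i d u f (edge_deriv v i f x) x \<le> 0) \<and>
        (x = 0 \<longrightarrow>
           min (Min ((\<lambda>i. Gop N v lam H nu i d u f (edge_deriv v i f 0) 0) ` {1..N}))
               ((\<Sum>i=1..N. - edge_deriv v i f 0) - B) \<le> 0) \<and>
        (\<forall>i\<in>{1..N}. x = v i \<longrightarrow>
           min (Gop N v lam H nu i d u f (edge_deriv v i f x) x) (u x - h i) \<le> 0))"

definition visc_supersolution :: "nat \<Rightarrow> (nat \<Rightarrow> real ^ 'd) \<Rightarrow> real \<Rightarrow>
    (nat \<Rightarrow> real ^ 'd \<Rightarrow> real \<Rightarrow> real) \<Rightarrow> (nat \<Rightarrow> nat \<Rightarrow> real ^ 'd \<Rightarrow> real \<Rightarrow> real) \<Rightarrow>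
    real \<Rightarrow> (nat \<Rightarrow> real) \<Rightarrow> (real ^ 'd \<Rightarrow> real) \<Rightarrow> bool" where
  "visc_supersolution N v lam H nu B h u \<longleftrightarrow> u \<in> LSC N v \<and>
     (\<forall>x\<in>Gam N v. \<forall>d>0. \<forall>f\<in>C1 N v. (\<forall>y\<in>gball N v d x. u x - f x \<le> u y - f y) \<longrightarrow>
        (\<forall>i\<in>{1..N}. x \<in> edge v i \<longrightarrow> Gop N v lam H nu i d u f (edge_deriv v i f x) x \<ge> 0) \<and>
        (x = 0 \<longrightarrow>
           max (Max ((\<lambda>i. Gop N v lam H nu i d u f (edge_deriv v i f 0) 0) ` {1..N}))
               ((\<Sum>i=1..N. - edge_deriv v i f 0) - B) \<ge> 0) \<and>
        (\<forall>i\<in>{1..N}. x = v i \<longrightarrow>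
           max (Gop N v lam H nu i d u f (edge_deriv v i f x) x) (u x - h i) \<ge> 0))"

text \<open>
  Viscosity solutions of the Kirchhoff-Dirichlet problem; the Kirchhoff condition at the vertex
  and the Dirichlet conditions at the outer end points hold in the generalised (relaxed) sense.
\<close>

definition visc_solution :: "nat \<Rightarrow> (nat \<Rightarrow> real ^ 'd) \<Rightarrow> real \<Rightarrow>
    (nat \<Rightarrow> real ^ 'd \<Rightarrow> real \<Rightarrow> real) \<Rightarrow> (nat \<Rightarrow> nat \<Rightarrow> real ^ 'd \<Rightarrow> real \<Rightarrow> real) \<Rightarrow>
    real \<Rightarrow> (nat \<Rightarrow> real) \<Rightarrow> (real ^ 'd \<Rightarrow> real) \<Rightarrow> bool" where
  "visc_solution N v lam H nu B h u \<longleftrightarrow> u \<in> C0 N v \<and>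
     visc_subsolution N v lam H nu B h u \<and> visc_supersolution N v lam H nu B h u"


text \<open>
  Joint measurability of a kernel on \<open>cedge v i \<times> {0<..}\<close>, in the Lebesgue sense with
  respect to arc length on the edge; it is implied by Borel measurability.
\<close>

definition kernel_measurable :: "(nat \<Rightarrow> real ^ 'd) \<Rightarrow> nat \<Rightarrow> (real ^ 'd \<Rightarrow> real \<Rightarrow> real) \<Rightarrow> bool"
  where
  "kernel_measurable v i k \<longleftrightarrow>
     (\<lambda>(s, r). k (gam v i s) r) \<in> borel_measurable (lebesgue_on ({0..edge_len v i} \<times> {0<..}))"

end

theory Submission
  imports Defs
begin

text \<open>
  Perron's method, without a comparison principle. Since \<open>\<sigma> < 1\<close>, the nonlocal term is classically
  defined on Lipschitz functions, so the equation becomes a local one in the sub- and superjets. Coercivity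
  of \<open>H\<close> bounds the slopes of a Lipschitz subsolution \<open>w\<close> with \<open>\<bar>w\<bar> \<le> M\<close> by \<open>C (1 + I w)\<close>, and
  \<open>I w \<le> \<theta> K + C\<^sub>\<theta>\<close> if \<open>w\<close> is \<open>K\<close>-Lipschitz; for small \<open>\<theta>\<close> this gives a Lipschitz constant that depends
  on the data only. Hence the supremum of these subsolutions is Lipschitz. It is a subsolution by stability,
  and a supersolution because otherwise it could be raised by a small bump; at a point where it equals \<open>M\<close>
  it is a supersolution anyway.
\<close>

section \<open>Superjets in one variable\<close>

text \<open>The class \<open>candidates\<close> has to meet two opposed demands. A raised envelope
  must belong to it again, so no Lipschitz constant may be prescribed; yet one constant must serve
  all members, so that the supremum inherits it. What resolves this is that each member has some
  finite constant: the equation turns a constant \<open>K\<close> into \<open>K / 2 + D\<close>, and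
  iteration brings every member down to \<open>2 * D\<close>. The other obstacle is the vertex,
  whose condition is a disjunction over the legs. For stability, the interior inequality has no
  alternative, so the contact points of an approximating candidate cannot leave the vertex on any
  leg, and the slopes in the Kirchhoff sum are kept exactly. For raising, all legs are lifted by one
  common height, and the strict deficit in the Kirchhoff sum pays for the change of slopes. The
  function obtained is Lipschitz up to the outer ends. This is compatible with arbitrary
  \<open>h\<close> because the Dirichlet condition is relaxed and its data may be missed.\<close>

text \<open>Touching from above to first order, relative to \<open>S\<close> and hence one-sided at
  an end point: at the left end every larger slope qualifies too, at the right end every smaller
  one. Subjets get no definition of their own: \<open>q\<close> is a subjet slope of
  \<open>f\<close> when \<open>- q\<close> is a superjet slope of \<open>- f\<close>.\<close>

definition superjet :: "real set \<Rightarrow> (real \<Rightarrow> real) \<Rightarrow> real \<Rightarrow> real \<Rightarrow> bool" where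
  "superjet S f x p \<longleftrightarrow>
     (\<forall>e>0. \<exists>d>0. \<forall>t\<in>S. \<bar>t - x\<bar> < d \<longrightarrow> f t \<le> f x + p * (t - x) + e * \<bar>t - x\<bar>)"

lemma superjetD:
  assumes "superjet S f x p" "0 < e"
  obtains d where "0 < d"
    "\<And>t. t \<in> S \<Longrightarrow> \<bar>t - x\<bar> < d \<Longrightarrow> f t \<le> f x + p * (t - x) + e * \<bar>t - x\<bar>"
  using assms unfolding superjet_def by metis

lemma superjet_mono:
  assumes "superjet S f x p" "\<And>t. t \<in> S \<Longrightarrow> g t \<le> f t" "g x = f x"
  shows "superjet S g x p"
  using assms unfolding superjet_def by (metis order_trans)

text \<open>The bridge from test functions to jets: only the derivative at the contact point enters,
  and the point may be an end of \<open>S\<close>.\<close>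

lemma superjet_touch_deriv:
  assumes "(\<phi> has_real_derivative p) (at x within S)" "0 < r"
    and "\<And>t. t \<in> S \<Longrightarrow> \<bar>t - x\<bar> < r \<Longrightarrow> f t - \<phi> t \<le> f x - \<phi> x"
  shows "superjet S f x p"
  unfolding superjet_def
proof (intro allI impI)
  fix e :: real assume "0 < e"
  with assms(1) obtain d where d: "0 < d"
    "\<And>t. t \<in> S \<Longrightarrow> \<bar>t - x\<bar> < d \<Longrightarrow> \<bar>\<phi> t - \<phi> x - p * (t - x)\<bar> \<le> e * \<bar>t - x\<bar>"
    unfolding has_field_derivative_def has_derivative_within_alt by (auto simp: real_norm_def)
  have "f t \<le> f x + p * (t - x) + e * \<bar>t - x\<bar>" if "t \<in> S" "\<bar>t - x\<bar> < min d r" for t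
  proof -
    have "f t - \<phi> t \<le> f x - \<phi> x" "\<bar>\<phi> t - \<phi> x - p * (t - x)\<bar> \<le> e * \<bar>t - x\<bar>"
      using assms(3)[of t] d(2)[of t] that by auto
    then show ?thesis by linarith
  qed
  then show "\<exists>d>0. \<forall>t\<in>S. \<bar>t - x\<bar> < d \<longrightarrow> f t \<le> f x + p * (t - x) + e * \<bar>t - x\<bar>"
    using d(1) assms(2) by (intro exI[of _ "min d r"]) auto
qed

text \<open>At one point \<open>x + k\<close> with small \<open>k\<close>, the line below and the
  jet above give \<open>m * k \<le> (p + e) * k\<close>. Only a right neighbourhood occurs, so the
  bound is available at the left end of a leg.\<close>

lemma superjet_ge:
  assumes "superjet S f x p" "0 < d" "{x..x + d} \<subseteq> S"
    and "\<And>t. t \<in> {x..x + d} \<Longrightarrow> f x + m * (t - x) \<le> f t"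
  shows "m \<le> p"
proof (rule field_le_epsilon)
  fix e :: real assume "0 < e"
  with assms(1) obtain d' where d': "0 < d'"
    "\<And>t. t \<in> S \<Longrightarrow> \<bar>t - x\<bar> < d' \<Longrightarrow> f t \<le> f x + p * (t - x) + e * \<bar>t - x\<bar>"
    unfolding superjet_def by blast
  define k where "k = min d (d' / 2)"
  have k: "0 < k" "k \<le> d" "k < d'" using assms(2) d'(1) by (auto simp: k_def)
  have "x + k \<in> S" using k assms(3) by auto
  then have "f x + m * k \<le> f x + p * k + e * k"
    using assms(4)[of "x + k"] d'(2)[of "x + k"] k by auto
  then have "m * k \<le> (p + e) * k" by (simp add: algebra_simps)
  then show "m \<le> p + e" using k(1) by simp
qed

lemma superjet_reflect:
  "superjet S f x p \<Longrightarrow> superjet (uminus ` S) (\<lambda>t. f (- t)) (- x) (- p)"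
  unfolding superjet_def
proof (intro allI impI)
  fix e :: real assume "0 < e"
    "\<forall>e>0. \<exists>d>0. \<forall>t\<in>S. \<bar>t - x\<bar> < d \<longrightarrow> f t \<le> f x + p * (t - x) + e * \<bar>t - x\<bar>"
  then obtain d where d: "0 < d"
    "\<And>t. t \<in> S \<Longrightarrow> \<bar>t - x\<bar> < d \<Longrightarrow> f t \<le> f x + p * (t - x) + e * \<bar>t - x\<bar>" by blast
  have "f (- t) \<le> f (- (- x)) + - p * (t - (- x)) + e * \<bar>t - (- x)\<bar>"
    if "t \<in> uminus ` S" "\<bar>t - (- x)\<bar> < d" for t
  proof -
    have "\<bar>t - (- x)\<bar> = \<bar>- t - x\<bar>" by linarith
    then show ?thesis using d(2)[of "- t"] that by (auto simp: algebra_simps)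
  qed
  then show "\<exists>d>0. \<forall>t\<in>uminus ` S. \<bar>t - (- x)\<bar> < d \<longrightarrow>
      f (- t) \<le> f (- (- x)) + - p * (t - (- x)) + e * \<bar>t - (- x)\<bar>"
    using d(1) by blast
qed

lemma superjet_le:
  assumes "superjet S f x p" "0 < d" "{x - d..x} \<subseteq> S"
    and "\<And>t. t \<in> {x - d..x} \<Longrightarrow> f x + m * (t - x) \<le> f t"
  shows "p \<le> m"
proof -
  have "- m \<le> - p"
  proof (rule superjet_ge[OF superjet_reflect[OF assms(1)] assms(2)])
    have "{- x..- x + d} = uminus ` {x - d..x}" by simp
    then show "{- x..- x + d} \<subseteq> uminus ` S" using assms(3) by blast
    show "f (- (- x)) + - m * (t - (- x)) \<le> f (- t)" if "t \<in> {- x..- x + d}" for t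
      using assms(4)[of "- t"] that by (auto simp: algebra_simps)
  qed
  then show ?thesis by simp
qed

text \<open>The barrier \<open>\<theta> / (y - z)\<close> is increasing and keeps the maximum point away from \<open>y\<close>.\<close>

lemma superjet_mean_value:
  assumes "x < y" "continuous_on {x..y} f" "m * (y - x) < f y - f x"
  obtains z p where "x < z" "z < y" "m \<le> p" "superjet {x..y} f z p"
proof -
  define g where "g z = f z - m * z" for z
  have gc: "continuous_on {x..y} g" unfolding g_def by (intro continuous_intros assms)
  have gxy: "g x < g y" using assms(3) by (simp add: g_def algebra_simps)
  obtain d where d: "0 < d" "\<And>t. t \<in> {x..y} \<Longrightarrow> \<bar>t - y\<bar> < d \<Longrightarrow> \<bar>g t - g y\<bar> < g y - g x"
    using continuous_on_iff[THEN iffD1, OF gc, rule_format, of y "g y - g x"] gxy assms(1)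
    by (auto simp: dist_real_def)
  \<comment> \<open>Close enough to \<open>y\<close> for \<open>g x < g z1\<close>, by continuity at
    \<open>y\<close>.\<close>
  define z1 where "z1 = max ((x + y) / 2) (y - d / 2)"
  have z1: "x < z1" "z1 < y" "\<bar>z1 - y\<bar> < d" using assms(1) d(1) unfolding z1_def by (simp_all add: max_def abs_if field_simps)
  have gz1: "g x < g z1" using d(2)[of z1] z1 by auto
  \<comment> \<open>Makes the barrier at \<open>z1\<close> half of \<open>g z1 - g x\<close>. Then
    \<open>\<Phi> z1\<close> is the mean of \<open>g x\<close> and \<open>g z1\<close> and exceeds
    \<open>\<Phi> x\<close>.\<close>
  define \<theta> where "\<theta> = (g z1 - g x) / 2 * (y - z1)"
  have \<theta>: "0 < \<theta>" using gz1 z1 by (simp add: \<theta>_def)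
  obtain C where C: "\<And>t. t \<in> {x..y} \<Longrightarrow> g t \<le> C"
    using compact_imp_bounded[OF compact_continuous_image[OF gc compact_Icc]]
    unfolding bounded_iff by (metis abs_le_D1 imageI real_norm_def)
  define \<Phi> where "\<Phi> z = g z - \<theta> / (y - z)" for z
  \<comment> \<open>The barrier equals \<open>D\<close> at \<open>y2\<close> and
    \<open>C - D < \<Phi> z1\<close>, so the maximum over \<open>{x..y2}\<close> is attained at
    neither end.\<close>
  define D where "D = max 1 (C - \<Phi> z1 + 1)"
  have D: "0 < D" "C - D < \<Phi> z1" by (auto simp: D_def)
  define y2 where "y2 = y - \<theta> / D"
  have Dy2: "\<theta> / (y - y2) = D" using \<theta> D by (simp add: y2_def)
  have \<Phi>x: "\<Phi> x < \<Phi> z1"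
  proof -
    have "\<theta> / (y - z1) = (g z1 - g x) / 2" 
      unfolding \<theta>_def using z1 by (intro nonzero_mult_div_cancel_right) simp
    moreover have "0 < \<theta> / (y - x)" using \<theta> assms(1) by simp
    ultimately have "- (\<theta> / (y - x)) < 0" "g z1 - \<theta> / (y - z1) = (g z1 + g x) / 2"
      by (simp_all add: field_simps)
    then show ?thesis using gz1 unfolding \<Phi>_def by argo
  qed
  have y2: "y2 < y" using \<theta> D by (simp add: y2_def)
  have y2z1: "z1 < y2"
  proof (rule ccontr)
    assume "\<not> ?thesis"
    then have "\<theta> / (y - y2) \<le> \<theta> / (y - z1)"
      using \<theta> z1 y2 by (intro divide_left_mono mult_pos_pos) simp_all
    then have "D \<le> \<theta> / (y - z1)" using Dy2 by simp
    then have "\<Phi> z1 \<le> C - D" using C[of z1] z1 by (simp add: \<Phi>_def)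
    then show False using D by simp
  qed
  have \<Phi>y2: "\<Phi> y2 < \<Phi> z1" using C[of y2] D Dy2 y2z1 z1 y2 by (simp add: \<Phi>_def)
  have "continuous_on {x..y2} \<Phi>" unfolding \<Phi>_def
    using y2 by (intro continuous_intros continuous_on_subset[OF gc]) auto
  then obtain z where z: "z \<in> {x..y2}" "\<And>t. t \<in> {x..y2} \<Longrightarrow> \<Phi> t \<le> \<Phi> z"
    using continuous_attains_sup[of "{x..y2}" \<Phi>] y2z1 z1 by auto
  have "\<Phi> z1 \<le> \<Phi> z" using z(2)[of z1] y2z1 z1 by auto
  then have zz: "x < z" "z < y2" using z(1) \<Phi>x \<Phi>y2 by (auto simp: order_less_le)
  define p where "p = m + \<theta> / (y - z)\<^sup>2"
  have der: "((\<lambda>t. m * t + \<theta> / (y - t)) has_real_derivative p) (at z within S)" for S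
    unfolding p_def using zz y2
    by (auto intro!: derivative_eq_intros simp: power2_eq_square field_simps)
  have jet: "superjet S f z p" if "S \<subseteq> {x..y}" for S
  proof (rule superjet_touch_deriv[OF der, of "y2 - z"])
    show "0 < y2 - z" using zz by simp
    show "f t - (m * t + \<theta> / (y - t)) \<le> f z - (m * z + \<theta> / (y - z))"
      if "t \<in> S" "\<bar>t - z\<bar> < y2 - z" for t
    proof -
      have "x \<le> t" using that(1) \<open>S \<subseteq> {x..y}\<close> by auto
      moreover have "t \<le> y2" using that(2) by linarith
      ultimately show ?thesis using z(2)[of t] by (simp add: \<Phi>_def g_def algebra_simps)
    qed
  qed
  show ?thesis
    by (rule that[of z p]) (use zz y2 \<theta> jet in \<open>auto simp: p_def\<close>)
qed

text \<open>Superjets alone suffice, which matters because a subsolution controls nothing else: a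
  difference quotient beyond \<open>K\<close> in either direction yields an interior superjet slope
  of modulus larger than \<open>K\<close>, in the falling case after reflection.\<close>

lemma lipschitz_if_superjets_bounded:
  assumes "continuous_on {0..a} f"
    and b: "\<And>s p. 0 < s \<Longrightarrow> s < a \<Longrightarrow> superjet {0..a} f s p \<Longrightarrow> \<bar>p\<bar> \<le> K"
    and "s \<in> {0..a}" "t \<in> {0..a}"
  shows "\<bar>f s - f t\<bar> \<le> K * \<bar>s - t\<bar>"
proof -
  \<comment> \<open>Jets at an interior point are local, so they pass from \<open>{x..y}\<close> to
    the whole leg.\<close>
  have ext: "superjet {0..a} f z p"
    if "superjet {x..y} f z p" "0 \<le> x" "y \<le> a" "x < z" "z < y" for x y z p and f :: "real \<Rightarrow> real"
    unfolding superjet_def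
  proof (intro allI impI)
    fix e :: real assume "0 < e"
    from superjetD[OF that(1) this] obtain d where d: "0 < d"
      "\<And>t. t \<in> {x..y} \<Longrightarrow> \<bar>t - z\<bar> < d \<Longrightarrow> f t \<le> f z + p * (t - z) + e * \<bar>t - z\<bar>"
      by metis
    define d' where "d' = min d (min (z - x) (y - z))"
    have "0 < d'" using d(1) that by (simp add: d'_def)
    moreover have "f t \<le> f z + p * (t - z) + e * \<bar>t - z\<bar>" if "\<bar>t - z\<bar> < d'" for t
    proof -
      have "x \<le> t" "t \<le> y" "\<bar>t - z\<bar> < d" using that unfolding d'_def by linarith+
      then show ?thesis using d(2)[of t] by simp
    qed
    ultimately show "\<exists>d>0. \<forall>t\<in>{0..a}. \<bar>t - z\<bar> < d \<longrightarrow> f t \<le> f z + p * (t - z) + e * \<bar>t - z\<bar>"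
      by blast
  qed
  have main: "\<bar>f y - f x\<bar> \<le> K * (y - x)" if xy: "x < y" "x \<in> {0..a}" "y \<in> {0..a}" for x y
  proof (rule ccontr)
    assume "\<not> ?thesis"
    then consider "K * (y - x) < f y - f x" | "K * (y - x) < f x - f y" by linarith
    then show False
    proof cases
      case 1
      then have "K < (f y - f x) / (y - x)" using xy(1) by (simp add: pos_less_divide_eq)
      \<comment> \<open>A strictly intermediate slope, because the mean value lemma only gives
        \<open>m \<le> p\<close>.\<close>
      then obtain m where "K < m" "m < (f y - f x) / (y - x)" using dense by blast
      then have m: "K < m" "m * (y - x) < f y - f x" using xy(1) by (simp_all add: pos_less_divide_eq)
      have "continuous_on {x..y} f" using assms(1) xy by (auto elim: continuous_on_subset)
      from superjet_mean_value[OF xy(1) this m(2)] obtain z p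
        where "x < z" "z < y" "m \<le> p" "superjet {x..y} f z p" by metis
      then show False using ext[of x y f z p] b[of z p] m xy by auto
    next
      case 2
      then have "K < (f x - f y) / (y - x)" using xy(1) by (simp add: pos_less_divide_eq)
      then obtain m where "K < m" "m < (f x - f y) / (y - x)" using dense by blast
      then have m: "K < m" "m * (y - x) < f x - f y" using xy(1) by (simp_all add: pos_less_divide_eq)
      have "continuous_on {- y..- x} (\<lambda>t. f (- t))"
        using assms(1) xy by (intro continuous_on_compose2[OF assms(1)] continuous_intros) auto
      moreover have "- y < - x" "m * (- x - - y) < f (- (- x)) - f (- (- y))" using xy m by simp_all
      ultimately obtain z p
        where z: "- y < z" "z < - x" "m \<le> p" "superjet {- y..- x} (\<lambda>t. f (- t)) z p"
        using superjet_mean_value[of "- y" "- x" "\<lambda>t. f (- t)" m] by metis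
      have "superjet {x..y} f (- z) (- p)" using superjet_reflect[OF z(4)] by simp
      then show False using ext[of x y f "- z" "- p"] b[of "- z" "- p"] m xy z by auto
    qed
  qed
  consider "s < t" | "s = t" | "t < s" by linarith
  then show ?thesis using main[of s t] main[of t s] assms(3,4) by cases auto
qed

text \<open>A continuous function below \<open>u\<close> and almost equal to it at \<open>s\<close> has a maximum point near \<open>s\<close>
  after subtraction of a steep parabola with slope \<open>p\<close> at \<open>s\<close>.\<close>

lemma superjet_perturb:
  assumes "superjet {0..a} u s p" "s \<in> {0..a}" "0 < \<delta>"
  obtains \<eta> where "0 < \<eta>"
    "\<And>w. continuous_on {0..a} w \<Longrightarrow> (\<And>t. t \<in> {0..a} \<Longrightarrow> w t \<le> u t) \<Longrightarrow> u s - \<eta> \<le> w s \<Longrightarrow>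
      \<exists>t\<in>{0..a}. \<exists>p'. \<bar>t - s\<bar> < \<delta> \<and> \<bar>p' - p\<bar> \<le> \<delta> \<and> (t = s \<longrightarrow> p' = p) \<and> superjet {0..a} w t p'"
proof -
  obtain r0 where r0: "0 < r0"
    "\<And>t. t \<in> {0..a} \<Longrightarrow> \<bar>t - s\<bar> < r0 \<Longrightarrow> u t \<le> u s + p * (t - s) + \<delta> / 4 * \<bar>t - s\<bar>"
    using assms(1,3) unfolding superjet_def by (metis zero_less_divide_iff zero_less_numeral)
  define r where "r = min (r0 / 2) (\<delta> / 2)"
  have r: "0 < r" "r < r0" "r < \<delta>" using r0(1) assms(3) by (auto simp: r_def)
  \<comment> \<open>The parabola adds \<open>\<delta> * r / 2\<close> at distance \<open>r\<close>,
    where the jet error is at most \<open>\<delta> * r / 4\<close>. The surplus beats the gap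
    \<open>\<delta> * r / 8\<close>, so the maximum is not attained at distance \<open>r\<close>.
    The slope changes by at most \<open>2 * k * r = \<delta>\<close>.\<close>
  define k where "k = \<delta> / (2 * r)"
  define \<phi> where "\<phi> t = p * (t - s) + k * (t - s)\<^sup>2" for t
  have kr: "k * r = \<delta> / 2" "0 < k" using r assms(3) by (simp_all add: k_def)
  show ?thesis
  proof (rule that[of "\<delta> * r / 8"])
    show "0 < \<delta> * r / 8" using r assms(3) by simp
    fix w assume w: "continuous_on {0..a} w" "\<And>t. t \<in> {0..a} \<Longrightarrow> w t \<le> u t" "u s - \<delta> * r / 8 \<le> w s"
    \<comment> \<open>Cut off at the ends of the leg; a maximum attained there is admissible, since
      jets are relative to the leg.\<close>
    define A where "A = {max 0 (s - r)..min a (s + r)}"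
    have A: "A \<subseteq> {0..a}" "s \<in> A" "\<And>t. t \<in> {0..a} \<Longrightarrow> \<bar>t - s\<bar> \<le> r \<Longrightarrow> t \<in> A"
      "\<And>t. t \<in> A \<Longrightarrow> \<bar>t - s\<bar> \<le> r"
      using assms(2) r by (auto simp: A_def)
    have "continuous_on A (\<lambda>t. w t - \<phi> t)" unfolding \<phi>_def
      by (intro continuous_intros continuous_on_subset[OF w(1) A(1)])
    then obtain t where t: "t \<in> A" "\<And>t'. t' \<in> A \<Longrightarrow> w t' - \<phi> t' \<le> w t - \<phi> t"
      using continuous_attains_sup[of A "\<lambda>t. w t - \<phi> t"] A(2) by (auto simp: A_def)
    have "\<bar>t - s\<bar> \<noteq> r"
    proof
      assume *: "\<bar>t - s\<bar> = r"
      then have "k * (t - s)\<^sup>2 = \<delta> / 2 * r"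
        using kr(1) by (metis mult.assoc power2_abs power2_eq_square)
      then have "w t - \<phi> t \<le> u s - \<delta> / 4 * r"
        using w(2)[of t] r0(2)[of t] t(1) A(1) * r(2) unfolding \<phi>_def by auto
      moreover have "w s - \<phi> s \<le> w t - \<phi> t" using t A by auto
      ultimately have "w s \<le> u s - \<delta> * r / 4" by (simp add: \<phi>_def)
      moreover have "0 < \<delta> * r" using assms r by simp
      ultimately show False using w(3) by linarith
    qed
    then have tr: "\<bar>t - s\<bar> < r" using A(4)[OF t(1)] by simp
    define p' where "p' = p + 2 * k * (t - s)"
    have der: "(\<phi> has_real_derivative p') (at t within {0..a})"
      unfolding \<phi>_def p'_def by (auto intro!: derivative_eq_intros)
    have "superjet {0..a} w t p'"
    proof (rule superjet_touch_deriv[OF der, of "r - \<bar>t - s\<bar>"])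
      show "w t' - \<phi> t' \<le> w t - \<phi> t" if "t' \<in> {0..a}" "\<bar>t' - t\<bar> < r - \<bar>t - s\<bar>" for t'
        using t(2) A(3)[of t'] that by auto
    qed (use tr in auto)
    moreover have "\<bar>p' - p\<bar> \<le> \<delta>"
    proof -
      have "\<bar>p' - p\<bar> = 2 * (k * \<bar>t - s\<bar>)" using kr by (simp add: p'_def abs_mult)
      also have "\<dots> \<le> 2 * (k * r)" using tr kr by auto
      finally show ?thesis using kr by simp
    qed
    ultimately show "\<exists>t\<in>{0..a}. \<exists>p'. \<bar>t - s\<bar> < \<delta> \<and> \<bar>p' - p\<bar> \<le> \<delta> \<and> (t = s \<longrightarrow> p' = p) \<and> superjet {0..a} w t p'"
      using tr r t(1) A(1) by (intro bexI[of _ t] exI[of _ p']) (auto simp: p'_def)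
  qed
qed

section \<open>The local problem on a star\<close>

text \<open>Functions live on separate legs in arc length. Agreement at 0 glues them, and together
  with the leg bounds it gives the constant \<open>K\<close> for the geodesic distance, see
  \<open>star_lipschitz_offset\<close>.\<close>

definition star_lipschitz :: "nat \<Rightarrow> (nat \<Rightarrow> real) \<Rightarrow> real \<Rightarrow> (nat \<Rightarrow> real \<Rightarrow> real) \<Rightarrow> bool" where
  "star_lipschitz N a K U \<longleftrightarrow> 0 \<le> K \<and>
     (\<forall>i\<in>{1..N}. \<forall>s\<in>{0..a i}. \<forall>t\<in>{0..a i}. \<bar>U i s - U i t\<bar> \<le> K * \<bar>s - t\<bar>) \<and>
     (\<forall>i\<in>{1..N}. \<forall>j\<in>{1..N}. U i 0 = U j 0)"

lemma star_lipschitzD: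
  assumes "star_lipschitz N a K U" "i \<in> {1..N}"
  shows "s \<in> {0..a i} \<Longrightarrow> t \<in> {0..a i} \<Longrightarrow> \<bar>U i s - U i t\<bar> \<le> K * \<bar>s - t\<bar>"
    and "j \<in> {1..N} \<Longrightarrow> U i 0 = U j 0" and "0 \<le> K"
  using assms unfolding star_lipschitz_def by blast+

lemma star_lipschitz_nonneg: "star_lipschitz N a K U \<Longrightarrow> 0 \<le> K"
  unfolding star_lipschitz_def by blast

lemma star_lipschitzI:
  assumes "0 \<le> K"
    and "\<And>i s t. i \<in> {1..N} \<Longrightarrow> s \<in> {0..a i} \<Longrightarrow> t \<in> {0..a i} \<Longrightarrow> \<bar>U i s - U i t\<bar> \<le> K * \<bar>s - t\<bar>"
    and "\<And>i j. i \<in> {1..N} \<Longrightarrow> j \<in> {1..N} \<Longrightarrow> U i 0 = U j 0"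
  shows "star_lipschitz N a K U"
  using assms unfolding star_lipschitz_def by blast

lemma star_lipschitz_mono:
  assumes "star_lipschitz N a K U" "K \<le> L"
  shows "star_lipschitz N a L U"
proof -
  have *: "K * \<bar>s - t\<bar> \<le> L * \<bar>s - t\<bar>" for s t :: real
    using assms(2) by (intro mult_right_mono) auto
  show ?thesis
  proof (rule star_lipschitzI)
    show "0 \<le> L" using star_lipschitz_nonneg[OF assms(1)] assms(2) by linarith
    show "\<bar>U i s - U i t\<bar> \<le> L * \<bar>s - t\<bar>" if "i \<in> {1..N}" "s \<in> {0..a i}" "t \<in> {0..a i}" for i s t
      using star_lipschitzD(1)[OF assms(1) that] * order_trans by blast
    show "U i 0 = U j 0" if "i \<in> {1..N}" "j \<in> {1..N}" for i j
      using star_lipschitzD(2)[OF assms(1) that] .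
  qed
qed

lemma star_lipschitz_continuous_on:
  assumes "star_lipschitz N a K U" "i \<in> {1..N}"
  shows "continuous_on {0..a i} (U i)"
proof (rule lipschitz_on_continuous_on)
  show "K-lipschitz_on {0..a i} (U i)"
    using star_lipschitzD[OF assms] by (auto simp: lipschitz_on_def dist_real_def)
qed

text \<open>Closes the iteration in \<open>lip_uniform\<close>, whose constants only converge to the
  final one.\<close>

lemma star_lipschitz_if_larger:
  assumes "\<And>L. K < L \<Longrightarrow> star_lipschitz N a L U" "0 \<le> K"
  shows "star_lipschitz N a K U"
proof -
  have "\<bar>U i s - U i t\<bar> \<le> K * \<bar>s - t\<bar>"
    if *: "i \<in> {1..N}" "s \<in> {0..a i}" "t \<in> {0..a i}" for i s t
  proof (rule field_le_epsilon)
    fix e :: real assume e: "0 < e"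
    define L where "L = K + e / (\<bar>s - t\<bar> + 1)"
    have "K < L" using e by (simp add: L_def add_nonneg_pos)
    then have "\<bar>U i s - U i t\<bar> \<le> L * \<bar>s - t\<bar>"
      using star_lipschitzD(1)[OF assms(1) *(1)] * by blast
    also have "\<dots> = K * \<bar>s - t\<bar> + e * (\<bar>s - t\<bar> / (\<bar>s - t\<bar> + 1))"
      by (simp add: L_def algebra_simps)
    also have "e * (\<bar>s - t\<bar> / (\<bar>s - t\<bar> + 1)) \<le> e * 1"
      using e by (intro mult_left_mono) (auto simp: divide_le_eq)
    finally show "\<bar>U i s - U i t\<bar> \<le> K * \<bar>s - t\<bar> + e" by simp
  qed
  moreover have "U i 0 = U j 0" if "i \<in> {1..N}" "j \<in> {1..N}" for i j
    using star_lipschitzD(2)[OF assms(1)[of "K + 1"] that] by simp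
  ultimately show ?thesis by (intro star_lipschitzI[OF assms(2)])
qed

text \<open>A Hamilton--Jacobi equation \<open>\<lambda> u - I u + H(x, u') = 0\<close> on a star with \<open>N\<close> legs of lengths
  \<open>a i\<close>, in arc length coordinates \<open>s \<in> {0..a i}\<close>, with \<open>I\<close> a lower order operator that is
  classically defined on Lipschitz functions.\<close>

locale star_hj =
  fixes N :: nat and a :: "nat \<Rightarrow> real" and lam B C_H M :: real and h :: "nat \<Rightarrow> real"
    and H :: "nat \<Rightarrow> real \<Rightarrow> real \<Rightarrow> real"
    and I :: "nat \<Rightarrow> (nat \<Rightarrow> real \<Rightarrow> real) \<Rightarrow> real \<Rightarrow> real"
  assumes N: "1 \<le> N" and a_pos: "\<And>i. i \<in> {1..N} \<Longrightarrow> 0 < a i" and lam: "0 < lam" and C_H: "1 < C_H"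
    and H_cont: "\<And>i. i \<in> {1..N} \<Longrightarrow> continuous_on ({0..a i} \<times> UNIV) (\<lambda>(s, p). H i s p)"
    and H_lower: "\<And>i s p. i \<in> {1..N} \<Longrightarrow> s \<in> {0..a i} \<Longrightarrow> \<bar>p\<bar> / C_H - C_H \<le> H i s p"
    and H_upper: "\<And>i s p. i \<in> {1..N} \<Longrightarrow> s \<in> {0..a i} \<Longrightarrow> H i s p \<le> C_H * (1 + \<bar>p\<bar>)"
    and I_cont: "\<And>i K U. i \<in> {1..N} \<Longrightarrow> star_lipschitz N a K U \<Longrightarrow> continuous_on {0..a i} (I i U)"
    and I_const: "\<And>i s c. i \<in> {1..N} \<Longrightarrow> s \<in> {0..a i} \<Longrightarrow> I i (\<lambda>_ _. c) s = 0"
    and I_stable: "\<And>K e. 0 < e \<Longrightarrow> \<exists>d>0. \<forall>U W i s. star_lipschitz N a K U \<and> star_lipschitz N a K W \<and>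
      (\<forall>j\<in>{1..N}. \<forall>t\<in>{0..a j}. U j t \<le> W j t) \<and> i \<in> {1..N} \<and> s \<in> {0..a i} \<and> W i s \<le> U i s + d \<longrightarrow>
      I i U s \<le> I i W s + e"
    and I_growth: "\<And>\<theta>. 0 < \<theta> \<Longrightarrow> \<exists>C. \<forall>K U i s. star_lipschitz N a K U \<and>
      (\<forall>j\<in>{1..N}. \<forall>t\<in>{0..a j}. \<bar>U j t\<bar> \<le> M) \<and> i \<in> {1..N} \<and> s \<in> {0..a i} \<longrightarrow> I i U s \<le> \<theta> * K + C"
    and M_lam: "C_H * (1 + \<bar>B\<bar>) \<le> lam * M" and M_h: "\<And>i. i \<in> {1..N} \<Longrightarrow> \<bar>h i\<bar> \<le> M"
begin

abbreviation lip where "lip \<equiv> star_lipschitz N a"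
abbreviation jet where "jet i \<equiv> superjet {0..a i}"

definition G :: "nat \<Rightarrow> (nat \<Rightarrow> real \<Rightarrow> real) \<Rightarrow> real \<Rightarrow> real \<Rightarrow> real" where
  "G i U s p = lam * U i s - I i U s + H i s p"

definition below :: "(nat \<Rightarrow> real \<Rightarrow> real) \<Rightarrow> (nat \<Rightarrow> real \<Rightarrow> real) \<Rightarrow> bool" where
  "below U W \<longleftrightarrow> (\<forall>j\<in>{1..N}. \<forall>t\<in>{0..a j}. U j t \<le> W j t)"

definition bdd :: "(nat \<Rightarrow> real \<Rightarrow> real) \<Rightarrow> bool" where
  "bdd U \<longleftrightarrow> (\<forall>j\<in>{1..N}. \<forall>t\<in>{0..a j}. \<bar>U j t\<bar> \<le> M)"

text \<open>\<open>G\<close> contains the nonlocal term of \<open>U\<close> itself, not of a test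
  function. For Lipschitz \<open>U\<close> this is enough, since a test function touching from above
  only lowers the left side of the inequality. At 0 one slope per leg is tested at once, as the
  Kirchhoff sum refers to a single test function on the star.\<close>

definition subsol :: "(nat \<Rightarrow> real \<Rightarrow> real) \<Rightarrow> bool" where
  "subsol U \<longleftrightarrow>
     (\<forall>i\<in>{1..N}. \<forall>s p. 0 < s \<longrightarrow> s < a i \<longrightarrow> jet i (U i) s p \<longrightarrow> G i U s p \<le> 0) \<and>
     (\<forall>p. (\<forall>i\<in>{1..N}. jet i (U i) 0 (p i)) \<longrightarrow>
        (\<exists>i\<in>{1..N}. G i U 0 (p i) \<le> 0) \<or> - (\<Sum>i=1..N. p i) \<le> B) \<and>
     (\<forall>i\<in>{1..N}. \<forall>p. jet i (U i) (a i) p \<longrightarrow> G i U (a i) p \<le> 0 \<or> U i (a i) \<le> h i)"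

definition supersol :: "(nat \<Rightarrow> real \<Rightarrow> real) \<Rightarrow> bool" where
  "supersol U \<longleftrightarrow>
     (\<forall>i\<in>{1..N}. \<forall>s q. 0 < s \<longrightarrow> s < a i \<longrightarrow> jet i (\<lambda>t. - U i t) s (- q) \<longrightarrow> 0 \<le> G i U s q) \<and>
     (\<forall>q. (\<forall>i\<in>{1..N}. jet i (\<lambda>t. - U i t) 0 (- q i)) \<longrightarrow>
        (\<exists>i\<in>{1..N}. 0 \<le> G i U 0 (q i)) \<or> B \<le> - (\<Sum>i=1..N. q i)) \<and>
     (\<forall>i\<in>{1..N}. \<forall>q. jet i (\<lambda>t. - U i t) (a i) (- q) \<longrightarrow> 0 \<le> G i U (a i) q \<or> h i \<le> U i (a i))"

definition candidates :: "(nat \<Rightarrow> real \<Rightarrow> real) set" where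
  "candidates = {U. (\<exists>K. lip K U) \<and> bdd U \<and> subsol U}"

section \<open>Continuity and ellipticity of the operator\<close>

lemma G_near:
  assumes "lip K U" "i \<in> {1..N}" "s \<in> {0..a i}" "0 < e"
  obtains d where "0 < d"
    "\<And>t p'. t \<in> {0..a i} \<Longrightarrow> \<bar>t - s\<bar> < d \<Longrightarrow> \<bar>p' - p\<bar> < d \<Longrightarrow> \<bar>G i U t p' - G i U s p\<bar> < e"
proof -
  have 1: "continuous_on ({0..a i} \<times> UNIV) (\<lambda>x. lam * U i (fst x) - I i U (fst x))"
    by (intro continuous_intros continuous_on_compose2[OF star_lipschitz_continuous_on[OF assms(1,2)]]
        continuous_on_compose2[OF I_cont[OF assms(2,1)]]) auto
  have "continuous_on ({0..a i} \<times> UNIV) (\<lambda>x. G i U (fst x) (snd x))"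
    unfolding G_def using continuous_on_add[OF 1 H_cont[OF assms(2)]] by (simp add: case_prod_unfold)
  then have "\<exists>d>0. \<forall>x'\<in>{0..a i} \<times> UNIV. dist x' (s, p) < d \<longrightarrow>
      dist (G i U (fst x') (snd x')) (G i U (fst (s, p)) (snd (s, p))) < e"
    using assms(3,4) unfolding continuous_on_iff by (elim ballE[where x = "(s, p)"]) auto
  then obtain d where d: "0 < d" "\<And>t p'. t \<in> {0..a i} \<Longrightarrow> dist (t, p') (s, p) < d \<Longrightarrow>
      dist (G i U t p') (G i U s p) < e" by auto
  show ?thesis
  proof (rule that[of "d / 2"])
    fix t p' assume *: "t \<in> {0..a i}" "\<bar>t - s\<bar> < d / 2" "\<bar>p' - p\<bar> < d / 2"
    have "dist (t, p') (s, p) \<le> \<bar>t - s\<bar> + \<bar>p' - p\<bar>"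
      unfolding dist_Pair_Pair dist_real_def
      using sqrt_sum_squares_le_sum_abs[of "t - s" "p' - p"] by simp
    then show "\<bar>G i U t p' - G i U s p\<bar> < e" using d(2)[OF *(1), of p'] * by (simp add: dist_real_def)
  qed (use d in simp)
qed

text \<open>\<open>d\<close> depends on \<open>K\<close> and \<open>e\<close> but not on the
  functions. The lemma serves in both directions: with the envelope as \<open>W\<close> it passes
  positivity of \<open>G\<close> down to an approximating candidate, with the envelope as
  \<open>U\<close> it passes negativity up to a raised function.\<close>

lemma G_stable:
  assumes "0 < e"
  obtains d where "0 < d"
    "\<And>U W i s p. lip K U \<Longrightarrow> lip K W \<Longrightarrow> below U W \<Longrightarrow> i \<in> {1..N} \<Longrightarrow> s \<in> {0..a i} \<Longrightarrow>
       W i s \<le> U i s + d \<Longrightarrow> G i W s p \<le> G i U s p + e"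
proof -
  obtain d where d: "0 < d" "\<And>U W i s. lip K U \<Longrightarrow> lip K W \<Longrightarrow> below U W \<Longrightarrow> i \<in> {1..N} \<Longrightarrow> s \<in> {0..a i} \<Longrightarrow>
       W i s \<le> U i s + d \<Longrightarrow> I i U s \<le> I i W s + e / 2"
    using I_stable[of "e / 2" K] assms unfolding below_def by (auto simp: conj_imp_eq_imp_imp)
  show ?thesis
  proof (rule that[of "min d (e / (2 * lam))"])
    show "0 < min d (e / (2 * lam))" using d assms lam by simp
    fix U W i s p assume *: "lip K U" "lip K W" "below U W" "i \<in> {1..N}" "s \<in> {0..a i}"
       "W i s \<le> U i s + min d (e / (2 * lam))"
    have "lam * W i s \<le> lam * (U i s + e / (2 * lam))" using *(6) lam by (intro mult_left_mono) auto
    also have "\<dots> = lam * U i s + e / 2" using lam by (simp add: field_simps)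
    finally show "G i W s p \<le> G i U s p + e"
      using d(2)[OF *(1-5)] *(6) unfolding G_def by linarith
  qed
qed

text \<open>Degenerate ellipticity: touching from above at \<open>s\<close> makes all increments of
  \<open>W\<close> at least those of \<open>U\<close>. It is the case of zero gap in
  \<open>G_stable\<close>, with the larger of both constants and \<open>e\<close> tending to
  0.\<close>

lemma G_mono:
  assumes "lip K U" "lip L W" "below U W" "i \<in> {1..N}" "s \<in> {0..a i}" "W i s = U i s"
  shows "G i W s p \<le> G i U s p"
proof (rule field_le_epsilon)
  fix e :: real assume e: "0 < e"
  have "lip (max K L) U" "lip (max K L) W" using star_lipschitz_mono[OF assms(1)] star_lipschitz_mono[OF assms(2)] by auto
  moreover obtain d where "0 < d"
    "\<And>U W i s p. lip (max K L) U \<Longrightarrow> lip (max K L) W \<Longrightarrow> below U W \<Longrightarrow> i \<in> {1..N} \<Longrightarrow> s \<in> {0..a i} \<Longrightarrow>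
       W i s \<le> U i s + d \<Longrightarrow> G i W s p \<le> G i U s p + e"
    using G_stable[OF e, of "max K L"] by blast
  ultimately show "G i W s p \<le> G i U s p + e" using assms(3-6) by simp
qed

lemma lip_const: "lip 0 (\<lambda>_ _. c)"
  by (simp add: star_lipschitz_def)

section \<open>Lower barrier and uniform Lipschitz bound\<close>

text \<open>Only slopes of modulus at most \<open>\<bar>B\<bar>\<close> have to be checked: in the
  interior the slope of a constant is 0, and at the vertex all slopes are nonnegative, with sum
  below \<open>- B\<close> unless the Kirchhoff alternative holds. Hence the factor
  \<open>1 + \<bar>B\<bar>\<close> in \<open>M_lam\<close>. At the outer ends
  \<open>- M \<le> h i\<close>.\<close>

lemma const_candidate: "(\<lambda>_ _. - M) \<in> candidates"
proof -
  have le: "G i (\<lambda>_ _. - M) s p \<le> 0" if "i \<in> {1..N}" "s \<in> {0..a i}" "\<bar>p\<bar> \<le> \<bar>B\<bar>" for i s p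
  proof -
    have "H i s p \<le> C_H * (1 + \<bar>B\<bar>)"
      using H_upper[OF that(1,2)] mult_left_mono[of "1 + \<bar>p\<bar>" "1 + \<bar>B\<bar>" C_H] that(3) C_H
      by (meson add_left_mono less_imp_le order_trans zero_less_one)
    then show ?thesis using M_lam I_const[OF that(1,2)] by (simp add: G_def)
  qed
  have "subsol (\<lambda>_ _. - M)"
    unfolding subsol_def
  proof (intro conjI ballI allI impI)
    fix i s p assume i: "i \<in> {1..N}" "0 < s" "s < a i" "jet i (\<lambda>_. - M) s p"
    have "0 \<le> p" using i by (intro superjet_ge[OF i(4), of "a i - s"]) auto
    moreover have "p \<le> 0" using i by (intro superjet_le[OF i(4), of s]) auto
    ultimately show "G i (\<lambda>_ _. - M) s p \<le> 0" using le[of i s p] i by auto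
  next
    fix p assume p: "\<forall>i\<in>{1..N}. jet i (\<lambda>_. - M) 0 (p i)"
    have p0: "0 \<le> p i" if "i \<in> {1..N}" for i
      using a_pos[OF that] p that by (intro superjet_ge[of _ "\<lambda>_. - M" 0 "p i" "a i"]) auto
    show "(\<exists>i\<in>{1..N}. G i (\<lambda>_ _. - M) 0 (p i) \<le> 0) \<or> - (\<Sum>i=1..N. p i) \<le> B"
    proof (rule disjCI)
      assume *: "\<not> - (\<Sum>i=1..N. p i) \<le> B"
      have 1: "1 \<in> {1..N}" using N by simp
      have "p 1 \<le> (\<Sum>i=1..N. p i)" using p0 1 by (intro member_le_sum) auto
      then have "\<bar>p 1\<bar> \<le> \<bar>B\<bar>" using p0[OF 1] * by linarith
      then show "\<exists>i\<in>{1..N}. G i (\<lambda>_ _. - M) 0 (p i) \<le> 0"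
        using le[OF 1, of 0] a_pos[OF 1] 1 by (intro bexI[OF _ 1]) auto
    qed
  qed (use M_h in force)
  moreover have "0 \<le> M" using M_h[of 1] N by force
  ultimately show ?thesis using lip_const unfolding candidates_def bdd_def by auto
qed

text \<open>A slope \<open>p\<close> of a candidate obeys
  \<open>\<bar>p\<bar> / C_H \<le> I i U x + lam * M + C_H\<close>. With
  \<open>\<theta> = 1 / (2 * C_H)\<close> in \<open>I_growth\<close>, whose \<open>C\<close> is
  independent of \<open>K\<close>, a \<open>K\<close>-Lipschitz candidate has slopes at most
  \<open>K / 2 + D\<close>.\<close>

lemma lip_uniform:
  obtains L where "\<And>U. U \<in> candidates \<Longrightarrow> lip L U"
proof -
  obtain C where C: "\<And>K U i s. lip K U \<Longrightarrow> bdd U \<Longrightarrow> i \<in> {1..N} \<Longrightarrow> s \<in> {0..a i} \<Longrightarrow>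
      I i U s \<le> 1 / (2 * C_H) * K + C"
  proof -
    have "0 < 1 / (2 * C_H)" using C_H by simp
    from I_growth[OF this] obtain C where C: "\<forall>K U i s. lip K U \<and>
      (\<forall>j\<in>{1..N}. \<forall>t\<in>{0..a j}. \<bar>U j t\<bar> \<le> M) \<and> i \<in> {1..N} \<and> s \<in> {0..a i} \<longrightarrow>
      I i U s \<le> 1 / (2 * C_H) * K + C" ..
    show ?thesis by (rule that[of C]) (use C in \<open>simp add: bdd_def\<close>)
  qed
  define D where "D = C_H * (\<bar>C\<bar> + lam * M + C_H)"
  have M0: "0 \<le> M" using M_h[of 1] N by force
  have D0: "0 \<le> D" using C_H lam M0 by (simp add: D_def)
  have step: "lip (K / 2 + D) U" if U: "lip K U" "bdd U" "subsol U" for K U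
  proof -
    have "\<bar>U i s - U i t\<bar> \<le> (K / 2 + D) * \<bar>s - t\<bar>"
      if i: "i \<in> {1..N}" "s \<in> {0..a i}" "t \<in> {0..a i}" for i s t
    proof (rule lipschitz_if_superjets_bounded[OF _ _ i(2,3)])
      show "continuous_on {0..a i} (U i)" using star_lipschitz_continuous_on U(1) i(1) by blast
      fix x p assume x: "0 < x" "x < a i" "jet i (U i) x p"
      then have "G i U x p \<le> 0" using U(3) i(1) unfolding subsol_def by blast
      moreover have "\<bar>p\<bar> / C_H - C_H \<le> H i x p" using H_lower[OF i(1)] x by simp
      moreover have "- (lam * M) \<le> lam * U i x"
      proof -
        have "\<bar>U i x\<bar> \<le> M" using U(2) i(1) x unfolding bdd_def by auto
        then have "- M \<le> U i x" by linarith
        then have "lam * (- M) \<le> lam * U i x" using lam by (intro mult_left_mono) auto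
        then show ?thesis by simp
      qed
      moreover have "I i U x \<le> 1 / (2 * C_H) * K + \<bar>C\<bar>" using C[OF U(1,2) i(1), of x] x by auto
      ultimately have "\<bar>p\<bar> / C_H \<le> 1 / (2 * C_H) * K + \<bar>C\<bar> + lam * M + C_H"
        unfolding G_def by linarith
      then have "\<bar>p\<bar> \<le> (1 / (2 * C_H) * K + \<bar>C\<bar> + lam * M + C_H) * C_H"
        using C_H by (simp add: pos_divide_le_eq)
      also have "\<dots> = K / 2 + D" using C_H by (simp add: D_def field_simps)
      finally show "\<bar>p\<bar> \<le> K / 2 + D" .
    qed
    moreover have "0 \<le> K / 2 + D" using star_lipschitz_nonneg[OF U(1)] D0 by simp
    ultimately show ?thesis using U(1) unfolding star_lipschitz_def by blast
  qed
  have "lip (2 * D) U" if "U \<in> candidates" for U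
  proof (rule star_lipschitz_if_larger)
    from that obtain K where K: "lip K U" "bdd U" "subsol U" by (auto simp: candidates_def)
    have K0: "0 \<le> K" using K(1) by (rule star_lipschitz_nonneg)
    \<comment> \<open>\<open>2 * D\<close> is the fixed point of \<open>step\<close>; the excess
      over it is halved each time.\<close>
    have it: "lip (2 * D + K / 2 ^ n) U" for n
    proof (induction n)
      case 0
      show ?case by (rule star_lipschitz_mono[OF K(1)]) (use D0 in simp)
    next
      case (Suc n)
      have "(2 * D + K / 2 ^ n) / 2 + D = 2 * D + K / 2 ^ Suc n" by (simp add: field_simps)
      then show ?case using step[OF Suc K(2,3)] by metis
    qed
    fix L assume L: "2 * D < L"
    have "(\<lambda>n. 2 * D + K / 2 ^ n) \<longlonglongrightarrow> 2 * D + 0"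
      by (intro tendsto_intros LIMSEQ_divide_realpow_zero) auto
    then have "\<forall>\<^sub>F n in sequentially. 2 * D + K / 2 ^ n < L"
      using L by (intro order_tendstoD(2)[where y = "2 * D + 0"]) auto
    then obtain n where "2 * D + K / 2 ^ n < L" by (auto simp: eventually_sequentially)
    then show "lip L U" using star_lipschitz_mono[OF it[of n]] by simp
  qed (use D0 in simp)
  then show ?thesis using that by blast
qed

section \<open>Stability under suprema\<close>

text \<open>If \<open>u\<close> violates the subsolution inequality at a jet, then so does, at a jet
  nearby, every \<open>L\<close>-Lipschitz function below \<open>u\<close> that is close to it at
  \<open>s\<close>. The clause for \<open>t = s\<close> keeps the slope unchanged; the arguments at
  the vertex and at the outer ends depend on it.\<close>

lemma perturbed_jet:
  assumes "lip L u" "i \<in> {1..N}" "s \<in> {0..a i}" "jet i (u i) s p" "0 < G i u s p" "0 < \<rho>"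
  obtains \<eta> where "0 < \<eta>" "\<And>w. lip L w \<Longrightarrow> below w u \<Longrightarrow> u i s - \<eta> \<le> w i s \<Longrightarrow>
    \<exists>t\<in>{0..a i}. \<exists>p'. \<bar>t - s\<bar> < \<rho> \<and> (t = s \<longrightarrow> p' = p) \<and> jet i (w i) t p' \<and> 0 < G i w t p'"
proof -
  define g where "g = G i u s p"
  have g: "0 < g / 2" "0 < g / 4" using assms(5) by (auto simp: g_def)
  have L: "0 \<le> L" using assms(1) by (rule star_lipschitz_nonneg)
  obtain d1 where d1: "0 < d1" "\<And>t p'. t \<in> {0..a i} \<Longrightarrow> \<bar>t - s\<bar> < d1 \<Longrightarrow> \<bar>p' - p\<bar> < d1 \<Longrightarrow>
      \<bar>G i u t p' - g\<bar> < g / 2"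
    using G_near[OF assms(1-3) g(1), of p] unfolding g_def by metis
  obtain d2 where d2: "0 < d2" "\<And>w t p'. lip L w \<Longrightarrow> below w u \<Longrightarrow> t \<in> {0..a i} \<Longrightarrow>
      u i t \<le> w i t + d2 \<Longrightarrow> G i u t p' \<le> G i w t p' + g / 4"
    using G_stable[OF g(2), of L] assms(1,2) by metis
  \<comment> \<open>The last bound controls the gap away from \<open>s\<close>: at most
    \<open>d2 / 2\<close> at \<open>s\<close>, it grows by at most
    \<open>2 * L * \<delta> \<le> d2 / 2\<close> up to the contact point and stays within
    \<open>d2\<close>.\<close>
  define \<delta> where "\<delta> = min (d1 / 2) (min \<rho> (d2 / (4 * (L + 1))))"
  have \<delta>: "0 < \<delta>" "\<delta> < d1" "\<delta> \<le> \<rho>" "\<delta> \<le> d2 / (4 * (L + 1))"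
    using d1(1) d2(1) assms(6) L by (auto simp: \<delta>_def)
  have L\<delta>: "L * \<delta> \<le> d2 / 4"
  proof -
    have "L * \<delta> \<le> (L + 1) * (d2 / (4 * (L + 1)))" using \<delta> L by (intro mult_mono) auto
    also have "\<dots> = d2 / 4" using L by (simp add: field_simps)
    finally show ?thesis .
  qed
  obtain \<eta> where \<eta>: "0 < \<eta>" "\<And>w. continuous_on {0..a i} w \<Longrightarrow> (\<And>t. t \<in> {0..a i} \<Longrightarrow> w t \<le> u i t) \<Longrightarrow>
      u i s - \<eta> \<le> w s \<Longrightarrow>
      \<exists>t\<in>{0..a i}. \<exists>p'. \<bar>t - s\<bar> < \<delta> \<and> \<bar>p' - p\<bar> \<le> \<delta> \<and> (t = s \<longrightarrow> p' = p) \<and> jet i w t p'"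
    using superjet_perturb[OF assms(4,3) \<delta>(1)] by blast
  show ?thesis
  proof (rule that[of "min \<eta> (d2 / 2)"])
    show "0 < min \<eta> (d2 / 2)" using \<eta> d2 by simp
    fix w assume w: "lip L w" "below w u" "u i s - min \<eta> (d2 / 2) \<le> w i s"
    have "\<exists>t\<in>{0..a i}. \<exists>p'. \<bar>t - s\<bar> < \<delta> \<and> \<bar>p' - p\<bar> \<le> \<delta> \<and> (t = s \<longrightarrow> p' = p) \<and> jet i (w i) t p'"
      using w assms(2) star_lipschitz_continuous_on by (intro \<eta>(2)) (auto simp: below_def)
    then obtain t p' where t: "t \<in> {0..a i}" "\<bar>t - s\<bar> < \<delta>" "\<bar>p' - p\<bar> \<le> \<delta>" "t = s \<longrightarrow> p' = p"
      "jet i (w i) t p'" by blast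
    have "L * \<bar>t - s\<bar> \<le> d2 / 4" using L\<delta> t(2) L mult_left_mono[of "\<bar>t - s\<bar>" \<delta> L] by linarith
    then have "u i t \<le> w i t + d2"
      using star_lipschitzD(1)[OF w(1) assms(2) t(1) assms(3)]
        star_lipschitzD(1)[OF assms(1,2) t(1) assms(3)] w(3) by linarith
    then have "G i u t p' \<le> G i w t p' + g / 4" using d2(2) w t by blast
    moreover have "\<bar>G i u t p' - g\<bar> < g / 2" using d1(2)[of t p'] t \<delta> by auto
    ultimately have "0 < G i w t p'" using g by linarith
    then show "\<exists>t\<in>{0..a i}. \<exists>p'. \<bar>t - s\<bar> < \<rho> \<and> (t = s \<longrightarrow> p' = p) \<and> jet i (w i) t p' \<and> 0 < G i w t p'"
      using t \<delta> by (intro bexI[OF _ t(1)] exI[of _ p']) auto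
  qed
qed

lemma envelope:
  obtains L u where "lip L u" "bdd u" "\<And>w. w \<in> candidates \<Longrightarrow> below w u" "\<And>w. w \<in> candidates \<Longrightarrow> lip L w"
    "\<And>i s e. i \<in> {1..N} \<Longrightarrow> s \<in> {0..a i} \<Longrightarrow> 0 < e \<Longrightarrow> \<exists>w\<in>candidates. u i s - e < w i s"
proof -
  obtain L where L: "\<And>w. w \<in> candidates \<Longrightarrow> lip L w" using lip_uniform by blast
  define u where "u i s = (SUP w\<in>candidates. w i s)" for i s
  have ne: "candidates \<noteq> {}" using const_candidate by blast
  have wM: "\<bar>w i s\<bar> \<le> M" if "w \<in> candidates" "i \<in> {1..N}" "s \<in> {0..a i}" for w i s
    using that unfolding candidates_def bdd_def by blast
  have bd: "bdd_above ((\<lambda>w. w i s) ` candidates)" if "i \<in> {1..N}" "s \<in> {0..a i}" for i s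
    using abs_le_D1[OF wM[OF _ that]] by (auto simp: bdd_above_def)
  have wu: "w i s \<le> u i s" if "w \<in> candidates" "i \<in> {1..N}" "s \<in> {0..a i}" for w i s
    unfolding u_def using that bd by (intro cSUP_upper) auto
  have uM: "u i s \<le> M" if "i \<in> {1..N}" "s \<in> {0..a i}" for i s
    unfolding u_def using abs_le_D1[OF wM[OF _ that]] ne by (intro cSUP_least) auto
  have one: "u i s \<le> u i t + L * \<bar>s - t\<bar>" if "i \<in> {1..N}" "s \<in> {0..a i}" "t \<in> {0..a i}" for i s t
    unfolding u_def[of i s]
  proof (rule cSUP_least[OF ne])
    fix w assume w: "w \<in> candidates"
    show "w i s \<le> u i t + L * \<bar>s - t\<bar>"
      using star_lipschitzD(1)[OF L[OF w] that(1-3)] wu[OF w that(1,3)] by linarith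
  qed
  have "lip L u"
  proof (rule star_lipschitzI)
    show "0 \<le> L" using star_lipschitz_nonneg L const_candidate by blast
    show "\<bar>u i s - u i t\<bar> \<le> L * \<bar>s - t\<bar>" if "i \<in> {1..N}" "s \<in> {0..a i}" "t \<in> {0..a i}" for i s t
      using one[OF that] one[OF that(1,3,2)] by (simp add: abs_le_iff abs_minus_commute)
    show "u i 0 = u j 0" if "i \<in> {1..N}" "j \<in> {1..N}" for i j
      unfolding u_def using star_lipschitzD(2)[OF L that] by (intro SUP_cong) auto
  qed
  moreover have "bdd u" unfolding bdd_def
  proof (intro ballI)
    fix i s assume *: "i \<in> {1..N}" "s \<in> {0..a i}"
    show "\<bar>u i s\<bar> \<le> M" using uM[OF *] wu[OF const_candidate *] by (simp add: abs_le_iff)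
  qed
  moreover have "\<exists>w\<in>candidates. u i s - e < w i s" if "i \<in> {1..N}" "s \<in> {0..a i}" "0 < e" for i s e
    using that(3) less_cSUP_iff[OF ne bd[OF that(1,2)], of "u i s - e"] by (simp add: u_def)
  moreover have "below w u" if "w \<in> candidates" for w
    using wu[OF that] unfolding below_def by blast
  ultimately show ?thesis using that L by blast
qed

text \<open>At an inner contact point a candidate satisfies the inequality without any alternative,
  so \<open>perturbed_jet\<close> gives a contradiction at once. At the vertex and at the outer ends
  this forces the contact point of the candidate to stay where it is, with the same slope, and the
  alternative is then excluded as well.\<close>

lemma envelope_subsol:
  assumes "lip L u" "\<And>w. w \<in> candidates \<Longrightarrow> below w u" "\<And>w. w \<in> candidates \<Longrightarrow> lip L w"
    and app: "\<And>i s e. i \<in> {1..N} \<Longrightarrow> s \<in> {0..a i} \<Longrightarrow> 0 < e \<Longrightarrow> \<exists>w\<in>candidates. u i s - e < w i s"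
  shows "subsol u"
proof -
  have inner: "G i w t p \<le> 0" if "w \<in> candidates" "i \<in> {1..N}" "0 < t" "t < a i" "jet i (w i) t p" for i w t p
    using that unfolding candidates_def subsol_def by blast
  have 1: "G i u s p \<le> 0" if i: "i \<in> {1..N}" "0 < s" "s < a i" "jet i (u i) s p" for i s p
  proof (rule ccontr)
    assume "\<not> ?thesis"
    then have G: "0 < G i u s p" by simp
    have s: "s \<in> {0..a i}" "0 < min s (a i - s)" using i by auto
    obtain \<eta> where \<eta>: "0 < \<eta>" "\<And>w. lip L w \<Longrightarrow> below w u \<Longrightarrow> u i s - \<eta> \<le> w i s \<Longrightarrow>
      \<exists>t\<in>{0..a i}. \<exists>p'. \<bar>t - s\<bar> < min s (a i - s) \<and> (t = s \<longrightarrow> p' = p) \<and> jet i (w i) t p' \<and> 0 < G i w t p'"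
      using perturbed_jet[OF assms(1) i(1) s(1) i(4) G s(2)] by blast
    obtain w where w: "w \<in> candidates" "u i s - \<eta> < w i s" using app[OF i(1) s(1) \<eta>(1)] by blast
    then obtain t p' where t: "\<bar>t - s\<bar> < min s (a i - s)" "jet i (w i) t p'" "0 < G i w t p'"
      using \<eta>(2)[of w] assms(2,3)[OF w(1)] by auto
    then have "0 < t" "t < a i" by linarith+
    then show False using inner[OF w(1) i(1) _ _ t(2)] t(3) by linarith
  qed
  have 2: "(\<exists>i\<in>{1..N}. G i u 0 (p i) \<le> 0) \<or> - (\<Sum>i=1..N. p i) \<le> B"
    if p: "\<forall>i\<in>{1..N}. jet i (u i) 0 (p i)" for p
  proof (rule ccontr)
    assume "\<not> ?thesis"
    then have G: "\<And>i. i \<in> {1..N} \<Longrightarrow> 0 < G i u 0 (p i)" and B: "B < - (\<Sum>i=1..N. p i)" by force+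
    have "\<exists>\<eta>>0. \<forall>w. lip L w \<longrightarrow> below w u \<longrightarrow> u i 0 - \<eta> \<le> w i 0 \<longrightarrow>
      (\<exists>t\<in>{0..a i}. \<exists>p'. \<bar>t\<bar> < a i \<and> (t = 0 \<longrightarrow> p' = p i) \<and> jet i (w i) t p' \<and> 0 < G i w t p')"
      if i: "i \<in> {1..N}" for i
    proof -
      have "0 \<in> {0..a i}" "0 < a i" using a_pos[OF i] by auto
      from perturbed_jet[OF assms(1) i this(1) _ G[OF i] this(2)] p i show ?thesis
        by (metis diff_zero)
    qed
    then obtain \<eta> where \<eta>: "\<And>i. i \<in> {1..N} \<Longrightarrow> 0 < \<eta> i"
      "\<And>i w. i \<in> {1..N} \<Longrightarrow> lip L w \<Longrightarrow> below w u \<Longrightarrow> u i 0 - \<eta> i \<le> w i 0 \<Longrightarrow>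
      (\<exists>t\<in>{0..a i}. \<exists>p'. \<bar>t\<bar> < a i \<and> (t = 0 \<longrightarrow> p' = p i) \<and> jet i (w i) t p' \<and> 0 < G i w t p')"
      by metis
    \<comment> \<open>One \<open>e\<close> for all legs, so that a single candidate is close on each
      of them; its gap at the vertex is the same on every leg.\<close>
    define e where "e = Min (\<eta> ` {1..N})"
    have e: "0 < e" "\<And>i. i \<in> {1..N} \<Longrightarrow> e \<le> \<eta> i" using \<eta>(1) N by (auto simp: e_def)
    have one: "1 \<in> {1..N}" using N by simp
    obtain w where w: "w \<in> candidates" "u 1 0 - e < w 1 0"
      using app[OF one _ e(1), of 0] a_pos[OF one] by auto
    note wl = assms(3)[OF w(1)]
    have jets: "jet i (w i) 0 (p i) \<and> 0 < G i w 0 (p i)" if i: "i \<in> {1..N}" for i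
    proof -
      have "u i 0 = u 1 0" "w i 0 = w 1 0"
        using star_lipschitzD(2)[OF assms(1) i one] star_lipschitzD(2)[OF wl i one] .
      then have "u i 0 - \<eta> i \<le> w i 0" using w(2) e(2)[OF i] by linarith
      then obtain t p' where t: "t \<in> {0..a i}" "\<bar>t\<bar> < a i" "t = 0 \<longrightarrow> p' = p i"
        "jet i (w i) t p'" "0 < G i w t p'"
        using \<eta>(2)[OF i wl assms(2)[OF w(1)]] by blast
      have "t = 0"
      proof (rule ccontr)
        assume "t \<noteq> 0"
        then have "0 < t" "t < a i" using t(1,2) by auto
        then show False using inner[OF w(1) i _ _ t(4)] t(5) by linarith
      qed
      then show ?thesis using t by simp
    qed
    have "(\<exists>i\<in>{1..N}. G i w 0 (p i) \<le> 0) \<or> - (\<Sum>i=1..N. p i) \<le> B"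
      using w(1) jets unfolding candidates_def subsol_def by blast
    then show False using jets B by force
  qed
  have 3: "G i u (a i) p \<le> 0 \<or> u i (a i) \<le> h i" if i: "i \<in> {1..N}" "jet i (u i) (a i) p" for i p
  proof (rule ccontr)
    assume "\<not> ?thesis"
    then have G: "0 < G i u (a i) p" and hi: "h i < u i (a i)" by auto
    have s: "a i \<in> {0..a i}" "0 < a i" using a_pos[OF i(1)] by auto
    obtain \<eta> where \<eta>: "0 < \<eta>" "\<And>w. lip L w \<Longrightarrow> below w u \<Longrightarrow> u i (a i) - \<eta> \<le> w i (a i) \<Longrightarrow>
      \<exists>t\<in>{0..a i}. \<exists>p'. \<bar>t - a i\<bar> < a i \<and> (t = a i \<longrightarrow> p' = p) \<and> jet i (w i) t p' \<and> 0 < G i w t p'"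
      using perturbed_jet[OF assms(1) i(1) s(1) i(2) G s(2)] by blast
    \<comment> \<open>The second bound keeps the candidate above \<open>h i\<close> at the end and
      so rules out the Dirichlet alternative.\<close>
    have "0 < min \<eta> (u i (a i) - h i)" using \<eta>(1) hi by simp
    from app[OF i(1) s(1) this] obtain w where w: "w \<in> candidates"
      "u i (a i) - min \<eta> (u i (a i) - h i) < w i (a i)" by blast
    then have "u i (a i) - \<eta> \<le> w i (a i)" by linarith
    then obtain t p' where t: "t \<in> {0..a i}" "\<bar>t - a i\<bar> < a i" "t = a i \<longrightarrow> p' = p" "jet i (w i) t p'" "0 < G i w t p'"
      using \<eta>(2)[of w] assms(2,3)[OF w(1)] by blast
    show False
    proof (cases "t = a i")
      case True
      then have "G i w (a i) p \<le> 0 \<or> w i (a i) \<le> h i"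
        using w(1) t i(1) unfolding candidates_def subsol_def by blast
      then show False using t True w(2) by auto
    next
      case False
      then have "0 < t" "t < a i" using t(1,2) by auto
      then show False using inner[OF w(1) i(1) _ _ t(4)] t(5) by linarith
    qed
  qed
  show ?thesis unfolding subsol_def using 1 2 3 by blast
qed

section \<open>Raising a maximal subsolution\<close>

text \<open>Describes a raised leg before the raised star is known: \<open>W\<close> need only
  dominate \<open>u\<close> and agree with \<open>b\<close> at the one point \<open>t\<close>, so
  bumps on several legs can be joined afterwards. \<open>\<rho>\<close> is both the radius of the
  raised region and the loss of slope allowed at the vertex. \<open>K\<close> and
  \<open>\<eta>\<close> are parameters because the legs must share them when the vertex is
  raised.\<close>

definition bump :: "nat \<Rightarrow> (nat \<Rightarrow> real \<Rightarrow> real) \<Rightarrow> real \<Rightarrow> real \<Rightarrow> real \<Rightarrow> real \<Rightarrow> real \<Rightarrow> (real \<Rightarrow> real) \<Rightarrow> bool" where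
  "bump i u s q \<rho> K \<eta> b \<longleftrightarrow> b s = u i s + \<eta> \<and>
      (\<forall>t\<in>{0..a i}. u i t \<le> b t \<and> b t \<le> M \<and> (u i t < b t \<longrightarrow> \<bar>t - s\<bar> < \<rho>)) \<and>
      (\<forall>t\<in>{0..a i}. \<forall>t'\<in>{0..a i}. \<bar>b t - b t'\<bar> \<le> K * \<bar>t - t'\<bar>) \<and>
      (\<forall>W t p. lip K W \<longrightarrow> below u W \<longrightarrow> W i t = b t \<longrightarrow> u i t < b t \<longrightarrow> 0 < t \<longrightarrow> t < a i \<longrightarrow>
         jet i b t p \<longrightarrow> G i W t p \<le> 0) \<and>
      (\<forall>p. s = 0 \<longrightarrow> jet i b 0 p \<longrightarrow> q - \<rho> \<le> p)"

lemma bumpD: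
  assumes "bump i u s q \<rho> K \<eta> b"
  shows "b s = u i s + \<eta>"
    and "t \<in> {0..a i} \<Longrightarrow> u i t \<le> b t" and "t \<in> {0..a i} \<Longrightarrow> b t \<le> M"
    and "t \<in> {0..a i} \<Longrightarrow> u i t < b t \<Longrightarrow> \<bar>t - s\<bar> < \<rho>"
    and "t \<in> {0..a i} \<Longrightarrow> t' \<in> {0..a i} \<Longrightarrow> \<bar>b t - b t'\<bar> \<le> K * \<bar>t - t'\<bar>"
    and "lip K W \<Longrightarrow> below u W \<Longrightarrow> W i t = b t \<Longrightarrow> u i t < b t \<Longrightarrow> 0 < t \<Longrightarrow> t < a i \<Longrightarrow>
      jet i b t p \<Longrightarrow> G i W t p \<le> 0"
    and "s = 0 \<Longrightarrow> jet i b 0 p \<Longrightarrow> q - \<rho> \<le> p"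
  using assms unfolding bump_def by simp_all

text \<open>Raising \<open>u\<close> along one leg: the concave kink \<open>\<psi>\<close> crosses \<open>u\<close> only close to \<open>s\<close>, where its slopes
  are close to \<open>q\<close>; the minimum with \<open>u t + r - \<bar>t - s\<bar>\<close> switches the kink off away from \<open>s\<close>.\<close>

lemma local_bump:
  assumes u: "lip L u" "bdd u" and i: "i \<in> {1..N}" and s: "s \<in> {0..a i}"
    and jet: "jet i (\<lambda>t. - u i t) s (- q)" and G: "G i u s q < 0" and \<rho>: "0 < \<rho>"
    and uM: "u i s < M" and K: "L + \<bar>q\<bar> + 3 \<le> K"
  obtains \<eta>0 where "0 < \<eta>0"
    "\<And>\<eta>. 0 < \<eta> \<Longrightarrow> \<eta> \<le> \<eta>0 \<Longrightarrow> \<exists>b. bump i u s q \<rho> K \<eta> b"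
proof -
  define g where "g = - G i u s q"
  have g: "0 < g / 2" using G by (simp add: g_def)
  have L: "0 \<le> L" using u(1) by (rule star_lipschitz_nonneg)
  obtain d1 where d1: "0 < d1" "\<And>t p'. t \<in> {0..a i} \<Longrightarrow> \<bar>t - s\<bar> < d1 \<Longrightarrow> \<bar>p' - q\<bar> < d1 \<Longrightarrow>
      \<bar>G i u t p' - G i u s q\<bar> < g / 2"
    using G_near[OF u(1) i s g, of q] by metis
  obtain d2 where d2: "0 < d2" "\<And>W t p'. lip K u \<Longrightarrow> lip K W \<Longrightarrow> below u W \<Longrightarrow> t \<in> {0..a i} \<Longrightarrow>
      W i t \<le> u i t + d2 \<Longrightarrow> G i W t p' \<le> G i u t p' + g / 2"
    using G_stable[OF g, of K] i by metis
  have lipK: "lip K u" using star_lipschitz_mono[OF u(1)] K by auto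
  \<comment> \<open>The slopes of the kink differ from \<open>q\<close> by at most
    \<open>2 * \<epsilon>\<close>, which must stay below both \<open>d1\<close> and
    \<open>\<rho>\<close>.\<close>
  define \<epsilon> where "\<epsilon> = min 1 (min (d1 / 4) (\<rho> / 4))"
  have \<epsilon>: "0 < \<epsilon>" "\<epsilon> \<le> 1" "3 * \<epsilon> < d1" "3 * \<epsilon> < \<rho>" using d1(1) \<rho> unfolding \<epsilon>_def by linarith+
  obtain r0 where r0: "0 < r0" "\<And>t. t \<in> {0..a i} \<Longrightarrow> \<bar>t - s\<bar> < r0 \<Longrightarrow>
      - u i t \<le> - u i s + - q * (t - s) + \<epsilon> * \<bar>t - s\<bar>"
    using superjetD[OF jet \<epsilon>(1)] by blast
  \<comment> \<open>The last bound leaves room below \<open>M\<close>: within distance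
    \<open>r\<close> the function \<open>u\<close> rises by at most \<open>(M - u i s) / 2\<close>,
    and \<open>\<eta>\<close> takes at most the other half.\<close>
  define r where "r = min (min r0 \<rho>) (min d1 ((M - u i s) / (2 * (L + 1))))"
  have r: "0 < r" "r \<le> r0" "r \<le> \<rho>" "r \<le> d1" "r \<le> (M - u i s) / (2 * (L + 1))"
    using r0(1) \<rho> d1(1) uM L by (auto simp: r_def)
  have Lr: "L * r \<le> (M - u i s) / 2"
  proof -
    have "L * r \<le> (L + 1) * r" using r(1) by (simp add: algebra_simps)
    also have "\<dots> \<le> (L + 1) * ((M - u i s) / (2 * (L + 1)))" using r(5) L by (intro mult_left_mono) auto
    also have "\<dots> = (M - u i s) / 2" using L by (simp add: field_simps)
    finally show ?thesis .
  qed
  \<comment> \<open>The first bound confines the region where \<open>\<psi>\<close> exceeds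
    \<open>u\<close> to distances below \<open>r / 2\<close>; since
    \<open>\<epsilon> \<le> 1\<close>, it also keeps the cut-off inactive there.\<close>
  define \<eta>0 where "\<eta>0 = min (\<epsilon> * r / 2) (min d2 ((M - u i s) / 2))"
  show ?thesis
  proof (rule that[of \<eta>0])
    show "0 < \<eta>0" using \<epsilon>(1) r(1) d2(1) uM by (simp add: \<eta>0_def)
    fix \<eta> assume \<eta>: "0 < \<eta>" "\<eta> \<le> \<eta>0"
    have "\<epsilon> * r \<le> 1 * r" using \<epsilon> r(1) by (intro mult_right_mono) auto
    then have \<eta>': "\<eta> \<le> \<epsilon> * (r / 2)" "\<eta> \<le> r / 2" "\<eta> \<le> d2" "\<eta> \<le> (M - u i s) / 2"
      using \<eta> unfolding \<eta>0_def by simp_all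
    define \<psi> where "\<psi> t = u i s + \<eta> + q * (t - s) - 2 * \<epsilon> * \<bar>t - s\<bar>" for t
    define b where "b t = max (u i t) (min (\<psi> t) (u i t + r - \<bar>t - s\<bar>))" for t
    \<comment> \<open>The subjet costs \<open>\<epsilon> * \<bar>t - s\<bar>\<close>; the
      coefficient \<open>2 * \<epsilon>\<close> of the kink leaves one such term to push
      \<open>\<psi>\<close> below \<open>u\<close>.\<close>
    have \<psi>u: "\<psi> t \<le> u i t + \<eta> - \<epsilon> * \<bar>t - s\<bar>" if "t \<in> {0..a i}" "\<bar>t - s\<bar> < r" for t
      using r0(2)[OF that(1)] that(2) r(2) unfolding \<psi>_def by (simp add: algebra_simps)
    have near: "\<psi> t \<le> b t" if "t \<in> {0..a i}" "\<bar>t - s\<bar> \<le> r / 2" for t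
    proof -
      have "\<psi> t \<le> u i t + \<eta> - \<epsilon> * \<bar>t - s\<bar>" using \<psi>u that r(1) by simp
      moreover have "0 \<le> \<epsilon> * \<bar>t - s\<bar>" using \<epsilon> by simp
      ultimately have "\<psi> t \<le> u i t + r - \<bar>t - s\<bar>" using \<eta>'(2) that(2) by linarith
      then show ?thesis by (simp add: b_def)
    qed
    have contact: "\<bar>t - s\<bar> < r / 2 \<and> b t = \<psi> t \<and> b t \<le> u i t + \<eta> \<and> b t \<le> M"
      if t: "t \<in> {0..a i}" "u i t < b t" for t
    proof -
      have *: "u i t < \<psi> t" "\<bar>t - s\<bar> < r" "b t \<le> \<psi> t" using t(2) unfolding b_def by linarith+
      have le: "\<psi> t \<le> u i t + \<eta> - \<epsilon> * \<bar>t - s\<bar>" using \<psi>u[OF t(1) *(2)] .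
      then have "\<epsilon> * \<bar>t - s\<bar> < \<epsilon> * (r / 2)" using *(1) \<eta>'(1) by linarith
      then have tr: "\<bar>t - s\<bar> < r / 2" using \<epsilon>(1) by simp
      have b: "b t = \<psi> t" using near[OF t(1)] tr *(3) by simp
      have pos: "0 \<le> \<epsilon> * \<bar>t - s\<bar>" using \<epsilon> by simp
      have bu: "b t \<le> u i t + \<eta>" using b le pos by linarith
      have "L * \<bar>t - s\<bar> \<le> L * r" using *(2) L by (intro mult_left_mono) auto
      then have "b t \<le> M"
        using star_lipschitzD(1)[OF u(1) i t(1) s] bu Lr \<eta>'(4) by argo
      then show ?thesis using tr b bu by simp
    qed
    have uM': "u i t \<le> M" if "t \<in> {0..a i}" for t using u(2) i that unfolding bdd_def by (meson abs_le_D1)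
    have bM: "u i t \<le> b t \<and> b t \<le> M \<and> (u i t < b t \<longrightarrow> \<bar>t - s\<bar> < \<rho>)" if t: "t \<in> {0..a i}" for t
    proof (cases "u i t < b t")
      case True
      then show ?thesis using contact[OF t True] r by auto
    next
      case False
      moreover have "u i t \<le> b t" by (simp add: b_def)
      ultimately show ?thesis using uM'[OF t] by simp
    qed
    have bs: "b s = u i s + \<eta>" using \<eta>(1) \<eta>'(2) r(1) by (simp add: b_def \<psi>_def)
    have blip: "\<bar>b t - b t'\<bar> \<le> K * \<bar>t - t'\<bar>" if t: "t \<in> {0..a i}" "t' \<in> {0..a i}" for t t'
    proof -
      define D where "D = \<bar>t - t'\<bar>"
      have D: "0 \<le> D" by (simp add: D_def)
      have 1: "\<bar>u i t - u i t'\<bar> \<le> L * D"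
        using star_lipschitzD(1)[OF u(1) i t] by (simp add: D_def)
      have 2: "\<bar>\<bar>t - s\<bar> - \<bar>t' - s\<bar>\<bar> \<le> D" unfolding D_def by linarith
      have "\<bar>q * (t - s) - q * (t' - s)\<bar> = \<bar>q\<bar> * D"
        by (simp add: D_def abs_mult flip: right_diff_distrib)
      moreover have "\<bar>2 * \<epsilon> * \<bar>t - s\<bar> - 2 * \<epsilon> * \<bar>t' - s\<bar>\<bar> \<le> 2 * D"
      proof -
        have "\<bar>2 * \<epsilon> * \<bar>t - s\<bar> - 2 * \<epsilon> * \<bar>t' - s\<bar>\<bar> = (2 * \<epsilon>) * \<bar>\<bar>t - s\<bar> - \<bar>t' - s\<bar>\<bar>"
          using \<epsilon>(1) by (simp add: abs_mult flip: right_diff_distrib)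
        also have "\<dots> \<le> 2 * D" using 2 \<epsilon> D by (intro mult_mono) auto
        finally show ?thesis .
      qed
      ultimately have 3: "\<bar>\<psi> t - \<psi> t'\<bar> \<le> \<bar>q\<bar> * D + 2 * D" unfolding \<psi>_def by linarith
      have "\<bar>b t - b t'\<bar> \<le> L * D + \<bar>q\<bar> * D + 3 * D"
        using 1 2 3 D mult_nonneg_nonneg[OF L D] mult_nonneg_nonneg[OF abs_ge_zero[of q] D]
        unfolding b_def max_def min_def by (smt (verit))
      also have "\<dots> = (L + \<bar>q\<bar> + 3) * D" by (simp add: algebra_simps)
      also have "\<dots> \<le> K * D" using K D by (intro mult_right_mono) auto
      finally show ?thesis by (simp add: D_def)
    qed
    have \<psi>low: "\<psi> t + q * (t' - t) - 2 * \<epsilon> * \<bar>t' - t\<bar> \<le> \<psi> t'" for t t'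
    proof -
      have "2 * \<epsilon> * \<bar>t' - s\<bar> \<le> 2 * \<epsilon> * (\<bar>t - s\<bar> + \<bar>t' - t\<bar>)" using \<epsilon> by (intro mult_left_mono) auto
      then show ?thesis by (simp add: \<psi>_def algebra_simps)
    qed
    \<comment> \<open>Near a raised point \<open>b\<close> dominates the concave kink and equals it
      at the point, so interior superjet slopes of \<open>b\<close> are trapped between
      \<open>q - 2 * \<epsilon>\<close> and \<open>q + 2 * \<epsilon>\<close>. At the vertex only
      the lower bound is available.\<close>
    have slope_ge: "q - 2 * \<epsilon> \<le> p" if t: "0 \<le> t" "t < a i" "u i t < b t" "jet i b t p" for t p
    proof (rule superjet_ge[OF t(4)])
      have c: "\<bar>t - s\<bar> < r / 2" "b t = \<psi> t" using contact[of t] t by auto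
      define d where "d = min (a i - t) (r / 2 - \<bar>t - s\<bar>)"
      show "0 < d" using c(1) t(2) by (simp add: d_def)
      show "{t..t + d} \<subseteq> {0..a i}" using t by (auto simp: d_def)
      show "b t + (q - 2 * \<epsilon>) * (t' - t) \<le> b t'" if t': "t' \<in> {t..t + d}" for t'
      proof -
        have "t' \<le> t + (a i - t)" "t' \<le> t + (r / 2 - \<bar>t - s\<bar>)" "t \<le> t'" using t' unfolding d_def by auto
        then have "0 \<le> t'" "t' \<le> a i" "\<bar>t' - s\<bar> \<le> r / 2" "\<bar>t' - t\<bar> = t' - t"
          using t(1) by linarith+
        then show ?thesis using near[of t'] \<psi>low[of t t'] c(2) by (simp add: algebra_simps)
      qed
    qed
    have slope_le: "p \<le> q + 2 * \<epsilon>" if t: "0 < t" "t \<le> a i" "u i t < b t" "jet i b t p" for t p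
    proof (rule superjet_le[OF t(4)])
      have c: "\<bar>t - s\<bar> < r / 2" "b t = \<psi> t" using contact[of t] t by auto
      define d where "d = min t (r / 2 - \<bar>t - s\<bar>)"
      show "0 < d" using c(1) t(1) by (simp add: d_def)
      show "{t - d..t} \<subseteq> {0..a i}" using t by (auto simp: d_def)
      show "b t + (q + 2 * \<epsilon>) * (t' - t) \<le> b t'" if t': "t' \<in> {t - d..t}" for t'
      proof -
        have "t - t \<le> t'" "t - (r / 2 - \<bar>t - s\<bar>) \<le> t'" "t' \<le> t" using t' unfolding d_def by auto
        then have "0 \<le> t'" "t' \<le> a i" "\<bar>t' - s\<bar> \<le> r / 2" "\<bar>t' - t\<bar> = t - t'"
          using t(2) by linarith+
        then show ?thesis using near[of t'] \<psi>low[of t t'] c(2) by (simp add: algebra_simps)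
      qed
    qed
    have Gle: "G i W t p \<le> 0"
      if W: "lip K W" "below u W" "W i t = b t" and t: "u i t < b t" "0 < t" "t < a i" "jet i b t p" for W t p
    proof -
      have t0: "t \<in> {0..a i}" using t by simp
      have c: "\<bar>t - s\<bar> < r / 2" "b t \<le> u i t + \<eta>" using contact[OF t0 t(1)] by auto
      have "\<bar>p - q\<bar> < d1" using slope_ge[of t p] slope_le[of t p] t \<epsilon> by auto
      moreover have "\<bar>t - s\<bar> < d1" using c(1) r by linarith
      ultimately have "\<bar>G i u t p - G i u s q\<bar> < g / 2" by (rule d1(2)[OF t0, rotated])
      moreover have "G i W t p \<le> G i u t p + g / 2"
        using d2(2)[OF lipK W(1,2) t0] W(3) c(2) \<eta>'(3) by simp
      ultimately show ?thesis unfolding g_def by argo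
    qed
    have G0: "q - \<rho> \<le> p" if "s = 0" "jet i b 0 p" for p
      using slope_ge[of 0 p] that bs \<eta>(1) a_pos[OF i] \<epsilon> by auto
    show "\<exists>b. bump i u s q \<rho> K \<eta> b"
      using bs bM blip Gle G0 unfolding bump_def by (intro exI[of _ b] conjI) blast+
  qed
qed

text \<open>Such a \<open>W\<close> is itself a candidate. Where it equals \<open>u\<close>, its
  jets are jets of \<open>u\<close> and \<open>G_mono\<close> lowers \<open>G\<close>, so raising
  elsewhere does no harm through the nonlocal term; where it is larger, the hypotheses
  apply.\<close>

lemma maximal_no_bump:
  assumes u: "lip L u" "bdd u" "subsol u" "\<And>w. w \<in> candidates \<Longrightarrow> below w u"
    and W: "lip K W" "below u W" "\<And>i t. i \<in> {1..N} \<Longrightarrow> t \<in> {0..a i} \<Longrightarrow> W i t \<le> M"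
    and inner: "\<And>i t p. i \<in> {1..N} \<Longrightarrow> 0 < t \<Longrightarrow> t < a i \<Longrightarrow> u i t < W i t \<Longrightarrow> jet i (W i) t p \<Longrightarrow> G i W t p \<le> 0"
    and vertex: "\<And>p. (\<And>i. i \<in> {1..N} \<Longrightarrow> u i 0 < W i 0 \<and> jet i (W i) 0 (p i)) \<Longrightarrow> - (\<Sum>i=1..N. p i) \<le> B"
    and outer: "\<And>i. i \<in> {1..N} \<Longrightarrow> u i (a i) < W i (a i) \<Longrightarrow> W i (a i) \<le> h i"
  shows "below W u"
proof -
  have uW: "u i t \<le> W i t" if "i \<in> {1..N}" "t \<in> {0..a i}" for i t
    using W(2) that unfolding below_def by blast
  have "bdd W" unfolding bdd_def
  proof (intro ballI)
    fix i t assume *: "i \<in> {1..N}" "t \<in> {0..a i}"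
    have "\<bar>u i t\<bar> \<le> M" using u(2) * unfolding bdd_def by blast
    then show "\<bar>W i t\<bar> \<le> M" using uW[OF *] W(3)[OF *] by linarith
  qed
  moreover have keep: "jet i (u i) t p \<and> G i W t p \<le> G i u t p"
    if "i \<in> {1..N}" "t \<in> {0..a i}" "\<not> u i t < W i t" "jet i (W i) t p" for i t p
  proof -
    have eq: "W i t = u i t" using uW[OF that(1,2)] that(3) by simp
    have "jet i (u i) t p" by (rule superjet_mono[OF that(4)]) (use uW that(1) eq in auto)
    then show ?thesis using G_mono[OF u(1) W(1,2) that(1,2) eq] by blast
  qed
  moreover have "subsol W" unfolding subsol_def
  proof (intro conjI ballI allI impI)
    fix i t p assume *: "i \<in> {1..N}" "0 < t" "t < a i" "jet i (W i) t p"
    show "G i W t p \<le> 0"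
    proof (cases "u i t < W i t")
      case True
      then show ?thesis using inner * by blast
    next
      case False
      then have "jet i (u i) t p" "G i W t p \<le> G i u t p" using keep[OF *(1) _ False *(4)] * by auto
      moreover have "G i u t p \<le> 0" using u(3) * calculation(1) unfolding subsol_def by blast
      ultimately show ?thesis by linarith
    qed
  next
    fix p assume p: "\<forall>i\<in>{1..N}. jet i (W i) 0 (p i)"
    show "(\<exists>i\<in>{1..N}. G i W 0 (p i) \<le> 0) \<or> - (\<Sum>i=1..N. p i) \<le> B"
    proof (cases "\<forall>i\<in>{1..N}. u i 0 < W i 0")
      case True
      then show ?thesis using vertex[of p] p by blast
    next
      case False
      then obtain j where j: "j \<in> {1..N}" "\<not> u j 0 < W j 0" by blast
      \<comment> \<open>Both functions have a single value at the vertex: not raised on one leg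
        means raised on none.\<close>
      have k: "jet i (u i) 0 (p i) \<and> G i W 0 (p i) \<le> G i u 0 (p i)" if i: "i \<in> {1..N}" for i
      proof (rule keep[OF i])
        show "\<not> u i 0 < W i 0"
          using j(2) star_lipschitzD(2)[OF u(1) i j(1)] star_lipschitzD(2)[OF W(1) i j(1)] by simp
      qed (use a_pos[OF i] p i in auto)
      then have "(\<exists>i\<in>{1..N}. G i u 0 (p i) \<le> 0) \<or> - (\<Sum>i=1..N. p i) \<le> B"
        using u(3) unfolding subsol_def by blast
      then show ?thesis using k by (meson order_trans)
    qed
  next
    fix i p assume *: "i \<in> {1..N}" "jet i (W i) (a i) p"
    show "G i W (a i) p \<le> 0 \<or> W i (a i) \<le> h i"
    proof (cases "u i (a i) < W i (a i)")
      case True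
      then show ?thesis using outer * by blast
    next
      case False
      have ai: "a i \<in> {0..a i}" using a_pos[OF *(1)] by simp
      have k: "jet i (u i) (a i) p" "G i W (a i) p \<le> G i u (a i) p"
        using keep[OF *(1) ai False *(2)] by auto
      have "G i u (a i) p \<le> 0 \<or> u i (a i) \<le> h i" using u(3) *(1) k(1) unfolding subsol_def by blast
      then show ?thesis using k(2) False by linarith
    qed
  qed
  ultimately have "W \<in> candidates" using W(1) unfolding candidates_def by blast
  then show ?thesis by (rule u(4))
qed

text \<open>If \<open>u\<close> attained \<open>M\<close> at \<open>s\<close>, the constant
  \<open>M\<close> would touch it from above, and \<open>G_mono\<close> with coercivity would give
  \<open>G i u s q \<ge> lam * M - C_H \<ge> 0\<close>. Thus there is room for a bump wherever one
  is wanted.\<close>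

lemma below_max_if_G_neg:
  assumes "lip L u" "bdd u" "i \<in> {1..N}" "s \<in> {0..a i}" "G i u s q < 0"
  shows "u i s < M"
proof (rule ccontr)
  assume "\<not> ?thesis"
  moreover have uM: "u j t \<le> M" if "j \<in> {1..N}" "t \<in> {0..a j}" for j t
    using assms(2) that unfolding bdd_def by (meson abs_le_D1)
  ultimately have eq: "u i s = M" using assms(3,4) by force
  have "G i (\<lambda>_ _. M) s q \<le> G i u s q"
    by (rule G_mono[OF assms(1) lip_const _ assms(3,4)]) (use uM eq in \<open>auto simp: below_def\<close>)
  moreover have "- C_H \<le> H i s q"
    using H_lower[OF assms(3,4), of q] C_H by (smt (verit) divide_nonneg_pos)
  moreover have "C_H \<le> lam * M"
  proof -
    have "C_H * 1 \<le> C_H * (1 + \<bar>B\<bar>)" using C_H by (intro mult_left_mono) auto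
    then show ?thesis using M_lam by simp
  qed
  ultimately show False using assms(5) I_const[OF assms(3,4), of M] by (simp add: G_def)
qed

lemma maximal_supersol:
  assumes u: "lip L u" "bdd u" "subsol u" "\<And>w. w \<in> candidates \<Longrightarrow> below w u"
  shows "supersol u"
proof -
  have L: "0 \<le> L" using u(1) by (rule star_lipschitz_nonneg)
  have single: False
    if i: "i \<in> {1..N}" and s: "0 < s" "s \<le> a i" and hs: "s = a i \<Longrightarrow> u i s < h i"
      and jet: "jet i (\<lambda>t. - u i t) s (- q)" and G: "G i u s q < 0" for i s q
  proof -
    have s0: "s \<in> {0..a i}" using s by simp
    \<comment> \<open>Only leg \<open>i\<close> is raised. The radius keeps the raised part off the
      vertex and, unless \<open>s\<close> is the outer end, off that end too.\<close>
    define \<rho> where "\<rho> = (if s = a i then s else min s (a i - s))"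
    define K where "K = L + \<bar>q\<bar> + 3"
    have \<rho>: "0 < \<rho>" "\<rho> \<le> s" "s \<noteq> a i \<Longrightarrow> \<rho> \<le> a i - s" using s by (auto simp: \<rho>_def)
    obtain \<eta>0 where \<eta>0: "0 < \<eta>0" "\<And>\<eta>. 0 < \<eta> \<Longrightarrow> \<eta> \<le> \<eta>0 \<Longrightarrow> \<exists>b. bump i u s q \<rho> K \<eta> b"
      using local_bump[OF u(1,2) i s0 jet G \<rho>(1) below_max_if_G_neg[OF u(1,2) i s0 G], of K]
      unfolding K_def by auto
    \<comment> \<open>At an outer end the height must not pass \<open>h i\<close>, so that the
      raised function satisfies the Dirichlet alternative.\<close>
    define \<eta> where "\<eta> = (if s = a i then min \<eta>0 (h i - u i s) else \<eta>0)"
    have \<eta>: "0 < \<eta>" "\<eta> \<le> \<eta>0" using \<eta>0(1) hs by (auto simp: \<eta>_def)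
    obtain b where "bump i u s q \<rho> K \<eta> b" using \<eta>0(2)[OF \<eta>] by blast
    note b = bumpD[OF this]
    define W where "W = u(i := b)"
    have Wi: "W i = b" "\<And>j. j \<noteq> i \<Longrightarrow> W j = u j" by (simp_all add: W_def)
    have b0: "b 0 = u i 0"
    proof (rule ccontr)
      assume "b 0 \<noteq> u i 0"
      then have "u i 0 < b 0" "0 \<in> {0..a i}" using b(2)[of 0] s by force+
      then have "\<bar>0 - s\<bar> < \<rho>" by (intro b(4))
      then show False using \<rho> s by linarith
    qed
    have W0: "W j 0 = u j 0" for j using b0 by (simp add: W_def)
    have lipK: "lip K u" using star_lipschitz_mono[OF u(1)] by (simp add: K_def)
    have lipW: "lip K W"
    proof (rule star_lipschitzI)
      show "0 \<le> K" using L by (simp add: K_def)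
      show "\<bar>W j t - W j t'\<bar> \<le> K * \<bar>t - t'\<bar>" if "j \<in> {1..N}" "t \<in> {0..a j}" "t' \<in> {0..a j}" for j t t'
        using star_lipschitzD(1)[OF lipK that] b(5)[of t t'] that by (cases "j = i") (auto simp: Wi)
      show "W j 0 = W k 0" if "j \<in> {1..N}" "k \<in> {1..N}" for j k
        using star_lipschitzD(2)[OF u(1) that] W0 by simp
    qed
    have uM: "u j t \<le> M" if "j \<in> {1..N}" "t \<in> {0..a j}" for j t
      using u(2) that unfolding bdd_def by (meson abs_le_D1)
    have uW: "below u W" unfolding below_def
    proof (intro ballI)
      show "u j t \<le> W j t" if "j \<in> {1..N}" "t \<in> {0..a j}" for j t
        using b(2)[of t] that by (cases "j = i") (auto simp: Wi)
    qed
    have "below W u"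
    proof (rule maximal_no_bump[OF u lipW uW])
      show "W j t \<le> M" if "j \<in> {1..N}" "t \<in> {0..a j}" for j t
        using uM[OF that] b(3)[of t] that by (cases "j = i") (auto simp: Wi)
      show "G j W t p \<le> 0" if "j \<in> {1..N}" "0 < t" "t < a j" "u j t < W j t" "jet j (W j) t p" for j t p
        using b(6)[OF lipW uW, of t p] that by (cases "j = i") (auto simp: Wi)
      show "- (\<Sum>j=1..N. p j) \<le> B"
        if "\<And>j. j \<in> {1..N} \<Longrightarrow> u j 0 < W j 0 \<and> jet j (W j) 0 (p j)" for p
        using that[OF i] W0[of i] by simp
      show "W j (a j) \<le> h j" if j: "j \<in> {1..N}" "u j (a j) < W j (a j)" for j
      proof -
        have ji: "j = i" using j(2) Wi(2)[of j] by force
        then have lt: "u i (a i) < b (a i)" using j(2) Wi(1) by simp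
        have "a i \<in> {0..a i}" using s by simp
        then have "\<bar>a i - s\<bar> < \<rho>" using lt by (rule b(4))
        then have sa: "s = a i" using \<rho>(3) by linarith
        then have "\<eta> \<le> h i - u i s" by (simp add: \<eta>_def)
        then show ?thesis using ji Wi(1) b(1) sa by simp
      qed
    qed
    then have "W i s \<le> u i s" using i s0 unfolding below_def by blast
    then show False using b(1) \<eta>(1) Wi(1) by simp
  qed
  have vertex: False
    if jet: "\<And>i. i \<in> {1..N} \<Longrightarrow> jet i (\<lambda>t. - u i t) 0 (- q i)"
      and G: "\<And>i. i \<in> {1..N} \<Longrightarrow> G i u 0 (q i) < 0" and B: "- (\<Sum>i=1..N. q i) < B" for q
  proof -
    \<comment> \<open>Each leg's equal share of the Kirchhoff deficit: if every slope loses at most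
      \<open>c\<close>, the sum of the slopes stays at least \<open>- B\<close>.\<close>
    define c where "c = (B + (\<Sum>i=1..N. q i)) / N"
    have c: "0 < c" using B N by (simp add: c_def)
    define \<rho> where "\<rho> i = min (a i) c" for i
    define K where "K = L + (\<Sum>i=1..N. \<bar>q i\<bar>) + 3"
    have "\<exists>\<eta>0>0. \<forall>\<eta>. 0 < \<eta> \<longrightarrow> \<eta> \<le> \<eta>0 \<longrightarrow> (\<exists>b. bump i u 0 (q i) (\<rho> i) K \<eta> b)" if i: "i \<in> {1..N}" for i
    proof -
      have s0: "0 \<in> {0..a i}" using a_pos[OF i] by simp
      have \<rho>: "0 < \<rho> i" using a_pos[OF i] c by (simp add: \<rho>_def)
      have K: "L + \<bar>q i\<bar> + 3 \<le> K"
        using i member_le_sum[of i "{1..N}" "\<lambda>i. \<bar>q i\<bar>"] by (simp add: K_def)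
      obtain \<eta>0 where "0 < \<eta>0" "\<And>\<eta>. 0 < \<eta> \<Longrightarrow> \<eta> \<le> \<eta>0 \<Longrightarrow> \<exists>b. bump i u 0 (q i) (\<rho> i) K \<eta> b"
        using local_bump[OF u(1,2) i s0 jet[OF i] G[OF i] \<rho> below_max_if_G_neg[OF u(1,2) i s0 G[OF i]] K]
        by blast
      then show ?thesis by blast
    qed
    then obtain \<eta>0 where \<eta>0: "\<And>i. i \<in> {1..N} \<Longrightarrow> 0 < \<eta>0 i"
      "\<And>i \<eta>. i \<in> {1..N} \<Longrightarrow> 0 < \<eta> \<Longrightarrow> \<eta> \<le> \<eta>0 i \<Longrightarrow> \<exists>b. bump i u 0 (q i) (\<rho> i) K \<eta> b"
      by metis
    \<comment> \<open>A common height makes the raised legs agree at the vertex.\<close>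
    define \<eta> where "\<eta> = Min (\<eta>0 ` {1..N})"
    have \<eta>: "0 < \<eta>" "\<And>i. i \<in> {1..N} \<Longrightarrow> \<eta> \<le> \<eta>0 i" using \<eta>0(1) N by (auto simp: \<eta>_def)
    have "\<forall>i\<in>{1..N}. \<exists>b. bump i u 0 (q i) (\<rho> i) K \<eta> b"
      using \<eta>0(2) \<eta> by blast
    from bchoice[OF this] obtain W where "\<And>i. i \<in> {1..N} \<Longrightarrow> bump i u 0 (q i) (\<rho> i) K \<eta> (W i)"
      by blast
    note W = bumpD[OF this]
    have lipW: "lip K W"
    proof (rule star_lipschitzI)
      show "0 \<le> K" using L by (simp add: K_def sum_nonneg)
      show "\<bar>W i t - W i t'\<bar> \<le> K * \<bar>t - t'\<bar>" if "i \<in> {1..N}" "t \<in> {0..a i}" "t' \<in> {0..a i}" for i t t'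
        using W(5)[OF that] .
      show "W i 0 = W j 0" if "i \<in> {1..N}" "j \<in> {1..N}" for i j
        using star_lipschitzD(2)[OF u(1) that] W(1)[OF that(1)] W(1)[OF that(2)] by simp
    qed
    have uW: "below u W" unfolding below_def using W(2) by blast
    have "below W u"
    proof (rule maximal_no_bump[OF u lipW uW])
      show "W j t \<le> M" if "j \<in> {1..N}" "t \<in> {0..a j}" for j t using W(3)[OF that] .
      show "G j W t p \<le> 0" if "j \<in> {1..N}" "0 < t" "t < a j" "u j t < W j t" "jet j (W j) t p" for j t p
        using W(6)[OF that(1) lipW uW refl that(4,2,3,5)] .
      show "- (\<Sum>j=1..N. p j) \<le> B"
        if p: "\<And>j. j \<in> {1..N} \<Longrightarrow> u j 0 < W j 0 \<and> jet j (W j) 0 (p j)" for p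
      proof -
        have "q j - c \<le> p j" if j: "j \<in> {1..N}" for j
          using W(7)[OF j refl, of "p j"] p[OF j] unfolding \<rho>_def by linarith
        then have "(\<Sum>j=1..N. q j - c) \<le> (\<Sum>j=1..N. p j)" by (intro sum_mono) auto
        moreover have "(\<Sum>j=1..N. q j - c) = - B" using N by (simp add: sum_subtractf c_def)
        ultimately show ?thesis by linarith
      qed
      show "W j (a j) \<le> h j" if j: "j \<in> {1..N}" "u j (a j) < W j (a j)" for j
      proof -
        have "a j \<in> {0..a j}" using a_pos[OF j(1)] by simp
        then have "\<bar>a j - 0\<bar> < \<rho> j" using W(4)[OF j(1)] j(2) by blast
        then show ?thesis unfolding \<rho>_def by linarith
      qed
    qed
    moreover have "1 \<in> {1..N}" "0 \<in> {0..a 1}" using N a_pos[of 1] by auto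
    ultimately have "W 1 0 \<le> u 1 0" unfolding below_def by blast
    then show False using W(1)[of 1] \<eta>(1) N by simp
  qed
  show ?thesis unfolding supersol_def
  proof (intro conjI ballI allI impI)
    show "0 \<le> G i u s q" if "i \<in> {1..N}" "0 < s" "s < a i" "jet i (\<lambda>t. - u i t) s (- q)" for i s q
      by (rule ccontr) (use single[of i s q] that in auto)
    show "0 \<le> G i u (a i) q \<or> h i \<le> u i (a i)"
      if "i \<in> {1..N}" "jet i (\<lambda>t. - u i t) (a i) (- q)" for i q
      by (rule ccontr) (use single[of i "a i" q] that a_pos[of i] in auto)
    show "(\<exists>i\<in>{1..N}. 0 \<le> G i u 0 (q i)) \<or> B \<le> - (\<Sum>i=1..N. q i)"
      if "\<forall>i\<in>{1..N}. jet i (\<lambda>t. - u i t) 0 (- q i)" for q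
    proof (rule ccontr)
      assume "\<not> ?thesis"
      then have "\<And>i. i \<in> {1..N} \<Longrightarrow> G i u 0 (q i) < 0" "- (\<Sum>i=1..N. q i) < B"
        by (meson not_le)+
      then show False using vertex[of q] that by blast
    qed
  qed
qed

lemma lipschitz_solution_exists:
  obtains L u where "lip L u" "subsol u" "supersol u"
proof (rule envelope)
  fix L u
  assume u: "lip L u" "bdd u" "\<And>w. w \<in> candidates \<Longrightarrow> below w u" "\<And>w. w \<in> candidates \<Longrightarrow> lip L w"
    "\<And>i s e. i \<in> {1..N} \<Longrightarrow> s \<in> {0..a i} \<Longrightarrow> 0 < e \<Longrightarrow> \<exists>w\<in>candidates. u i s - e < w i s"
  then have "subsol u" by (intro envelope_subsol)
  then show thesis using that maximal_supersol u(1-3) by blast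
qed

end

section \<open>The nonlocal operator\<close>

text \<open>Finite because \<open>sig < 1\<close>: two reflected copies of the integral over
  \<open>{0..r}\<close>, then a shift by \<open>e\<close>. The shared point 0 is harmless, as
  \<open>0 powr x = 0\<close>.\<close>

lemma abs_powr_integral:
  fixes sig :: real
  assumes "0 < sig" "sig < 1" "0 \<le> r"
  shows "has_bochner_integral lebesgue (\<lambda>z. indicator {-r..r} (z - e) * \<bar>z - e\<bar> powr (- sig))
    (2 * (r powr (1 - sig) / (1 - sig)))"
proof -
  define q :: "real \<Rightarrow> real" where "q t = indicator {0..r} t * t powr (- sig)" for t
  have int: "((\<lambda>t. t powr (- sig)) has_integral (r powr (1 - sig) / (1 - sig))) {0..r}"
    using has_integral_powr_from_0[of "- sig" r] assms by simp
  then have ai: "set_integrable lebesgue {0..r} (\<lambda>t. t powr (- sig))"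
    by (intro nonnegative_absolutely_integrable_1) auto
  have q: "has_bochner_integral lebesgue q (r powr (1 - sig) / (1 - sig))"
    using ai set_lebesgue_integral_eq_integral(2)[OF ai] integral_unique[OF int]
    unfolding has_bochner_integral_iff q_def set_integrable_def set_lebesgue_integral_def by simp
  have q': "has_bochner_integral lebesgue (\<lambda>t. q (- t)) (r powr (1 - sig) / (1 - sig))"
    using q has_bochner_integral_lebesgue_real_affine_iff[of "-1" q _ 0] by simp
  have "q t + q (- t) = indicator {-r..r} t * \<bar>t\<bar> powr (- sig)" for t
    by (cases "t = 0") (auto simp: q_def indicator_def abs_if)
  then have "has_bochner_integral lebesgue (\<lambda>t. indicator {-r..r} t * \<bar>t\<bar> powr (- sig))
      (2 * (r powr (1 - sig) / (1 - sig)))"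
    using has_bochner_integral_add[OF q q'] by simp
  then show ?thesis
    using has_bochner_integral_lebesgue_real_affine_iff[of 1
        "\<lambda>t. indicator {-r..r} t * \<bar>t\<bar> powr (- sig)" _ "- e"] by simp
qed

text \<open>The geodesic distance is \<open>\<bar>z - offset i j s\<bar>\<close>: from a point \<open>s\<close> of leg \<open>i\<close>, the point \<open>z\<close> of leg
  \<open>j\<close> has distance \<open>\<bar>z - s\<bar>\<close> if \<open>i = j\<close> and \<open>z + s\<close> otherwise.\<close>

definition offset :: "nat \<Rightarrow> nat \<Rightarrow> real \<Rightarrow> real" where
  "offset i j s = (if i = j then s else - s)"

text \<open>For different legs the path runs through the vertex, where both leg functions agree; its
  length is \<open>z + s\<close>.\<close>

lemma star_lipschitz_offset:
  assumes "star_lipschitz N a K U" "i \<in> {1..N}" "j \<in> {1..N}" "s \<in> {0..a i}" "z \<in> {0..a j}"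
  shows "\<bar>U j z - U i s\<bar> \<le> K * \<bar>z - offset i j s\<bar>"
proof (cases "i = j")
  case True
  then show ?thesis using star_lipschitzD(1)[OF assms(1,3)] assms by (simp add: offset_def)
next
  case False
  have "\<bar>U j z - U j 0\<bar> \<le> K * \<bar>z - 0\<bar>" "\<bar>U i 0 - U i s\<bar> \<le> K * \<bar>0 - s\<bar>"
    using assms by (intro star_lipschitzD(1)[OF assms(1)]; auto)+
  moreover have "U i 0 = U j 0" using star_lipschitzD(2)[OF assms(1-3)] .
  ultimately have "\<bar>U j z - U i s\<bar> \<le> K * z + K * s" using assms(4,5) by simp
  then show ?thesis using False assms(4,5) by (simp add: offset_def distrib_left)
qed

text \<open>\<open>k_nonpos\<close> extends the kernel by 0 to the whole line, so that each section
  in \<open>r\<close> is one Lebesgue measurable function of a real variable and can be composed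
  with affine maps.\<close>

locale star_kernel =
  fixes N :: nat and a :: "nat \<Rightarrow> real" and Lam sig :: real
    and k :: "nat \<Rightarrow> nat \<Rightarrow> real \<Rightarrow> real \<Rightarrow> real"
  assumes N: "1 \<le> N" and a_pos: "\<And>i. i \<in> {1..N} \<Longrightarrow> 0 < a i" and Lam: "0 < Lam"
    and sig: "0 < sig" "sig < 1"
    and k_nonpos: "\<And>i j s r. r \<le> 0 \<Longrightarrow> k i j s r = 0"
    and k_bound: "\<And>i j s r. i \<in> {1..N} \<Longrightarrow> j \<in> {1..N} \<Longrightarrow> s \<in> {0..a i} \<Longrightarrow> 0 < r \<Longrightarrow>
      0 \<le> k i j s r \<and> k i j s r \<le> Lam * r powr (- 1 - sig)"
    and k_lip: "\<And>i j s t r. i \<in> {1..N} \<Longrightarrow> j \<in> {1..N} \<Longrightarrow> s \<in> {0..a i} \<Longrightarrow> t \<in> {0..a i} \<Longrightarrow> 0 < r \<Longrightarrow>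
      \<bar>k i j s r - k i j t r\<bar> \<le> Lam * r powr (- 1 - sig) * \<bar>s - t\<bar>"
    and k_meas: "\<And>i j s. i \<in> {1..N} \<Longrightarrow> j \<in> {1..N} \<Longrightarrow> s \<in> {0..a i} \<Longrightarrow>
      k i j s \<in> borel_measurable lebesgue"
begin

definition I :: "nat \<Rightarrow> (nat \<Rightarrow> real \<Rightarrow> real) \<Rightarrow> real \<Rightarrow> real" where
  "I i U s = (\<Sum>j=1..N. LINT z:{0<..<a j}|lebesgue. (U j z - U i s) * k i j s \<bar>z - offset i j s\<bar>)"

text \<open>The sections are only Lebesgue measurable, and affine invariance does not cover
  composition with the absolute value. Since \<open>k\<close> vanishes for \<open>r \<le> 0\<close>,
  its value at \<open>\<bar>z - e\<bar>\<close> is the sum of its values at \<open>z - e\<close> and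
  \<open>e - z\<close>.\<close>

lemma kernel_measurable_shift:
  assumes "i \<in> {1..N}" "j \<in> {1..N}" "s \<in> {0..a i}"
  shows "(\<lambda>z. k i j s \<bar>z - e\<bar>) \<in> borel_measurable lebesgue"
proof -
  have aff: "(\<lambda>x::real. t + c * x) \<in> lebesgue \<rightarrow>\<^sub>M lebesgue" if "c \<noteq> 0" for t c
    using lebesgue_affine_measurable[where c = "\<lambda>x::real. c" and t = t] that by simp
  have 1: "(\<lambda>z. k i j s (- e + 1 * z)) \<in> borel_measurable lebesgue"
    by (rule measurable_compose[OF aff k_meas[OF assms]]) simp
  have 2: "(\<lambda>z. k i j s (e + (- 1) * z)) \<in> borel_measurable lebesgue"
    by (rule measurable_compose[OF aff k_meas[OF assms]]) simp
  have "k i j s \<bar>z - e\<bar> = k i j s (- e + 1 * z) + k i j s (e + (- 1) * z)" for z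
    by (cases "e \<le> z") (auto simp: k_nonpos abs_if)
  then show ?thesis using borel_measurable_add[OF 1 2] by (simp cong: measurable_cong)
qed

lemma kernel_nonneg:
  assumes "i \<in> {1..N}" "j \<in> {1..N}" "s \<in> {0..a i}"
  shows "0 \<le> k i j s r"
  using k_bound[OF assms, of r] k_nonpos[of r i j s] by (cases "0 < r") auto

text \<open>One factor of distance, supplied by a Lipschitz difference, lowers the singularity from
  order \<open>1 + sig\<close> to the integrable order \<open>sig\<close>.\<close>

lemma kernel_times_abs:
  assumes "i \<in> {1..N}" "j \<in> {1..N}" "s \<in> {0..a i}"
  shows "\<bar>t\<bar> * k i j s \<bar>t\<bar> \<le> Lam * \<bar>t\<bar> powr (- sig)"
proof (cases "t = 0")
  case False
  then have "\<bar>t\<bar> * k i j s \<bar>t\<bar> \<le> \<bar>t\<bar> * (Lam * \<bar>t\<bar> powr (- 1 - sig))"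
    using k_bound[OF assms, of "\<bar>t\<bar>"] by (intro mult_left_mono) auto
  also have "\<dots> = Lam * (\<bar>t\<bar> powr 1 * \<bar>t\<bar> powr (- 1 - sig))" using False by simp
  also have "\<dots> = Lam * \<bar>t\<bar> powr (- sig)" unfolding powr_add[symmetric] by simp
  finally show ?thesis .
qed (use Lam in simp)

lemma kernel_integrable:
  assumes ij: "i \<in> {1..N}" "j \<in> {1..N}" "s \<in> {0..a i}"
    and S: "S \<in> sets lebesgue" "S \<subseteq> {0..a j}"
    and g: "continuous_on {0..a j} g" "\<And>z. z \<in> S \<Longrightarrow> \<bar>g z\<bar> \<le> K * \<bar>z - e\<bar>"
  shows "set_integrable lebesgue S (\<lambda>z. g z * k i j s \<bar>z - e\<bar>)"
proof (rule set_integrable_bound)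
  define r where "r = a j + \<bar>e\<bar>"
  have r: "0 \<le> r" using a_pos[OF ij(2)] by (simp add: r_def)
  have "integrable lebesgue (\<lambda>z. \<bar>K\<bar> * Lam * (indicator {-r..r} (z - e) * \<bar>z - e\<bar> powr (- sig)))"
    using abs_powr_integral[OF sig r] by (intro integrable_mult_right) (simp add: has_bochner_integral_iff)
  then have "set_integrable lebesgue UNIV (\<lambda>z. \<bar>K\<bar> * Lam * (indicator {-r..r} (z - e) * \<bar>z - e\<bar> powr (- sig)))"
    by (simp add: set_integrable_def)
  then show "set_integrable lebesgue S (\<lambda>z. \<bar>K\<bar> * Lam * (indicator {-r..r} (z - e) * \<bar>z - e\<bar> powr (- sig)))"
    by (rule set_integrable_subset) (use S in auto)
  have gm: "(\<lambda>z. indicator {0..a j} z *\<^sub>R g z) \<in> borel_measurable lebesgue"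
    using borel_measurable_continuous_on_indicator[OF _ g(1)]
    by (intro measurable_completion) simp
  have im: "indicator S \<in> borel_measurable lebesgue" using S(1) by simp
  have "(\<lambda>z. indicator S z * (indicator {0..a j} z *\<^sub>R g z * k i j s \<bar>z - e\<bar>)) \<in> borel_measurable lebesgue"
    by (intro borel_measurable_times im gm kernel_measurable_shift[OF ij])
  moreover have "indicator S z * (indicator {0..a j} z *\<^sub>R g z * k i j s \<bar>z - e\<bar>) = indicator S z *\<^sub>R (g z * k i j s \<bar>z - e\<bar>)" for z
    using S(2) by (auto simp: indicator_def)
  ultimately show "set_borel_measurable lebesgue S (\<lambda>z. g z * k i j s \<bar>z - e\<bar>)"
    unfolding set_borel_measurable_def by (simp only:)
  show "AE z in lebesgue. z \<in> S \<longrightarrow> norm (g z * k i j s \<bar>z - e\<bar>) \<le>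
    norm (\<bar>K\<bar> * Lam * (indicator {-r..r} (z - e) * \<bar>z - e\<bar> powr (- sig)))"
  proof (intro AE_I2 impI)
    fix z assume z: "z \<in> S"
    then have "0 \<le> z" "z \<le> a j" using S(2) by auto
    then have "- r \<le> z - e" "z - e \<le> r" unfolding r_def by linarith+
    then have ind: "indicator {-r..r} (z - e) = (1::real)" by simp
    have "norm (g z * k i j s \<bar>z - e\<bar>) = \<bar>g z\<bar> * k i j s \<bar>z - e\<bar>"
      using kernel_nonneg[OF ij] by (simp add: abs_mult)
    also have "\<dots> \<le> (\<bar>K\<bar> * \<bar>z - e\<bar>) * k i j s \<bar>z - e\<bar>"
      using g(2)[OF z] kernel_nonneg[OF ij] mult_right_mono[of K "\<bar>K\<bar>" "\<bar>z - e\<bar>"]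
      by (intro mult_right_mono) linarith+
    also have "\<dots> \<le> \<bar>K\<bar> * (Lam * \<bar>z - e\<bar> powr (- sig))"
      unfolding mult.assoc by (intro mult_left_mono kernel_times_abs[OF ij]) auto
    finally show "norm (g z * k i j s \<bar>z - e\<bar>) \<le> norm (\<bar>K\<bar> * Lam * (indicator {-r..r} (z - e) * \<bar>z - e\<bar> powr (- sig)))"
      using ind Lam by (simp add: abs_mult)
  qed
qed

lemma difference_integrable:
  assumes U: "star_lipschitz N a K U" and ij: "i \<in> {1..N}" "j \<in> {1..N}" "s \<in> {0..a i}"
    and S: "S \<in> sets lebesgue" "S \<subseteq> {0..a j}"
  shows "set_integrable lebesgue S (\<lambda>z. (U j z - U i s) * k i j s \<bar>z - offset i j s\<bar>)"
proof (rule kernel_integrable[OF ij S])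
  show "continuous_on {0..a j} (\<lambda>z. U j z - U i s)"
    by (intro continuous_intros star_lipschitz_continuous_on[OF U ij(2)])
  show "\<bar>U j z - U i s\<bar> \<le> K * \<bar>z - offset i j s\<bar>" if "z \<in> S" for z
    using star_lipschitz_offset[OF U ij] S(2) that by blast
qed

section \<open>Quantitative bounds on the nonlocal term\<close>

text \<open>A one-sided estimate in which the bound by the distance costs \<open>\<theta>\<close>
  per unit of \<open>K\<close> and the bound \<open>\<eta>\<close> costs \<open>C\<close> per unit.
  One \<open>C\<close> serves all \<open>K\<close> and \<open>\<eta>\<close>: a fixed bound
  \<open>\<eta>\<close> gives \<open>I_growth\<close>, a small one gives
  \<open>I_stable\<close>.\<close>

definition kernel_bound :: "real \<Rightarrow> real \<Rightarrow> bool" where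
  "kernel_bound \<theta> C \<longleftrightarrow> (\<forall>K \<eta> g i j s. 0 \<le> K \<longrightarrow> 0 \<le> \<eta> \<longrightarrow> i \<in> {1..N} \<longrightarrow> j \<in> {1..N} \<longrightarrow> s \<in> {0..a i} \<longrightarrow>
     set_integrable lebesgue {0<..<a j} (\<lambda>z. g z * k i j s \<bar>z - offset i j s\<bar>) \<longrightarrow>
     (\<forall>z\<in>{0<..<a j}. g z \<le> \<eta> \<and> g z \<le> K * \<bar>z - offset i j s\<bar>) \<longrightarrow>
     (LINT z:{0<..<a j}|lebesgue. g z * k i j s \<bar>z - offset i j s\<bar>) \<le> \<theta> * K + C * \<eta>)"

lemma kernel_boundD:
  assumes "kernel_bound \<theta> C" "0 \<le> K" "0 \<le> \<eta>" "i \<in> {1..N}" "j \<in> {1..N}" "s \<in> {0..a i}"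
    "set_integrable lebesgue {0<..<a j} (\<lambda>z. g z * k i j s \<bar>z - offset i j s\<bar>)"
    "\<And>z. z \<in> {0<..<a j} \<Longrightarrow> g z \<le> \<eta>" "\<And>z. z \<in> {0<..<a j} \<Longrightarrow> g z \<le> K * \<bar>z - offset i j s\<bar>"
  shows "(LINT z:{0<..<a j}|lebesgue. g z * k i j s \<bar>z - offset i j s\<bar>) \<le> \<theta> * K + C * \<eta>"
  using assms unfolding kernel_bound_def by simp

text \<open>\<open>\<theta>\<close> can be arbitrarily small: it is the integral of the kernel against the distance near the singularity,
  which converges since \<open>\<sigma> < 1\<close>.\<close>

lemma kernel_bound_exists:
  assumes "0 < \<theta>"
  obtains C where "0 \<le> C" "kernel_bound \<theta> C"
proof -
  define \<beta> where "\<beta> = 1 - sig"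
  have \<beta>: "0 < \<beta>" using sig by (simp add: \<beta>_def)
  \<comment> \<open>The solution of the equation \<open>small\<close>.\<close>
  define r where "r = (\<theta> / Lam * \<beta> / 2) powr (1 / \<beta>)"
  have r: "0 < r" using assms Lam \<beta> by (simp add: r_def)
  have small: "Lam * (2 * (r powr (1 - sig) / (1 - sig))) = \<theta>"
    unfolding \<beta>_def[symmetric] using assms Lam \<beta> by (simp add: r_def powr_powr)
  define A where "A = (\<Sum>j=1..N. a j)"
  have A: "0 \<le> a j" "a j \<le> A" if "j \<in> {1..N}" for j
    using a_pos that member_le_sum[of j "{1..N}" a] by (auto simp: A_def less_imp_le)
  have A0: "0 \<le> A" using A[of 1] N by simp
  define C where "C = Lam * r powr (- 1 - sig) * A"
  show ?thesis
  proof (rule that[of C])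
    show "0 \<le> C" using Lam A0 by (simp add: C_def)
    show "kernel_bound \<theta> C" unfolding kernel_bound_def
    proof (intro allI impI)
      fix K \<eta> :: real and g i j s
      assume K: "0 \<le> K" "0 \<le> \<eta>" and ij: "i \<in> {1..N}" "j \<in> {1..N}" "s \<in> {0..a i}"
        and int: "set_integrable lebesgue {0<..<a j} (\<lambda>z. g z * k i j s \<bar>z - offset i j s\<bar>)"
        and "\<forall>z\<in>{0<..<a j}. g z \<le> \<eta> \<and> g z \<le> K * \<bar>z - offset i j s\<bar>"
      then have g: "\<And>z. z \<in> {0<..<a j} \<Longrightarrow> g z \<le> \<eta>"
        "\<And>z. z \<in> {0<..<a j} \<Longrightarrow> g z \<le> K * \<bar>z - offset i j s\<bar>" by auto
      define e where "e = offset i j s"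
      define P :: "real \<Rightarrow> real" where "P z = indicator {-r..r} (z - e) * \<bar>z - e\<bar> powr (- sig)" for z
      \<comment> \<open>Bounds the integrand farther than \<open>r\<close> from the singularity,
        where the kernel is at most \<open>Lam * r powr (- 1 - sig)\<close>.\<close>
      define c where "c = Lam * r powr (- 1 - sig) * \<eta>"
      have c: "0 \<le> c" using Lam K by (simp add: c_def)
      have P: "integrable lebesgue P" "integral\<^sup>L lebesgue P = 2 * (r powr (1 - sig) / (1 - sig))"
        using abs_powr_integral[OF sig, of r e] r unfolding P_def has_bochner_integral_iff by auto
      have P0: "0 \<le> P z" for z by (simp add: P_def)
      have "set_integrable lebesgue UNIV P" using P(1) by (simp add: set_integrable_def)
      then have Ps: "set_integrable lebesgue {0<..<a j} P" by (rule set_integrable_subset) auto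
      have PI: "(LINT z:{0<..<a j}|lebesgue. P z) \<le> 2 * (r powr (1 - sig) / (1 - sig))"
        unfolding P(2)[symmetric] set_lebesgue_integral_def
        by (rule integral_mono[OF Ps[unfolded set_integrable_def] P(1)])
          (use P0 in \<open>auto simp: indicator_def\<close>)
      have ci: "set_integrable lebesgue {0<..<a j} (\<lambda>_. c)"
        using A(1)[OF ij(2)] unfolding set_integrable_def
        by (intro integrable_real_indicator integrable_scaleR_left) auto
      have cI: "(LINT z:{0<..<a j}|lebesgue. c) = c * a j"
        using A(1)[OF ij(2)] unfolding set_lebesgue_integral_def by simp
      have pt: "g z * k i j s \<bar>z - e\<bar> \<le> K * Lam * P z + c" if z: "z \<in> {0<..<a j}" for z
      proof (cases "\<bar>z - e\<bar> \<le> r")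
        case True
        then have "z - e \<in> {-r..r}" by auto
        then have Pz: "P z = \<bar>z - e\<bar> powr (- sig)" by (simp add: P_def)
        have "g z * k i j s \<bar>z - e\<bar> \<le> (K * \<bar>z - e\<bar>) * k i j s \<bar>z - e\<bar>"
          using g(2)[OF z] kernel_nonneg[OF ij] unfolding e_def by (intro mult_right_mono)
        also have "\<dots> \<le> K * (Lam * \<bar>z - e\<bar> powr (- sig))"
          unfolding mult.assoc using K by (intro mult_left_mono kernel_times_abs[OF ij]) auto
        finally show ?thesis using Pz c by simp
      next
        case False
        then have pos: "0 < \<bar>z - e\<bar>" using r by linarith
        have "g z * k i j s \<bar>z - e\<bar> \<le> \<eta> * k i j s \<bar>z - e\<bar>"
          using g(1)[OF z] kernel_nonneg[OF ij] by (intro mult_right_mono)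
        also have "\<dots> \<le> \<eta> * (Lam * r powr (- 1 - sig))"
        proof (rule mult_left_mono[OF _ K(2)])
          have "k i j s \<bar>z - e\<bar> \<le> Lam * \<bar>z - e\<bar> powr (- 1 - sig)" using k_bound[OF ij pos] by blast
          also have "\<dots> \<le> Lam * r powr (- 1 - sig)"
            using False r sig Lam by (intro mult_left_mono powr_mono2') auto
          finally show "k i j s \<bar>z - e\<bar> \<le> Lam * r powr (- 1 - sig)" .
        qed
        also have "\<dots> = c" by (simp add: c_def)
        finally show ?thesis using mult_nonneg_nonneg[of "K * Lam" "P z"] mult_nonneg_nonneg[of K Lam] K Lam P0[of z]
          by linarith
      qed
      have Pm: "set_integrable lebesgue {0<..<a j} (\<lambda>z. K * Lam * P z)"
        using Ps by (intro set_integrable_mult_right)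
      have "(LINT z:{0<..<a j}|lebesgue. g z * k i j s \<bar>z - offset i j s\<bar>)
          \<le> (LINT z:{0<..<a j}|lebesgue. K * Lam * P z + c)"
        using int pt set_integral_add(1)[OF Pm ci] unfolding e_def by (intro set_integral_mono) auto
      also have "\<dots> = K * Lam * (LINT z:{0<..<a j}|lebesgue. P z) + c * a j"
        using set_integral_add(2)[OF Pm ci] cI by simp
      also have "\<dots> \<le> K * Lam * (2 * (r powr (1 - sig) / (1 - sig))) + c * A"
        using PI K Lam A(2)[OF ij(2)] c by (intro add_mono mult_left_mono) auto
      also have "\<dots> = K * \<theta> + c * A" unfolding small[symmetric] by (simp only: mult.assoc)
      finally show "(LINT z:{0<..<a j}|lebesgue. g z * k i j s \<bar>z - offset i j s\<bar>) \<le> \<theta> * K + C * \<eta>"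
        by (simp add: C_def c_def mult.commute mult.left_commute)
    qed
  qed
qed

lemma I_const: "I i (\<lambda>_ _. c) s = 0"
  by (simp add: I_def)

lemma I_growth:
  assumes "0 < \<theta>"
  shows "\<exists>C. \<forall>K U i s. star_lipschitz N a K U \<and> (\<forall>j\<in>{1..N}. \<forall>t\<in>{0..a j}. \<bar>U j t\<bar> \<le> M) \<and>
    i \<in> {1..N} \<and> s \<in> {0..a i} \<longrightarrow> I i U s \<le> \<theta> * K + C"
proof -
  have "0 < \<theta> / N" using assms N by simp
  then obtain C where C: "0 \<le> C" "kernel_bound (\<theta> / N) C"
    by (rule kernel_bound_exists)
  have "I i U s \<le> \<theta> * K + N * (C * (2 * \<bar>M\<bar>))"
    if U: "star_lipschitz N a K U" "\<forall>j\<in>{1..N}. \<forall>t\<in>{0..a j}. \<bar>U j t\<bar> \<le> M" and i: "i \<in> {1..N}" "s \<in> {0..a i}"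
    for K U i s
  proof -
    have "I i U s \<le> (\<Sum>j=1..N. \<theta> / N * K + C * (2 * \<bar>M\<bar>))"
      unfolding I_def
    proof (rule sum_mono)
      fix j assume j: "j \<in> {1..N}"
      show "(LINT z:{0<..<a j}|lebesgue. (U j z - U i s) * k i j s \<bar>z - offset i j s\<bar>) \<le> \<theta> / N * K + C * (2 * \<bar>M\<bar>)"
      proof (rule kernel_boundD[OF C(2) _ _ i(1) j i(2)])
        show "set_integrable lebesgue {0<..<a j} (\<lambda>z. (U j z - U i s) * k i j s \<bar>z - offset i j s\<bar>)"
          by (rule difference_integrable[OF U(1) i(1) j i(2)]) auto
        show "U j z - U i s \<le> 2 * \<bar>M\<bar>" if "z \<in> {0<..<a j}" for z
        proof -
          have "\<bar>U j z\<bar> \<le> M" "\<bar>U i s\<bar> \<le> M" using U(2) j i that by auto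
          then show ?thesis by linarith
        qed
        show "U j z - U i s \<le> K * \<bar>z - offset i j s\<bar>" if "z \<in> {0<..<a j}" for z
          using star_lipschitz_offset[OF U(1) i(1) j i(2), of z] that by auto
      qed (use star_lipschitz_nonneg[OF U(1)] in auto)
    qed
    also have "\<dots> = \<theta> * K + N * (C * (2 * \<bar>M\<bar>))" using N by (simp add: sum.distrib algebra_simps)
    finally show ?thesis .
  qed
  then show ?thesis by blast
qed

text \<open>As \<open>U \<le> W\<close>, an increment of \<open>U\<close> exceeds that of
  \<open>W\<close> by at most the gap \<open>W i s - U i s \<le> d\<close>, and by at most
  \<open>2 * K\<close> times the distance. Both bounds feed \<open>kernel_bound\<close>.\<close>

lemma I_stable:
  assumes "0 < e"
  shows "\<exists>d>0. \<forall>U W i s. star_lipschitz N a K U \<and> star_lipschitz N a K W \<and>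
      (\<forall>j\<in>{1..N}. \<forall>t\<in>{0..a j}. U j t \<le> W j t) \<and> i \<in> {1..N} \<and> s \<in> {0..a i} \<and> W i s \<le> U i s + d \<longrightarrow>
      I i U s \<le> I i W s + e"
proof -
  \<comment> \<open>\<open>\<theta>\<close> and later \<open>d\<close> are chosen so that each of
    the two terms of \<open>kernel_bound\<close> costs at most \<open>e / (2 * N)\<close> per leg;
    the added 1 avoids division by 0.\<close>
  define \<theta> where "\<theta> = e / (4 * N * (\<bar>K\<bar> + 1))"
  have "0 < \<theta>" using assms N unfolding \<theta>_def by (intro divide_pos_pos mult_pos_pos) auto
  then obtain C where C: "0 \<le> C" "kernel_bound (\<theta>) C"
    by (rule kernel_bound_exists)
  define d where "d = e / (2 * N * (C + 1))"
  have d: "0 < d" using assms N C(1) unfolding d_def by (intro divide_pos_pos mult_pos_pos) auto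
  have "I i U s \<le> I i W s + e"
    if U: "star_lipschitz N a K U" and W: "star_lipschitz N a K W"
      and UW: "\<forall>j\<in>{1..N}. \<forall>t\<in>{0..a j}. U j t \<le> W j t" and i: "i \<in> {1..N}" "s \<in> {0..a i}"
      and s: "W i s \<le> U i s + d" for U W i s
  proof -
    have K: "0 \<le> K" using U by (rule star_lipschitz_nonneg)
    have "(LINT z:{0<..<a j}|lebesgue. (U j z - U i s) * k i j s \<bar>z - offset i j s\<bar>)
      \<le> (LINT z:{0<..<a j}|lebesgue. (W j z - W i s) * k i j s \<bar>z - offset i j s\<bar>) + e / N"
      if j: "j \<in> {1..N}" for j
    proof -
      have sub: "{0<..<a j} \<in> sets lebesgue" "{0<..<a j} \<subseteq> {0..a j}" by auto
      note intU = difference_integrable[OF U i(1) j i(2) sub]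
        and intW = difference_integrable[OF W i(1) j i(2) sub]
      have eq: "(U j z - U i s) * k i j s \<bar>z - offset i j s\<bar> - (W j z - W i s) * k i j s \<bar>z - offset i j s\<bar>
        = (U j z - U i s - (W j z - W i s)) * k i j s \<bar>z - offset i j s\<bar>" for z
        by (simp add: algebra_simps)
      have "(LINT z:{0<..<a j}|lebesgue. (U j z - U i s - (W j z - W i s)) * k i j s \<bar>z - offset i j s\<bar>)
        \<le> \<theta> * (2 * K) + C * d"
      proof (rule kernel_boundD[OF C(2) _ _ i(1) j i(2)])
        show "set_integrable lebesgue {0<..<a j}
          (\<lambda>z. (U j z - U i s - (W j z - W i s)) * k i j s \<bar>z - offset i j s\<bar>)"
          using set_integral_diff(1)[OF intU intW] unfolding eq .
        show "U j z - U i s - (W j z - W i s) \<le> d" if "z \<in> {0<..<a j}" for z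
        proof -
          have "U j z \<le> W j z" using UW j that by auto
          then show ?thesis using s by linarith
        qed
        show "U j z - U i s - (W j z - W i s) \<le> 2 * K * \<bar>z - offset i j s\<bar>" if "z \<in> {0<..<a j}" for z
        proof -
          have "z \<in> {0..a j}" using that by simp
          then show ?thesis
            using star_lipschitz_offset[OF U i(1) j i(2), of z] star_lipschitz_offset[OF W i(1) j i(2), of z]
            by (simp add: abs_le_iff)
        qed
      qed (use K d in auto)
      also have "\<theta> * (2 * K) \<le> e / (2 * N)"
      proof -
        have "\<theta> * (2 * K) = e / (2 * N) * (K / (K + 1))" 
        proof -
          have "K + 1 \<noteq> 0" "real N \<noteq> 0" "\<bar>K\<bar> = K" using K N by auto
          then show ?thesis by (simp add: \<theta>_def divide_simps)
        qed
        also have "\<dots> \<le> e / (2 * N) * 1" using K assms by (intro mult_left_mono) auto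
        finally show ?thesis by simp
      qed
      also have "C * d \<le> e / (2 * N)"
      proof -
        have "C * d = e / (2 * N) * (C / (C + 1))" by (simp add: d_def)
        also have "\<dots> \<le> e / (2 * N) * 1" using C(1) assms by (intro mult_left_mono) auto
        finally show ?thesis by simp
      qed
      finally have "(LINT z:{0<..<a j}|lebesgue. (U j z - U i s - (W j z - W i s)) * k i j s \<bar>z - offset i j s\<bar>)
        \<le> e / N" by simp
      then show ?thesis using set_integral_diff(2)[OF intU intW] unfolding eq by linarith
    qed
    then have "I i U s \<le> (\<Sum>j=1..N. (LINT z:{0<..<a j}|lebesgue. (W j z - W i s) * k i j s \<bar>z - offset i j s\<bar>) + e / N)"
      unfolding I_def by (intro sum_mono) auto
    also have "\<dots> = I i W s + e" using N by (simp add: I_def sum.distrib)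
    finally show ?thesis .
  qed
  then show ?thesis using d by blast
qed

text \<open>The kernel is merely measurable in the distance, so continuity in the base point is read off after
  translating the distance to the integration variable.\<close>

lemma I_cont:
  assumes U: "star_lipschitz N a K U" and i: "i \<in> {1..N}"
  shows "continuous_on {0..a i} (I i U)"
proof (rule continuous_on_sequentiallyI)
  fix x s assume x: "\<forall>n. x n \<in> {0..a i}" and s: "s \<in> {0..a i}" and lim: "x \<longlonglongrightarrow> s"
  have K: "0 \<le> K" using U by (rule star_lipschitz_nonneg)
  have "(\<lambda>n. LINT z:{0<..<a j}|lebesgue. (U j z - U i (x n)) * k i j (x n) \<bar>z - offset i j (x n)\<bar>)
    \<longlonglongrightarrow> (LINT z:{0<..<a j}|lebesgue. (U j z - U i s) * k i j s \<bar>z - offset i j s\<bar>)" if j: "j \<in> {1..N}" for j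
  proof -
    \<comment> \<open>The integrand in the signed distance variable \<open>t\<close>, common to all
      base points. The factor 1 only matches the affine substitution rule.\<close>
    define \<Phi> :: "real \<Rightarrow> real \<Rightarrow> real" where
      "\<Phi> y t = indicator {0<..<a j} (offset i j y + 1 * t) *\<^sub>R
        ((U j (offset i j y + 1 * t) - U i y) * k i j y \<bar>offset i j y + 1 * t - offset i j y\<bar>)" for y t
    have tr: "(LINT z:{0<..<a j}|lebesgue. (U j z - U i y) * k i j y \<bar>z - offset i j y\<bar>) = (\<integral>t. \<Phi> y t \<partial>lebesgue)" for y
      unfolding set_lebesgue_integral_def \<Phi>_def
      by (subst lebesgue_integral_real_affine[where c = 1 and t = "offset i j y"]) simp_all
    have meas: "\<Phi> y \<in> borel_measurable lebesgue" if y: "y \<in> {0..a i}" for y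
    proof -
      have "set_integrable lebesgue {0<..<a j} (\<lambda>z. (U j z - U i y) * k i j y \<bar>z - offset i j y\<bar>)"
        by (rule difference_integrable[OF U i j y]) auto
      then have "integrable lebesgue (\<Phi> y)"
        unfolding set_integrable_def \<Phi>_def
        by (subst lebesgue_integrable_real_affine_iff[where c = 1 and t = "offset i j y"]) simp_all
      then show ?thesis by (rule borel_measurable_integrable)
    qed
    define r where "r = a j + a i"
    have r: "0 \<le> r" using a_pos[OF i] a_pos[OF j] by (simp add: r_def)
    define w :: "real \<Rightarrow> real" where "w t = K * Lam * (indicator {-r..r} (t - 0) * \<bar>t - 0\<bar> powr (- sig))" for t
    have bound: "norm (\<Phi> y t) \<le> w t" if y: "y \<in> {0..a i}" for y t
    proof (cases "offset i j y + t \<in> {0<..<a j}")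
      case True
      have "\<bar>U j (offset i j y + t) - U i y\<bar> \<le> K * \<bar>offset i j y + t - offset i j y\<bar>"
        by (rule star_lipschitz_offset[OF U i j y]) (use True in auto)
      then have "norm (\<Phi> y t) \<le> K * \<bar>t\<bar> * k i j y \<bar>t\<bar>"
        using True kernel_nonneg[OF i j y] by (auto simp: \<Phi>_def abs_mult intro!: mult_right_mono)
      also have "\<dots> \<le> K * (Lam * \<bar>t\<bar> powr (- sig))"
        unfolding mult.assoc using K by (intro mult_left_mono kernel_times_abs[OF i j y]) auto
      also have "t \<in> {-r..r}" using True y a_pos[OF j] unfolding r_def offset_def by (auto split: if_splits)
      then have "K * (Lam * \<bar>t\<bar> powr (- sig)) = w t" by (simp add: w_def)
      finally show ?thesis .
    next
      case False
      then show ?thesis using K Lam by (simp add: \<Phi>_def w_def)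
    qed
    \<comment> \<open>Convergence may fail at these \<open>t\<close>: at 0 the kernel has no
      Lipschitz bound, at the others the shifted point lands on an end of leg
      \<open>j\<close>.\<close>
    have null: "{0, - offset i j s, a j - offset i j s} \<in> null_sets lebesgue"
      by (intro finite_imp_null_set_lborel null_sets_completionI) simp
    have "(\<lambda>n. \<integral>t. \<Phi> (x n) t \<partial>lebesgue) \<longlonglongrightarrow> (\<integral>t. \<Phi> s t \<partial>lebesgue)"
    proof (rule integral_dominated_convergence[where w = w])
      show "\<Phi> s \<in> borel_measurable lebesgue" "\<And>n. \<Phi> (x n) \<in> borel_measurable lebesgue"
        using meas x s by blast+
      show "integrable lebesgue w"
        using abs_powr_integral[OF sig r, of 0] unfolding w_def
        by (intro integrable_mult_right) (simp add: has_bochner_integral_iff)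
      show "AE t in lebesgue. norm (\<Phi> (x n) t) \<le> w t" for n
        using bound x by blast
      show "AE t in lebesgue. (\<lambda>n. \<Phi> (x n) t) \<longlonglongrightarrow> \<Phi> s t"
        using AE_not_in[OF null]
      proof eventually_elim
        fix t assume t: "t \<notin> {0, - offset i j s, a j - offset i j s}"
        define y where "y n = offset i j (x n) + t" for n
        define y0 where "y0 = offset i j s + t"
        have y: "y \<longlonglongrightarrow> y0" unfolding y_def y0_def offset_def using lim by (auto intro!: tendsto_intros)
        have y0: "y0 \<noteq> 0" "y0 \<noteq> a j" using t by (auto simp: y0_def)
        have k: "(\<lambda>n. k i j (x n) \<bar>t\<bar>) \<longlonglongrightarrow> k i j s \<bar>t\<bar>"
        proof (rule Lim_transform_bound[where g = "\<lambda>n. Lam * \<bar>t\<bar> powr (- 1 - sig) * \<bar>x n - s\<bar>" for f g, THEN LIM_zero_cancel])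
          show "\<forall>\<^sub>F n in sequentially. norm (k i j (x n) \<bar>t\<bar> - k i j s \<bar>t\<bar>)
              \<le> norm (Lam * \<bar>t\<bar> powr (- 1 - sig) * \<bar>x n - s\<bar>)"
          proof (rule always_eventually, rule allI)
            fix n
            have "\<bar>k i j (x n) \<bar>t\<bar> - k i j s \<bar>t\<bar>\<bar> \<le> Lam * \<bar>t\<bar> powr (- 1 - sig) * \<bar>x n - s\<bar>"
              using x s t by (intro k_lip[OF i j]) auto
            then show "norm (k i j (x n) \<bar>t\<bar> - k i j s \<bar>t\<bar>) \<le> norm (Lam * \<bar>t\<bar> powr (- 1 - sig) * \<bar>x n - s\<bar>)"
              by simp
          qed
          have "(\<lambda>n. Lam * \<bar>t\<bar> powr (- 1 - sig) * \<bar>x n - s\<bar>) \<longlonglongrightarrow> Lam * \<bar>t\<bar> powr (- 1 - sig) * \<bar>s - s\<bar>"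
            by (intro tendsto_intros lim)
          then show "(\<lambda>n. Lam * \<bar>t\<bar> powr (- 1 - sig) * \<bar>x n - s\<bar>) \<longlonglongrightarrow> 0" by simp
        qed
        have \<Phi>: "\<Phi> (x n) t = indicator {0<..<a j} (y n) *\<^sub>R ((U j (y n) - U i (x n)) * k i j (x n) \<bar>t\<bar>)" for n
          by (simp add: \<Phi>_def y_def)
        have \<Phi>0: "\<Phi> s t = indicator {0<..<a j} y0 *\<^sub>R ((U j y0 - U i s) * k i j s \<bar>t\<bar>)"
          by (simp add: \<Phi>_def y0_def)
        consider "y0 \<in> {0<..<a j}" | "y0 \<in> - {0..a j}" using y0 by force
        then show "(\<lambda>n. \<Phi> (x n) t) \<longlonglongrightarrow> \<Phi> s t"
        proof cases
          case 1
          then have ev: "\<forall>\<^sub>F n in sequentially. y n \<in> {0<..<a j}"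
            using y by (intro topological_tendstoD) auto
          have "isCont (U j) y0"
            using continuous_on_interior[OF star_lipschitz_continuous_on[OF U j], of y0] 1 by simp
          then have u1: "(\<lambda>n. U j (y n)) \<longlonglongrightarrow> U j y0" using y isCont_tendsto_compose by blast
          have u2: "(\<lambda>n. U i (x n)) \<longlonglongrightarrow> U i s"
            using star_lipschitz_continuous_on[OF U i] x s lim
            unfolding continuous_on_sequentially comp_def by blast
          have "(\<lambda>n. (U j (y n) - U i (x n)) * k i j (x n) \<bar>t\<bar>) \<longlonglongrightarrow> (U j y0 - U i s) * k i j s \<bar>t\<bar>"
            by (intro tendsto_intros u1 u2 k)
          moreover have "\<forall>\<^sub>F n in sequentially. (U j (y n) - U i (x n)) * k i j (x n) \<bar>t\<bar> = \<Phi> (x n) t"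
            using ev by eventually_elim (simp add: \<Phi>)
          ultimately show ?thesis using 1 \<Phi>0 by (simp add: tendsto_cong)
        next
          case 2
          then have "\<forall>\<^sub>F n in sequentially. y n \<in> - {0..a j}"
            using y by (intro topological_tendstoD) auto
          then have "\<forall>\<^sub>F n in sequentially. \<Phi> (x n) t = 0"
            by eventually_elim (auto simp: \<Phi> indicator_def)
          then show ?thesis using 2 \<Phi>0 by (auto simp: indicator_def tendsto_eventually)
        qed
      qed
    qed
    then show ?thesis unfolding tr .
  qed
  then show "(\<lambda>n. I i U (x n)) \<longlonglongrightarrow> I i U s" unfolding I_def by (intro tendsto_sum) auto
qed

section \<open>Splitting the nonlocal term at a test function\<close>

text \<open>The two nonlocal terms of \<open>Gop\<close> in leg coordinates. Each part subtracts the
  base value of its own function, so a test function may touch \<open>U\<close> up to an additive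
  constant.\<close>

definition I_split :: "real \<Rightarrow> nat \<Rightarrow> (nat \<Rightarrow> real \<Rightarrow> real) \<Rightarrow> (nat \<Rightarrow> real \<Rightarrow> real) \<Rightarrow> real \<Rightarrow> real" where
  "I_split d i U F s = (\<Sum>j=1..N.
     (LINT z:{z\<in>{0<..<a j}. d \<le> \<bar>z - offset i j s\<bar>}|lebesgue. (U j z - U i s) * k i j s \<bar>z - offset i j s\<bar>) +
     (LINT z:{z\<in>{0<..<a j}. \<bar>z - offset i j s\<bar> < d}|lebesgue. (F j z - F i s) * k i j s \<bar>z - offset i j s\<bar>))"

lemma near_far_sets:
  "{z\<in>{0<..<a j}. d \<le> \<bar>z - e\<bar>} \<in> sets lebesgue" "{z\<in>{0<..<a j}. \<bar>z - e\<bar> < d} \<in> sets lebesgue"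
proof -
  have "{z\<in>{0<..<a j}. d \<le> \<bar>z - e\<bar>} \<in> sets borel" "{z\<in>{0<..<a j}. \<bar>z - e\<bar> < d} \<in> sets borel"
    by measurable
  then show "{z\<in>{0<..<a j}. d \<le> \<bar>z - e\<bar>} \<in> sets lebesgue" "{z\<in>{0<..<a j}. \<bar>z - e\<bar> < d} \<in> sets lebesgue"
    by auto
qed

lemma I_split_self:
  assumes U: "star_lipschitz N a K U" and i: "i \<in> {1..N}" "s \<in> {0..a i}"
  shows "I_split d i U U s = I i U s"
  unfolding I_split_def I_def
proof (rule sum.cong[OF refl])
  fix j assume j: "j \<in> {1..N}"
  let ?A = "{z\<in>{0<..<a j}. d \<le> \<bar>z - offset i j s\<bar>}" and ?B = "{z\<in>{0<..<a j}. \<bar>z - offset i j s\<bar> < d}"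
  have eq: "{0<..<a j} = ?A \<union> ?B" and disj: "?A \<inter> ?B = {}" by auto
  have "set_integrable lebesgue ?A (\<lambda>z. (U j z - U i s) * k i j s \<bar>z - offset i j s\<bar>)"
    "set_integrable lebesgue ?B (\<lambda>z. (U j z - U i s) * k i j s \<bar>z - offset i j s\<bar>)"
    by (rule difference_integrable[OF U i(1) j i(2) near_far_sets(1)], force,
        rule difference_integrable[OF U i(1) j i(2) near_far_sets(2)], force)
  from set_integral_Un[OF disj this]
  show "(LINT z:?A|lebesgue. (U j z - U i s) * k i j s \<bar>z - offset i j s\<bar>) +
      (LINT z:?B|lebesgue. (U j z - U i s) * k i j s \<bar>z - offset i j s\<bar>) =
      (LINT z:{0<..<a j}|lebesgue. (U j z - U i s) * k i j s \<bar>z - offset i j s\<bar>)"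
    unfolding eq[symmetric] by simp
qed

lemma I_split_mono:
  assumes F: "star_lipschitz N a K F" "star_lipschitz N a L F'" and i: "i \<in> {1..N}" "s \<in> {0..a i}"
    and le: "\<And>j z. j \<in> {1..N} \<Longrightarrow> z \<in> {0..a j} \<Longrightarrow> \<bar>z - offset i j s\<bar> < d \<Longrightarrow> F j z - F i s \<le> F' j z - F' i s"
  shows "I_split d i U F s \<le> I_split d i U F' s"
  unfolding I_split_def
proof (intro sum_mono add_left_mono set_integral_mono)
  fix j assume j: "j \<in> {1..N}"
  have sub: "{z\<in>{0<..<a j}. \<bar>z - offset i j s\<bar> < d} \<subseteq> {0..a j}" by auto
  show "set_integrable lebesgue {z\<in>{0<..<a j}. \<bar>z - offset i j s\<bar> < d} (\<lambda>z. (F j z - F i s) * k i j s \<bar>z - offset i j s\<bar>)"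
    "set_integrable lebesgue {z\<in>{0<..<a j}. \<bar>z - offset i j s\<bar> < d} (\<lambda>z. (F' j z - F' i s) * k i j s \<bar>z - offset i j s\<bar>)"
    by (rule difference_integrable[OF F(1) i(1) j i(2) near_far_sets(2) sub],
        rule difference_integrable[OF F(2) i(1) j i(2) near_far_sets(2) sub])
  show "(F j z - F i s) * k i j s \<bar>z - offset i j s\<bar> \<le> (F' j z - F' i s) * k i j s \<bar>z - offset i j s\<bar>"
    if "z \<in> {z\<in>{0<..<a j}. \<bar>z - offset i j s\<bar> < d}" for z
    using le[OF j, of z] that by (intro mult_right_mono kernel_nonneg[OF i(1) j i(2)]) auto
qed

end

section \<open>Measurable sections and the geometry of the junction\<close>

text \<open>Joint Lebesgue measurability yields measurable sections for almost every
  \<open>s\<close> only. Lipschitz dependence on \<open>s\<close> extends this to every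
  \<open>s\<close>, as a pointwise limit of good sections.\<close>

lemma borel_measurable_section:
  fixes f :: "real \<Rightarrow> real \<Rightarrow> real"
  assumes meas: "(\<lambda>(s, r). f s r) \<in> borel_measurable (lebesgue_on ({0..a} \<times> {0<..}))"
    and lip: "\<And>s t r. s \<in> {0..a} \<Longrightarrow> t \<in> {0..a} \<Longrightarrow> 0 < r \<Longrightarrow> \<bar>f s r - f t r\<bar> \<le> C r * \<bar>s - t\<bar>"
    and a: "0 < a" and s: "s \<in> {0..a}"
  shows "(\<lambda>r. if 0 < r then f s r else 0) \<in> borel_measurable lebesgue"
proof -
  define F where "F = (\<lambda>x. if x \<in> {0..a} \<times> {0<..} then (\<lambda>(s, r). f s r) x else 0)"
  have "{0..a} \<times> {0::real<..} \<in> sets borel" by (intro borel_Times) auto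
  then have "{0..a} \<times> {0::real<..} \<in> sets lebesgue" by simp
  then have "F \<in> borel_measurable (completion lborel)"
    unfolding F_def using borel_measurable_if_I[OF meas] by simp
  \<comment> \<open>The completed measure is not a product; a Borel representative has measurable
    sections, and the exceptional null set is sliced by Fubini.\<close>
  then obtain g where g: "g \<in> borel_measurable lborel" "AE x in lborel. F x = g x"
    using completion_ex_borel_measurable_real by blast
  have "AE x in lborel \<Otimes>\<^sub>M lborel. F x = g x" using g(2) unfolding lborel_prod[symmetric] .
  then have ae: "AE s in lborel. AE r in lborel. F (s, r) = g (s, r)" by (rule lborel_pair.AE_pair)
  have sec: "(\<lambda>r. F (t, r)) \<in> borel_measurable lebesgue" if t: "AE r in lborel. F (t, r) = g (t, r)" for t
  proof -
    have "g \<in> borel_measurable (lborel \<Otimes>\<^sub>M lborel)" using g(1) unfolding lborel_prod[symmetric] .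
    then have "(\<lambda>r. g (t, r)) \<in> borel_measurable lborel" by (rule measurable_Pair2) simp
    then have "(\<lambda>r. g (t, r)) \<in> borel_measurable lebesgue" by (rule measurable_completion)
    moreover have "AE r in lebesgue. g (t, r) = F (t, r)"
      using AE_completion[OF t] by eventually_elim simp
    ultimately show ?thesis by (rule borel_measurable_AE)
  qed
  obtain Z where Z: "Z \<in> null_sets lborel" "{t. \<not> (AE r in lborel. F (t, r) = g (t, r))} \<subseteq> Z"
    using ae unfolding eventually_ae_filter by auto
  have dense: "\<exists>t\<in>{0..a}. \<bar>t - s\<bar> < e \<and> (\<lambda>r. F (t, r)) \<in> borel_measurable lebesgue" if e: "0 < e" for e
  proof (rule ccontr)
    assume no: "\<not> ?thesis"
    \<comment> \<open>Without a good \<open>t\<close> near \<open>s\<close>, a nonempty interval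
      would be a null set.\<close>
    define l u where "l = max 0 (s - e)" and "u = min a (s + e)"
    have lu: "l < u" using s a e by (auto simp: l_def u_def)
    have "{l<..<u} \<subseteq> Z"
    proof
      fix t assume t: "t \<in> {l<..<u}"
      then have "t \<in> {0..a}" "\<bar>t - s\<bar> < e" by (auto simp: l_def u_def)
      then show "t \<in> Z" using no sec Z(2) by blast
    qed
    then have "{l<..<u} \<in> null_sets lborel" using null_sets_subset[OF Z(1)] by auto
    then have "emeasure lborel {l<..<u} = 0" by auto
    then show False using lu by simp
  qed
  have "\<forall>n. \<exists>t\<in>{0..a}. \<bar>t - s\<bar> < 1 / real (Suc n) \<and> (\<lambda>r. F (t, r)) \<in> borel_measurable lebesgue"
    using dense by simp
  then obtain x where x: "\<And>n. x n \<in> {0..a}" "\<And>n. \<bar>x n - s\<bar> < 1 / real (Suc n)"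
    "\<And>n. (\<lambda>r. F (x n, r)) \<in> borel_measurable lebesgue" by metis
  have lim0: "(\<lambda>n. x n - s) \<longlonglongrightarrow> 0"
    by (rule LIMSEQ_norm_0) (use x(2) in simp)
  show ?thesis
  proof (rule borel_measurable_LIMSEQ_real[OF _ x(3)])
    fix r :: real
    show "(\<lambda>n. F (x n, r)) \<longlonglongrightarrow> (if 0 < r then f s r else 0)"
    proof (cases "0 < r")
      case True
      have "(\<lambda>n. C r * \<bar>x n - s\<bar>) \<longlonglongrightarrow> C r * \<bar>0\<bar>"
        by (intro tendsto_intros lim0)
      then have "(\<lambda>n. C r * \<bar>x n - s\<bar>) \<longlonglongrightarrow> 0" by simp
      moreover have "\<forall>\<^sub>F n in sequentially. norm (f (x n) r - f s r) \<le> C r * \<bar>x n - s\<bar>"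
        using lip[OF x(1) s True] by simp
      ultimately have "(\<lambda>n. f (x n) r - f s r) \<longlonglongrightarrow> 0" by (rule Lim_null_comparison[rotated])
      then show ?thesis using True x(1) by (simp add: F_def LIM_zero_iff)
    qed (simp add: F_def)
  qed
qed

section \<open>Arc length coordinates on the junction\<close>

lemma edge_segment:
  assumes "v i \<noteq> 0"
  shows "edge v i = gam v i ` {0<..<edge_len v i}" and "cedge v i = gam v i ` {0..edge_len v i}"
proof -
  have n: "0 < norm (v i)" using assms by simp
  have im: "(\<lambda>s. s / norm (v i)) ` {0<..<norm (v i)} = {0<..<1}" "(\<lambda>s. s / norm (v i)) ` {0..norm (v i)} = {0..1}"
    using n by (auto simp: image_iff intro!: bexI[where x = "_ * norm (v i)"])
  have "edge v i = (\<lambda>t. t *\<^sub>R v i) ` {0<..<1}" by (auto simp: edge_def)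
  then show "edge v i = gam v i ` {0<..<edge_len v i}"
    unfolding im[symmetric] image_image gam_def .
  have "edge v i = open_segment 0 (v i)"
    using assms by (auto simp: edge_def open_segment_image_interval)
  then have "cedge v i = closed_segment 0 (v i)" using assms by simp
  also have "\<dots> = (\<lambda>t. t *\<^sub>R v i) ` {0..1}" by (simp add: closed_segment_image_interval)
  finally show "cedge v i = gam v i ` {0..edge_len v i}"
    unfolding im[symmetric] image_image gam_def .
qed

lemma gam_0 [simp]: "gam v i 0 = 0"
  by (simp add: gam_def)

lemma gam_end: "v i \<noteq> 0 \<Longrightarrow> gam v i (edge_len v i) = v i"
  by (simp add: gam_def)

lemma norm_gam: "v i \<noteq> 0 \<Longrightarrow> 0 \<le> s \<Longrightarrow> norm (gam v i s) = s"
  by (simp add: gam_def)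

lemma gam_in_cedge: "v i \<noteq> 0 \<Longrightarrow> s \<in> {0..edge_len v i} \<Longrightarrow> gam v i s \<in> cedge v i"
  using edge_segment(2)[of v i] by simp

lemma gam_notin_other_cedge:
  assumes "junction N v" "i \<in> {1..N}" "j \<in> {1..N}" "i \<noteq> j" "0 < s"
  shows "gam v i s \<notin> cedge v j"
proof
  have v: "v i \<noteq> 0" "v j \<noteq> 0" "\<not> collinear {0, v j, v i}" using assms(1-4) by (auto simp: junction_def)
  assume "gam v i s \<in> cedge v j"
  then obtain t where t: "0 \<le> t" "gam v i s = gam v j t" using edge_segment(2)[of v j] v by auto
  then have "t = s" using norm_gam[of v i s] norm_gam[of v j t] v t(1) assms(5) by simp
  then have "(norm (v i) / s) *\<^sub>R gam v i s = (norm (v i) / s) *\<^sub>R gam v j s" using t by simp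
  then have "v i = (norm (v i) / norm (v j)) *\<^sub>R v j" using assms(5) v by (simp add: gam_def)
  then show False using v(3) unfolding collinear_lemma by blast
qed

lemma geo_gam:
  assumes J: "junction N v" and ij: "i \<in> {1..N}" "j \<in> {1..N}"
    and s: "s \<in> {0..edge_len v i}" and z: "z \<in> {0..edge_len v j}"
  shows "geo N v (gam v i s) (gam v j z) = \<bar>z - offset i j s\<bar>"
proof -
  have v: "v i \<noteq> 0" "v j \<noteq> 0" using J ij by (auto simp: junction_def)
  have c: "gam v i s \<in> cedge v i" "gam v j z \<in> cedge v j"
    using gam_in_cedge v s z by blast+
  show ?thesis
  proof (cases "i = j")
    case True
    have "gam v i s - gam v i z = ((s - z) / norm (v i)) *\<^sub>R v i"
      by (simp add: gam_def diff_divide_distrib scaleR_left_diff_distrib)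
    then have "norm (gam v i s - gam v i z) = \<bar>z - s\<bar>" using v by simp
    moreover have "geo N v (gam v i s) (gam v j z) = norm (gam v i s - gam v i z)"
      using True c ij unfolding geo_def by auto
    ultimately show ?thesis using True by (simp add: offset_def)
  next
    case False
    have "geo N v (gam v i s) (gam v j z) = s + z"
    \<comment> \<open>The vertex lies on every closed leg, so \<open>geo\<close> may take its first
      branch; both branches give the same value when one of the points is 0.\<close>
    proof (cases "s = 0 \<or> z = 0")
      case True
      then show ?thesis using norm_gam[of v i s] norm_gam[of v j z] v s z by (auto simp: geo_def)
    next
      case nz: False
      then have "0 < s" "0 < z" using s z by auto
      then have "\<not> (\<exists>l\<in>{1..N}. gam v i s \<in> cedge v l \<and> gam v j z \<in> cedge v l)"
        using gam_notin_other_cedge[OF J] ij False by metis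
      then have "geo N v (gam v i s) (gam v j z) = norm (gam v i s) + norm (gam v j z)"
        unfolding geo_def by (simp only: if_False)
      then show ?thesis using norm_gam[of v i s] norm_gam[of v j z] v s z by simp
    qed
    then show ?thesis using False s z by (simp add: offset_def)
  qed
qed

text \<open>\<open>norm x\<close> is the arc length coordinate of \<open>x\<close>. The choice of
  the leg is ambiguous at the vertex alone, where the leg functions in question agree.\<close>

definition glue :: "nat \<Rightarrow> (nat \<Rightarrow> real ^ 'd) \<Rightarrow> (nat \<Rightarrow> real \<Rightarrow> real) \<Rightarrow> real ^ 'd \<Rightarrow> real" where
  "glue N v U x = U (SOME i. i \<in> {1..N} \<and> x \<in> cedge v i) (norm x)"

lemma glue_gam:
  assumes J: "junction N v" and U: "star_lipschitz N (\<lambda>i. edge_len v i) K U"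
    and i: "i \<in> {1..N}" and s: "s \<in> {0..edge_len v i}"
  shows "glue N v U (gam v i s) = U i s"
proof -
  have v: "v i \<noteq> 0" using J i by (auto simp: junction_def)
  define l where "l = (SOME l. l \<in> {1..N} \<and> gam v i s \<in> cedge v l)"
  have "l \<in> {1..N} \<and> gam v i s \<in> cedge v l"
    unfolding l_def by (rule someI[of _ i]) (use i gam_in_cedge[of v i s] v s in auto)
  then have l: "l \<in> {1..N}" "gam v i s \<in> cedge v l" by auto
  have "U l s = U i s"
  proof (cases "s = 0")
    case True
    then show ?thesis using star_lipschitzD(2)[OF U l(1) i] by simp
  next
    case False
    then have "l = i" using gam_notin_other_cedge[OF J i l(1)] l(2) s by force
    then show ?thesis by simp
  qed
  then show ?thesis using norm_gam[of v i s] v s by (simp add: glue_def l_def)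
qed

text \<open>A derivative bounded on each compact leg makes a test function Lipschitz on the star,
  which gives integrability against the singular kernel.\<close>

lemma C1_edges:
  assumes J: "junction N v" and f: "f \<in> C1 N v"
  shows "\<exists>K. star_lipschitz N (\<lambda>i. edge_len v i) K (\<lambda>i s. f (gam v i s))"
    and "i \<in> {1..N} \<Longrightarrow> s \<in> {0..edge_len v i} \<Longrightarrow>
      ((\<lambda>t. f (gam v i t)) has_real_derivative edge_deriv v i f (gam v i s)) (at s within {0..edge_len v i})"
proof -
  have "\<exists>K\<ge>0. \<forall>s\<in>{0..edge_len v i}. \<forall>t\<in>{0..edge_len v i}. \<bar>f (gam v i s) - f (gam v i t)\<bar> \<le> K * \<bar>s - t\<bar>"
    if i: "i \<in> {1..N}" for i
  proof -
    obtain f' where f': "\<And>s. s \<in> {0..edge_len v i} \<Longrightarrow>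
        (f \<circ> gam v i has_real_derivative f' s) (at s within {0..edge_len v i})" "continuous_on {0..edge_len v i} f'"
      using f i unfolding C1_def C1_on_def by blast
    have "bounded (f' ` {0..edge_len v i})"
      using f'(2) by (intro compact_imp_bounded compact_continuous_image) auto
    then obtain K where K: "0 < K" "\<And>s. s \<in> {0..edge_len v i} \<Longrightarrow> norm (f' s) \<le> K"
      unfolding bounded_pos by auto
    have "norm ((f \<circ> gam v i) s - (f \<circ> gam v i) t) \<le> K * norm (s - t)"
      if "s \<in> {0..edge_len v i}" "t \<in> {0..edge_len v i}" for s t
      by (rule field_differentiable_bound[OF _ f'(1) K(2) that]) auto
    then show ?thesis using K(1) by (intro exI[of _ K]) auto
  qed
  then obtain K where K: "\<And>i. i \<in> {1..N} \<Longrightarrow> 0 \<le> K i"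
    "\<And>i s t. i \<in> {1..N} \<Longrightarrow> s \<in> {0..edge_len v i} \<Longrightarrow> t \<in> {0..edge_len v i} \<Longrightarrow>
      \<bar>f (gam v i s) - f (gam v i t)\<bar> \<le> K i * \<bar>s - t\<bar>"
    by metis
  have "star_lipschitz N (\<lambda>i. edge_len v i) (\<Sum>i=1..N. K i) (\<lambda>i s. f (gam v i s))"
  proof (rule star_lipschitzI)
    show "0 \<le> (\<Sum>i=1..N. K i)" using K(1) by (rule sum_nonneg)
    fix i s t assume *: "i \<in> {1..N}" "s \<in> {0..edge_len v i}" "t \<in> {0..edge_len v i}"
    have "K i \<le> (\<Sum>i=1..N. K i)" using K(1) *(1) by (intro member_le_sum) auto
    then have "K i * \<bar>s - t\<bar> \<le> (\<Sum>i=1..N. K i) * \<bar>s - t\<bar>" by (intro mult_right_mono) auto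
    then show "\<bar>f (gam v i s) - f (gam v i t)\<bar> \<le> (\<Sum>i=1..N. K i) * \<bar>s - t\<bar>"
      using K(2)[OF *] by linarith
  qed simp
  then show "\<exists>K. star_lipschitz N (\<lambda>i. edge_len v i) K (\<lambda>i s. f (gam v i s))" ..
next
  assume i: "i \<in> {1..N}" and s: "s \<in> {0..edge_len v i}"
  have v: "v i \<noteq> 0" using J i by (auto simp: junction_def)
  obtain p where p: "(f \<circ> gam v i has_real_derivative p) (at s within {0..edge_len v i})"
    using f i s unfolding C1_def C1_on_def by blast
  have "vector_derivative (f \<circ> gam v i) (at s within {0..edge_len v i}) = p"
    by (rule vector_derivative_within_closed_interval[OF _ s])
      (use v p in \<open>auto simp: has_real_derivative_iff_has_vector_derivative\<close>)
  then have "edge_deriv v i f (gam v i s) = p"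
    using norm_gam[of v i s] v s by (simp add: edge_deriv_def)
  then show "((\<lambda>t. f (gam v i t)) has_real_derivative edge_deriv v i f (gam v i s)) (at s within {0..edge_len v i})"
    using p by (simp add: comp_def)
qed

lemma C0_if_continuous_on:
  assumes "\<And>i. i \<in> {1..N} \<Longrightarrow> continuous_on {0..edge_len v i} (u \<circ> gam v i)"
  shows "u \<in> C0 N v"
proof -
  have "((u \<circ> gam v i) \<longlongrightarrow> (u \<circ> gam v i) x) (at x within {0..edge_len v i})"
    if "i \<in> {1..N}" "x \<in> {0..edge_len v i}" for i x
    using assms[OF that(1)] that(2) unfolding continuous_on_def by blast
  then show ?thesis
    unfolding C0_def USC_def LSC_def usc_on_def lsc_on_def
    using order_tendstoD by (blast intro: order_tendstoD)
qed

lemma Gam_eq: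
  assumes "junction N v"
  shows "Gam N v = (\<Union>i\<in>{1..N}. gam v i ` {0..edge_len v i})"
  using assms edge_segment(2)[of v] unfolding Gam_def junction_def by simp

lemma gam_in_gball:
  assumes "junction N v" "i \<in> {1..N}" "j \<in> {1..N}" "s \<in> {0..edge_len v i}" "z \<in> {0..edge_len v j}"
  shows "gam v j z \<in> gball N v d (gam v i s) \<longleftrightarrow> \<bar>z - offset i j s\<bar> < d"
proof -
  have "gam v j z \<in> Gam N v" using assms(3,5) unfolding Gam_eq[OF assms(1)] by blast
  then show ?thesis using geo_gam[OF assms] unfolding gball_def by simp
qed

lemma nonloc_eq_I_split:
  fixes v :: "nat \<Rightarrow> real ^ 'd"
  assumes J: "junction N v" and K: "star_kernel N (\<lambda>i. edge_len v i) Lam sig k"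
    and k: "\<And>i j s r. 0 < r \<Longrightarrow> k i j s r = nu i j (gam v i s) r"
    and U: "star_lipschitz N (\<lambda>i. edge_len v i) L U" and F: "\<And>j. j \<in> {1..N} \<Longrightarrow> F j 0 = f 0"
    and Ff: "\<And>j z. F j z = f (gam v j z)"
    and i: "i \<in> {1..N}" and s: "s \<in> {0..edge_len v i}"
  shows "nonloc N v nu i (Gam N v - gball N v d (gam v i s)) (glue N v U) (gam v i s) +
      nonloc N v nu i (gball N v d (gam v i s)) f (gam v i s) =
    star_kernel.I_split N (\<lambda>i. edge_len v i) k d i U F s"
proof -
  \<comment> \<open>\<open>nu\<close> and \<open>k\<close> agree at positive distance. At distance
    0, where \<open>nu\<close> is unconstrained, the increment vanishes.\<close>
  have term_eq: "(g (gam v j z) - g (gam v i s)) * nu i j (gam v i s) (geo N v (gam v i s) (gam v j z)) =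
      (g (gam v j z) - g (gam v i s)) * k i j s \<bar>z - offset i j s\<bar>"
    if j: "j \<in> {1..N}" "z \<in> {0..edge_len v j}" for g :: "real ^ 'd \<Rightarrow> real" and j z
  proof (cases "z = offset i j s")
    case True
    then have "gam v j z = gam v i s"
    proof (cases "i = j")
      case False
      then have "z = 0" "s = 0" using True j(2) s by (auto simp: offset_def)
      then show ?thesis by simp
    qed (use True in \<open>simp add: offset_def\<close>)
    then show ?thesis by simp
  next
    case False
    then show ?thesis using geo_gam[OF J i j(1) s j(2)] k by simp
  qed
  have "set_lebesgue_integral lebesgue {z \<in> {0<..<edge_len v j}. gam v j z \<in> Gam N v - gball N v d (gam v i s)}
      (\<lambda>z. (glue N v U (gam v j z) - glue N v U (gam v i s)) * nu i j (gam v i s) (geo N v (gam v i s) (gam v j z))) =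
    (LINT z:{z\<in>{0<..<edge_len v j}. d \<le> \<bar>z - offset i j s\<bar>}|lebesgue. (U j z - U i s) * k i j s \<bar>z - offset i j s\<bar>)"
    if j: "j \<in> {1..N}" for j
  proof -
    have mem: "gam v j z \<in> Gam N v - gball N v d (gam v i s) \<longleftrightarrow> d \<le> \<bar>z - offset i j s\<bar>"
      if z: "z \<in> {0<..<edge_len v j}" for z
    proof -
      have "z \<in> {0..edge_len v j}" using z by simp
      moreover from this have "gam v j z \<in> Gam N v" using j unfolding Gam_eq[OF J] by blast
      ultimately show ?thesis using gam_in_gball[OF J i j s, of z d] by auto
    qed
    have "{z \<in> {0<..<edge_len v j}. gam v j z \<in> Gam N v - gball N v d (gam v i s)} =
        {z\<in>{0<..<edge_len v j}. d \<le> \<bar>z - offset i j s\<bar>}"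
      using mem by blast
    then show ?thesis unfolding set_lebesgue_integral_def
      using term_eq[OF j, of _ "glue N v U"] glue_gam[OF J U j] glue_gam[OF J U i s]
      by (intro Bochner_Integration.integral_cong) (auto simp: indicator_def)
  qed
  moreover have "set_lebesgue_integral lebesgue {z \<in> {0<..<edge_len v j}. gam v j z \<in> gball N v d (gam v i s)}
      (\<lambda>z. (f (gam v j z) - f (gam v i s)) * nu i j (gam v i s) (geo N v (gam v i s) (gam v j z))) =
    (LINT z:{z\<in>{0<..<edge_len v j}. \<bar>z - offset i j s\<bar> < d}|lebesgue. (F j z - F i s) * k i j s \<bar>z - offset i j s\<bar>)"
    if j: "j \<in> {1..N}" for j
  proof -
    have "{z \<in> {0<..<edge_len v j}. gam v j z \<in> gball N v d (gam v i s)} =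
        {z\<in>{0<..<edge_len v j}. \<bar>z - offset i j s\<bar> < d}"
      using gam_in_gball[OF J i j s, of _ d] by auto
    then show ?thesis unfolding set_lebesgue_integral_def Ff
      using term_eq[OF j, of _ f] by (intro Bochner_Integration.integral_cong) (auto simp: indicator_def)
  qed
  ultimately show ?thesis
    unfolding nonloc_def star_kernel.I_split_def[OF K] sum.distrib by simp
qed

section \<open>Transfer of the leg problem to the junction\<close>

theorem theorem4p4:
  fixes N :: nat
    and v :: "nat \<Rightarrow> real ^ 'd"
    and lam B C_H Lam sig :: real
    and h :: "nat \<Rightarrow> real"
    and H :: "nat \<Rightarrow> real ^ 'd \<Rightarrow> real \<Rightarrow> real"
    and nu :: "nat \<Rightarrow> nat \<Rightarrow> real ^ 'd \<Rightarrow> real \<Rightarrow> real"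
  assumes junction: "junction N v"
    and lam: "lam > 0"
    and H_cont: "\<And>i. i \<in> {1..N} \<Longrightarrow> continuous_on (cedge v i \<times> UNIV) (\<lambda>(x, p). H i x p)"
    and C_H: "C_H > 1"
    and H_x: "\<And>i x y p. \<lbrakk>i \<in> {1..N}; x \<in> cedge v i; y \<in> cedge v i\<rbrakk> \<Longrightarrow>
        \<bar>H i x p - H i y p\<bar> \<le> C_H * (1 + \<bar>p\<bar>) * norm (x - y)"
    and H_p: "\<And>i x p q. \<lbrakk>i \<in> {1..N}; x \<in> cedge v i\<rbrakk> \<Longrightarrow>
        \<bar>H i x p - H i x q\<bar> \<le> C_H * \<bar>p - q\<bar>"
    and H_growth: "\<And>i x p. \<lbrakk>i \<in> {1..N}; x \<in> cedge v i\<rbrakk> \<Longrightarrow>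
        \<bar>p\<bar> / C_H - C_H \<le> H i x p \<and> H i x p \<le> C_H * (1 + \<bar>p\<bar>)"
    and nu_meas: "\<And>i j. \<lbrakk>i \<in> {1..N}; j \<in> {1..N}\<rbrakk> \<Longrightarrow> kernel_measurable v i (nu i j)"
    and Lam: "Lam > 0"
    and sig: "0 < sig" "sig < 1"
    and nu_bound: "\<And>i j x r. \<lbrakk>i \<in> {1..N}; j \<in> {1..N}; x \<in> cedge v i; r > 0\<rbrakk> \<Longrightarrow>
        0 \<le> nu i j x r \<and> nu i j x r \<le> Lam * r powr (- 1 - sig)"
    and nu_x: "\<And>i j x y r. \<lbrakk>i \<in> {1..N}; j \<in> {1..N}; x \<in> cedge v i; y \<in> cedge v i; r > 0\<rbrakk> \<Longrightarrow>
        \<bar>nu i j x r - nu i j y r\<bar> \<le> Lam * r powr (- 1 - sig) * norm (x - y)"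
  shows "\<exists>u. visc_solution N v lam H nu B h u \<and>
    (\<forall>a. 0 < a \<and> a < 1 \<longrightarrow> u \<in> Hoelder N v a) \<and>
    locally_Lipschitz N v (Gam N v - v ` {1..N}) u"
proof -
  define a where "a i = edge_len v i" for i
  define k where "k i j s r = (if 0 < r then nu i j (gam v i s) r else 0)" for i j s r
  define Hc where "Hc i s p = H i (gam v i s) p" for i s p
  have N: "1 \<le> N" using junction by (simp add: junction_def)
  have v: "v i \<noteq> 0" if "i \<in> {1..N}" for i using junction that by (auto simp: junction_def)
  have a_pos: "0 < a i" if "i \<in> {1..N}" for i using v[OF that] by (simp add: a_def)
  have ce: "gam v i s \<in> cedge v i" if "i \<in> {1..N}" "s \<in> {0..a i}" for i s
    using gam_in_cedge[of v i s] v[OF that(1)] that(2) by (simp add: a_def)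
  have dist_gam: "norm (gam v i s - gam v i t) = \<bar>s - t\<bar>" if "i \<in> {1..N}" for i s t
  proof -
    have "gam v i s - gam v i t = ((s - t) / norm (v i)) *\<^sub>R v i"
      by (simp add: gam_def diff_divide_distrib scaleR_left_diff_distrib)
    then show ?thesis using v[OF that] by simp
  qed
  have kernel: "star_kernel N a Lam sig k"
  proof
    show "\<bar>k i j s r - k i j t r\<bar> \<le> Lam * r powr (- 1 - sig) * \<bar>s - t\<bar>"
      if "i \<in> {1..N}" "j \<in> {1..N}" "s \<in> {0..a i}" "t \<in> {0..a i}" "0 < r" for i j s t r
      using nu_x[OF that(1,2) ce[OF that(1,3)] ce[OF that(1,4)] that(5)] dist_gam[OF that(1)] that(5)
      by (simp add: k_def)
    show "k i j s \<in> borel_measurable lebesgue"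
      if "i \<in> {1..N}" "j \<in> {1..N}" "s \<in> {0..a i}" for i j s
      unfolding k_def
    proof (rule borel_measurable_section[where C = "\<lambda>r. Lam * r powr (- 1 - sig)"])
      show "(\<lambda>(s, r). nu i j (gam v i s) r) \<in> borel_measurable (lebesgue_on ({0..a i} \<times> {0<..}))"
        using nu_meas[OF that(1,2)] by (simp add: kernel_measurable_def a_def)
      show "\<bar>nu i j (gam v i s) r - nu i j (gam v i t) r\<bar> \<le> Lam * r powr (- 1 - sig) * \<bar>s - t\<bar>"
        if "s \<in> {0..a i}" "t \<in> {0..a i}" "0 < r" for s t r
        using nu_x[OF \<open>i \<in> {1..N}\<close> \<open>j \<in> {1..N}\<close> ce[OF _ that(1)] ce[OF _ that(2)] that(3)] dist_gam
          \<open>i \<in> {1..N}\<close> by simp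
    qed (use a_pos that in auto)
  qed (use N a_pos Lam sig nu_bound ce in \<open>auto simp: k_def\<close>)
  interpret star_kernel N a Lam sig k by (rule kernel)
  \<comment> \<open>The first summand serves \<open>M_lam\<close>, the second dominates each
    \<open>\<bar>h i\<bar>\<close>.\<close>
  define M where "M = C_H * (1 + \<bar>B\<bar>) / lam + (\<Sum>i=1..N. \<bar>h i\<bar>)"
  have "star_hj N a lam B C_H M h Hc I"
  proof
    show "continuous_on ({0..a i} \<times> UNIV) (\<lambda>(s, p). Hc i s p)" if "i \<in> {1..N}" for i
    proof -
      have "continuous_on ({0..a i} \<times> UNIV) (\<lambda>x. (gam v i (fst x), snd x))"
        unfolding gam_def using v[OF that] by (intro continuous_intros) auto
      moreover have "(\<lambda>x. (gam v i (fst x), snd x)) ` ({0..a i} \<times> UNIV) \<subseteq> cedge v i \<times> UNIV"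
        using ce[OF that] by auto
      ultimately have "continuous_on ({0..a i} \<times> UNIV)
          (\<lambda>x. (\<lambda>(x, p). H i x p) (gam v i (fst x), snd x))"
        by (rule continuous_on_compose2[OF H_cont[OF that]])
      then show ?thesis by (simp add: Hc_def case_prod_unfold)
    qed
    show "C_H * (1 + \<bar>B\<bar>) \<le> lam * M"
    proof -
      have "lam * M = C_H * (1 + \<bar>B\<bar>) + lam * (\<Sum>i=1..N. \<bar>h i\<bar>)"
        unfolding M_def distrib_left[of lam] using lam by simp
      moreover have "0 \<le> lam * (\<Sum>i=1..N. \<bar>h i\<bar>)" using lam by (intro mult_nonneg_nonneg sum_nonneg) auto
      ultimately show ?thesis by linarith
    qed
    show "\<bar>h i\<bar> \<le> M" if "i \<in> {1..N}" for i
    proof -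
      have "\<bar>h i\<bar> \<le> (\<Sum>i=1..N. \<bar>h i\<bar>)" using that by (intro member_le_sum) auto
      moreover have "0 \<le> C_H * (1 + \<bar>B\<bar>) / lam" using lam C_H by simp
      ultimately show ?thesis by (simp add: M_def)
    qed
    show "\<exists>d>0. \<forall>U W i s. star_lipschitz N a K U \<and> star_lipschitz N a K W \<and>
      (\<forall>j\<in>{1..N}. \<forall>t\<in>{0..a j}. U j t \<le> W j t) \<and> i \<in> {1..N} \<and> s \<in> {0..a i} \<and> W i s \<le> U i s + d \<longrightarrow>
      I i U s \<le> I i W s + e" if "0 < e" for K e
      by (rule I_stable[OF that])
    show "\<exists>C. \<forall>K U i s. star_lipschitz N a K U \<and>
      (\<forall>j\<in>{1..N}. \<forall>t\<in>{0..a j}. \<bar>U j t\<bar> \<le> M) \<and> i \<in> {1..N} \<and> s \<in> {0..a i} \<longrightarrow> I i U s \<le> \<theta> * K + C"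
      if "0 < \<theta>" for \<theta>
      by (rule I_growth[OF that])
    show "\<bar>p\<bar> / C_H - C_H \<le> Hc i s p" "Hc i s p \<le> C_H * (1 + \<bar>p\<bar>)"
      if "i \<in> {1..N}" "s \<in> {0..a i}" for i s p
      using H_growth[OF that(1) ce[OF that]] by (simp_all add: Hc_def)
  qed (fact N a_pos lam C_H | (rule I_cont I_const, (assumption+)?))+
  then interpret hj: star_hj N a lam B C_H M h Hc I .
  obtain L U where U: "star_lipschitz N a L U" "hj.subsol U" "hj.supersol U"
    by (rule hj.lipschitz_solution_exists)
  define u where "u = glue N v U"
  have a_eq: "a = (\<lambda>i. edge_len v i)" by (simp add: a_def fun_eq_iff)
  have uU: "u (gam v i s) = U i s" if "i \<in> {1..N}" "s \<in> {0..a i}" for i s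
    using glue_gam[OF junction U(1)[unfolded a_eq] that(1)] that(2) by (simp add: u_def a_def)
  have cont: "continuous_on {0..edge_len v i} (u \<circ> gam v i)" if "i \<in> {1..N}" for i
  proof -
    have "continuous_on {0..edge_len v i} (U i)"
      using star_lipschitz_continuous_on[OF U(1) that] by (simp add: a_def)
    then show ?thesis
      by (rule continuous_on_eq) (use uU that in \<open>simp add: a_def\<close>)
  qed
  have C0: "u \<in> C0 N v" by (rule C0_if_continuous_on[OF cont])
  define F where "F f = (\<lambda>j z. f (gam v j z))" for f :: "real ^ 'd \<Rightarrow> real"
  have Gop_eq: "Gop N v lam H nu i d u f p (gam v i s) = hj.G i U s p + I i U s - I_split d i U (F f) s"
    if "i \<in> {1..N}" "s \<in> {0..a i}" for i s d f p
  proof -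
    have "nonloc N v nu i (Gam N v - gball N v d (gam v i s)) u (gam v i s) +
      nonloc N v nu i (gball N v d (gam v i s)) f (gam v i s) = I_split d i U (F f) s"
      unfolding u_def a_eq
      by (rule nonloc_eq_I_split[OF junction kernel[unfolded a_eq] _ U(1)[unfolded a_eq]])
        (use that in \<open>auto simp: k_def F_def a_def\<close>)
    then show ?thesis using uU[OF that] by (simp add: Gop_def hj.G_def Hc_def)
  qed
  have F_lip: "\<exists>K. star_lipschitz N a K (F f)" if "f \<in> C1 N v" for f
    using C1_edges(1)[OF junction that] by (simp add: F_def a_eq)
  have F_der: "(F f i has_real_derivative edge_deriv v i f (gam v i s)) (at s within {0..a i})"
    if "f \<in> C1 N v" "i \<in> {1..N}" "s \<in> {0..a i}" for f i s
    using C1_edges(2)[OF junction that(1,2)] that(3) by (simp add: F_def a_def)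
  have ball: "gam v j z \<in> gball N v d (gam v i s)"
    if "i \<in> {1..N}" "j \<in> {1..N}" "s \<in> {0..a i}" "z \<in> {0..a j}" "\<bar>z - offset i j s\<bar> < d" for i j s z d
    using gam_in_gball[OF junction that(1,2)] that(3-5) by (simp add: a_def)
  have edge_pt: "\<exists>s. 0 < s \<and> s < a i \<and> x = gam v i s" if "i \<in> {1..N}" "x \<in> edge v i" for i x
    using edge_segment(1)[of v i] v[OF that(1)] that(2) by (auto simp: a_def)
  have end_pt: "v i = gam v i (a i)" if "i \<in> {1..N}" for i
    using gam_end[of v i] v[OF that] by (simp add: a_def)
  \<comment> \<open>A test function touching from above in the ball has larger increments there, so
    the split term dominates \<open>I i U s\<close> and \<open>Gop\<close> is at most
    \<open>G\<close>. The jet part does not involve \<open>p\<close> and is later extracted with the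
    dummy value 0.\<close>
  have sub: "Gop N v lam H nu i d u f p (gam v i s) \<le> hj.G i U s p \<and>
      superjet {0..a i} (U i) s (edge_deriv v i f (gam v i s))"
    if i: "i \<in> {1..N}" "s \<in> {0..a i}" and f: "f \<in> C1 N v" and d: "0 < d"
      and max: "\<forall>y\<in>gball N v d (gam v i s). u y - f y \<le> u (gam v i s) - f (gam v i s)" for i s d f p
  proof
    have le: "U j z - F f j z \<le> U i s - F f i s"
      if "j \<in> {1..N}" "z \<in> {0..a j}" "\<bar>z - offset i j s\<bar> < d" for j z
      using bspec[OF max ball[OF i(1) that(1) i(2) that(2,3)]] uU[OF that(1,2)] uU[OF i] by (simp add: F_def)
    obtain K where "star_lipschitz N a K (F f)" using F_lip[OF f] by blast
    then have "I_split d i U U s \<le> I_split d i U (F f) s"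
      by (rule I_split_mono[OF U(1) _ i]) (use le in \<open>simp add: algebra_simps\<close>)
    then show "Gop N v lam H nu i d u f p (gam v i s) \<le> hj.G i U s p"
      using Gop_eq[OF i] I_split_self[OF U(1) i] by simp
    show "superjet {0..a i} (U i) s (edge_deriv v i f (gam v i s))"
      by (rule superjet_touch_deriv[OF F_der[OF f i] d]) (use le[OF i(1)] in \<open>simp add: offset_def\<close>)
  qed
  have super: "hj.G i U s p \<le> Gop N v lam H nu i d u f p (gam v i s) \<and>
      superjet {0..a i} (\<lambda>t. - U i t) s (- edge_deriv v i f (gam v i s))"
    if i: "i \<in> {1..N}" "s \<in> {0..a i}" and f: "f \<in> C1 N v" and d: "0 < d"
      and min: "\<forall>y\<in>gball N v d (gam v i s). u (gam v i s) - f (gam v i s) \<le> u y - f y" for i s d f p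
  proof
    have le: "U i s - F f i s \<le> U j z - F f j z"
      if "j \<in> {1..N}" "z \<in> {0..a j}" "\<bar>z - offset i j s\<bar> < d" for j z
      using bspec[OF min ball[OF i(1) that(1) i(2) that(2,3)]] uU[OF that(1,2)] uU[OF i] by (simp add: F_def)
    obtain K where "star_lipschitz N a K (F f)" using F_lip[OF f] by blast
    then have "I_split d i U (F f) s \<le> I_split d i U U s"
      by (rule I_split_mono[OF _ U(1) i]) (use le in \<open>simp add: algebra_simps\<close>)
    then show "hj.G i U s p \<le> Gop N v lam H nu i d u f p (gam v i s)"
      using Gop_eq[OF i] I_split_self[OF U(1) i] by simp
    show "superjet {0..a i} (\<lambda>t. - U i t) s (- edge_deriv v i f (gam v i s))"
      by (rule superjet_touch_deriv[OF DERIV_minus[OF F_der[OF f i]] d])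
        (use le[OF i(1)] in \<open>simp add: offset_def algebra_simps\<close>)
  qed
  have zero: "0 \<in> {0..a i}" "a i \<in> {0..a i}" if "i \<in> {1..N}" for i using a_pos[OF that] by auto
  have one: "1 \<in> {1..N}" using N by simp
  have subsol: "visc_subsolution N v lam H nu B h u"
    unfolding visc_subsolution_def
  proof (intro conjI ballI allI impI)
    show "u \<in> USC N v" using C0 by (simp add: C0_def)
    fix x d f
    assume d: "0 < d" and f: "f \<in> C1 N v" and max: "\<forall>y\<in>gball N v d x. u y - f y \<le> u x - f x"
    show "Gop N v lam H nu i d u f (edge_deriv v i f x) x \<le> 0" if i: "i \<in> {1..N}" "x \<in> edge v i" for i
    proof -
      obtain s where s: "0 < s" "s < a i" "x = gam v i s" using edge_pt[OF i] by blast
      then have "s \<in> {0..a i}" by simp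
      note * = sub[OF i(1) this f d max[unfolded s(3)]]
      have "hj.G i U s (edge_deriv v i f x) \<le> 0"
        using U(2) i(1) s *[of 0] unfolding hj.subsol_def by blast
      then show ?thesis using *[of "edge_deriv v i f x"] s(3) by auto
    qed
    show "min (Min ((\<lambda>i. Gop N v lam H nu i d u f (edge_deriv v i f 0) 0) ` {1..N}))
        ((\<Sum>i=1..N. - edge_deriv v i f 0) - B) \<le> 0" if x: "x = 0"
    proof -
      have *: "Gop N v lam H nu i d u f p 0 \<le> hj.G i U 0 p \<and> superjet {0..a i} (U i) 0 (edge_deriv v i f 0)"
        if i: "i \<in> {1..N}" for i p
        using sub[OF i zero(1)[OF i] f d, of p] max x by simp
      then have "(\<exists>i\<in>{1..N}. hj.G i U 0 (edge_deriv v i f 0) \<le> 0) \<or> - (\<Sum>i=1..N. edge_deriv v i f 0) \<le> B"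
        using U(2)[unfolded hj.subsol_def, THEN conjunct2, THEN conjunct1,
            THEN spec[of _ "\<lambda>i. edge_deriv v i f 0"]] by blast
      then show ?thesis
      proof
        assume "\<exists>i\<in>{1..N}. hj.G i U 0 (edge_deriv v i f 0) \<le> 0"
        then obtain i where i: "i \<in> {1..N}" "Gop N v lam H nu i d u f (edge_deriv v i f 0) 0 \<le> 0"
          using * by (meson order_trans)
        have "Min ((\<lambda>i. Gop N v lam H nu i d u f (edge_deriv v i f 0) 0) ` {1..N})
            \<le> Gop N v lam H nu i d u f (edge_deriv v i f 0) 0"
          using i(1) by (intro Min_le) auto
        then show ?thesis using i(2) by linarith
      qed (simp add: sum_negf)
    qed
    show "min (Gop N v lam H nu i d u f (edge_deriv v i f x) x) (u x - h i) \<le> 0"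
      if i: "i \<in> {1..N}" "x = v i" for i
    proof -
      have x: "x = gam v i (a i)" using i end_pt by simp
      note * = sub[OF i(1) zero(2)[OF i(1)] f d max[unfolded x]]
      have "hj.G i U (a i) (edge_deriv v i f x) \<le> 0 \<or> U i (a i) \<le> h i"
        using U(2) i(1) x *[of 0] unfolding hj.subsol_def by blast
      then show ?thesis
        using *[of "edge_deriv v i f x"] x uU[OF i(1) zero(2)[OF i(1)]] by auto
    qed
  qed
  have supersol: "visc_supersolution N v lam H nu B h u"
    unfolding visc_supersolution_def
  proof (intro conjI ballI allI impI)
    show "u \<in> LSC N v" using C0 by (simp add: C0_def)
    fix x d f
    assume d: "0 < d" and f: "f \<in> C1 N v" and min: "\<forall>y\<in>gball N v d x. u x - f x \<le> u y - f y"
    show "0 \<le> Gop N v lam H nu i d u f (edge_deriv v i f x) x" if i: "i \<in> {1..N}" "x \<in> edge v i" for i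
    proof -
      obtain s where s: "0 < s" "s < a i" "x = gam v i s" using edge_pt[OF i] by blast
      then have "s \<in> {0..a i}" by simp
      note * = super[OF i(1) this f d min[unfolded s(3)]]
      have "0 \<le> hj.G i U s (edge_deriv v i f x)"
        using U(3) i(1) s *[of 0] unfolding hj.supersol_def by blast
      then show ?thesis using *[of "edge_deriv v i f x"] s(3) by auto
    qed
    show "0 \<le> max (Max ((\<lambda>i. Gop N v lam H nu i d u f (edge_deriv v i f 0) 0) ` {1..N}))
        ((\<Sum>i=1..N. - edge_deriv v i f 0) - B)" if x: "x = 0"
    proof -
      have *: "hj.G i U 0 p \<le> Gop N v lam H nu i d u f p 0 \<and>
          superjet {0..a i} (\<lambda>t. - U i t) 0 (- edge_deriv v i f 0)"
        if i: "i \<in> {1..N}" for i p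
        using super[OF i zero(1)[OF i] f d, of p] min x by simp
      then have "(\<exists>i\<in>{1..N}. 0 \<le> hj.G i U 0 (edge_deriv v i f 0)) \<or> B \<le> - (\<Sum>i=1..N. edge_deriv v i f 0)"
        using U(3)[unfolded hj.supersol_def, THEN conjunct2, THEN conjunct1,
            THEN spec[of _ "\<lambda>i. edge_deriv v i f 0"]] by blast
      then show ?thesis
      proof
        assume "\<exists>i\<in>{1..N}. 0 \<le> hj.G i U 0 (edge_deriv v i f 0)"
        then obtain i where i: "i \<in> {1..N}" "0 \<le> Gop N v lam H nu i d u f (edge_deriv v i f 0) 0"
          using * by (meson order_trans)
        have "Gop N v lam H nu i d u f (edge_deriv v i f 0) 0 \<le>
            Max ((\<lambda>i. Gop N v lam H nu i d u f (edge_deriv v i f 0) 0) ` {1..N})"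
          using i(1) by (intro Max_ge) auto
        then show ?thesis using i(2) by linarith
      qed (simp add: sum_negf)
    qed
    show "0 \<le> max (Gop N v lam H nu i d u f (edge_deriv v i f x) x) (u x - h i)"
      if i: "i \<in> {1..N}" "x = v i" for i
    proof -
      have x: "x = gam v i (a i)" using i end_pt by simp
      note * = super[OF i(1) zero(2)[OF i(1)] f d min[unfolded x]]
      have "0 \<le> hj.G i U (a i) (edge_deriv v i f x) \<or> h i \<le> U i (a i)"
        using U(3) i(1) x *[of 0] unfolding hj.supersol_def by blast
      then show ?thesis
        using *[of "edge_deriv v i f x"] x uU[OF i(1) zero(2)[OF i(1)]] by auto
    qed
  qed
  have hoelder: "u \<in> Hoelder N v \<alpha>" if \<alpha>: "0 < \<alpha>" "\<alpha> < 1" for \<alpha>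
    unfolding Hoelder_def
  proof (intro CollectI conjI C0 ballI exI)
    fix i s t assume *: "i \<in> {1..N}" "s \<in> {0..edge_len v i}" "t \<in> {0..edge_len v i}"
    have st: "s \<in> {0..a i}" "t \<in> {0..a i}" using * by (simp_all add: a_def)
    have "\<bar>U i s - U i t\<bar> \<le> L * \<bar>s - t\<bar>" by (rule star_lipschitzD(1)[OF U(1) *(1) st])
    \<comment> \<open>Lipschitz implies Hoelder on a leg, because
      \<open>\<bar>s - t\<bar> \<le> a i\<close>.\<close>
    also have "\<bar>s - t\<bar> = \<bar>s - t\<bar> powr (1 - \<alpha>) * \<bar>s - t\<bar> powr \<alpha>"
      by (simp flip: powr_add)
    also have "L * \<dots> \<le> L * (a i powr (1 - \<alpha>) * \<bar>s - t\<bar> powr \<alpha>)"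
      using st \<alpha> star_lipschitz_nonneg[OF U(1)]
      by (intro mult_left_mono mult_right_mono powr_mono2) auto
    finally show "\<bar>(u \<circ> gam v i) s - (u \<circ> gam v i) t\<bar> \<le> (L * a i powr (1 - \<alpha>)) * \<bar>s - t\<bar> powr \<alpha>"
      using uU[OF *(1)] st by (simp add: mult.assoc)
  qed
  have "locally_Lipschitz N v (Gam N v - v ` {1..N}) u"
    unfolding locally_Lipschitz_def
  proof (rule ballI)
    fix x
    \<comment> \<open>\<open>L\<close> is valid for the geodesic distance on the whole junction,
      across the vertex by \<open>star_lipschitz_offset\<close>; the radius 1 is arbitrary.\<close>
    have "\<bar>u y - u z\<bar> \<le> L * geo N v y z"
      if yz: "y \<in> (Gam N v - v ` {1..N}) \<inter> gball N v 1 x" "z \<in> (Gam N v - v ` {1..N}) \<inter> gball N v 1 x" for y z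
    proof -
      from yz obtain i s j t where y: "i \<in> {1..N}" "s \<in> {0..a i}" "y = gam v i s"
        and z: "j \<in> {1..N}" "t \<in> {0..a j}" "z = gam v j t"
        unfolding Gam_eq[OF junction] a_def by auto
      have "\<bar>U j t - U i s\<bar> \<le> L * \<bar>t - offset i j s\<bar>"
        by (rule star_lipschitz_offset[OF U(1) y(1) z(1) y(2) z(2)])
      then show "\<bar>u y - u z\<bar> \<le> L * geo N v y z"
        using geo_gam[OF junction y(1) z(1)] y(2,3) z(2,3) uU[OF y(1,2)] uU[OF z(1,2)]
        by (simp add: a_def abs_minus_commute)
    qed
    then show "\<exists>r>0. \<exists>L. \<forall>y\<in>(Gam N v - v ` {1..N}) \<inter> gball N v r x.
        \<forall>z\<in>(Gam N v - v ` {1..N}) \<inter> gball N v r x. \<bar>u y - u z\<bar> \<le> L * geo N v y z"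
      using zero_less_one by blast
  qed
  then show ?thesis using C0 subsol supersol hoelder unfolding visc_solution_def by blast
qed

end
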